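(* Let $\mathcal M$ be a von Neumann algebra with closed unit ball $\mathcal M_1$ and let $\Omega$ be a compact Hausdorff space such that the set $S\subset\Omega$ of isolated points of $\Omega$ is dense in $\Omega$. Let $f$ be a $C^*$-extreme point of the closed unit ball $C(\Omega,\mathcal M)_1$. Then $f(\omega)$ is a $C^*$-extreme point of $\mathcal M_1$ for all $\omega\in\Omega$.
   Context: $C(\Omega,\mathcal M)$ is the unital $C^*$-algebra of all norm-continuous functions $\Omega\to\mathcal M$ with the supremum norm and pointwise operations. For a unital $C^*$-algebra $\mathcal A$ with identity $\mathbf 1$ and closed unit ball $\mathcal A_1$, an element $x\in\mathcal A_1$ is a $C^*$-extreme point of $\mathcal A_1$ if, whenever $x=\sum_{i=1}^k t_i^*x_it_i$ with $x_1,\dots,x_k\in\mathcal A_1$ and $t_1,\dots,t_k\in\mathcal A$ invertible with $\sum_{i=1}^k t_i^*t_i=\mathbf 1$, there exist unitaries $u_1,\dots,u_k\in\mathcal A$ such that $x_i=u_i^*xu_i$ for all $i$. *)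

theory Defs
  imports "HOL-Analysis.Analysis" "HOL-Algebra.Group"
begin

section \<open>Complex Hilbert spaces\<close>

text \<open>
  The inner product is linear in its first argument.  Since the norm axiom expresses
  \<open>cinner x x\<close> as the square of a norm, it includes positive definiteness.
\<close>

class complex_hilbert_space = real_normed_vector + complete_space +
  fixes scaleC :: "complex \<Rightarrow> 'a \<Rightarrow> 'a" (infixr "*\<^sub>C" 75)
    and cinner :: "'a \<Rightarrow> 'a \<Rightarrow> complex"
  assumes scaleC_add_right: "c *\<^sub>C (x + y) = c *\<^sub>C x + c *\<^sub>C y"
    and scaleC_add_left: "(c + d) *\<^sub>C x = c *\<^sub>C x + d *\<^sub>C x"
    and scaleC_scaleC: "c *\<^sub>C d *\<^sub>C x = (c * d) *\<^sub>C x"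
    and scaleC_of_real: "complex_of_real r *\<^sub>C x = r *\<^sub>R x"
    and cinner_add_left: "cinner (x + y) z = cinner x z + cinner y z"
    and cinner_scaleC_left: "cinner (c *\<^sub>C x) y = c * cinner x y"
    and cinner_commute: "cinner y x = cnj (cinner x y)"
    and cinner_self: "cinner x x = complex_of_real ((norm x)\<^sup>2)"

instantiation complex :: complex_hilbert_space
begin

definition scaleC_complex :: "complex \<Rightarrow> complex \<Rightarrow> complex"
  where "scaleC_complex c x = c * x"

definition cinner_complex :: "complex \<Rightarrow> complex \<Rightarrow> complex"
  where "cinner_complex x y = x * cnj y"

instance
proof
  fix c d x y z :: complex and r :: real
  show "c *\<^sub>C (x + y) = c *\<^sub>C x + c *\<^sub>C y" "(c + d) *\<^sub>C x = c *\<^sub>C x + d *\<^sub>C x"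
    "c *\<^sub>C d *\<^sub>C x = (c * d) *\<^sub>C x" "complex_of_real r *\<^sub>C x = r *\<^sub>R x"
    by (simp_all add: scaleC_complex_def algebra_simps scaleR_conv_of_real)
  show "cinner (x + y) z = cinner x z + cinner y z" "cinner (c *\<^sub>C x) y = c * cinner x y"
    "cinner y x = cnj (cinner x y)" "cinner x x = complex_of_real ((norm x)\<^sup>2)"
    by (simp_all add: cinner_complex_def scaleC_complex_def algebra_simps
        complex_norm_square flip: of_real_power)
qed

end

lemma cinner_add_right:
  "cinner x (y + z) = cinner x y + cinner (x::'a::complex_hilbert_space) z"
  by (metis cinner_add_left cinner_commute complex_cnj_add)

lemma cinner_scaleC_right:
  "cinner x (c *\<^sub>C y) = cnj c * cinner (x::'a::complex_hilbert_space) y"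
  by (metis cinner_scaleC_left cinner_commute complex_cnj_mult)

lemma cinner_diff_left:
  "cinner (x - y) z = cinner x z - cinner (y::'a::complex_hilbert_space) z"
  by (metis add_diff_cancel_right' cinner_add_left diff_add_cancel)

lemma cinner_diff_right:
  "cinner x (y - z) = cinner x y - cinner (x::'a::complex_hilbert_space) z"
  by (metis add_diff_cancel_right' cinner_add_right diff_add_cancel)

lemma norm_scaleC: "norm (c *\<^sub>C x) = cmod c * norm (x::'a::complex_hilbert_space)"
proof -
  have "complex_of_real ((norm (c *\<^sub>C x))\<^sup>2) = (c * cnj c) * cinner x x"
    unfolding cinner_self [symmetric] cinner_scaleC_left cinner_scaleC_right by simp
  also have "\<dots> = complex_of_real ((cmod c * norm x)\<^sup>2)"
    unfolding cinner_self complex_norm_square [symmetric] by (simp add: power_mult_distrib)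
  finally have "(norm (c *\<^sub>C x))\<^sup>2 = (cmod c * norm x)\<^sup>2"
    using of_real_eq_iff by blast
  then show ?thesis by simp
qed

lemma cinner_eqI:
  fixes y :: "'a::complex_hilbert_space"
  assumes "\<And>x. cinner x y = cinner x z"
  shows "y = z"
proof -
  have "cinner (y - z) (y - z) = 0"
    using assms [of "y - z"] by (simp add: cinner_diff_right)
  then show ?thesis by (simp add: cinner_self)
qed

lemma cmod_cinner_le: "cmod (cinner x y) \<le> norm x * norm (y::'a::complex_hilbert_space)"
proof (cases "y = 0")
  case True
  then have "cinner x y = 0"
    using cinner_diff_right [of x 0 0] by simp
  then show ?thesis by simp
next
  case False
  define n where "n = norm y"
  define c where "c = cinner x y"
  have n: "n > 0" using False by (simp add: n_def)
  define a where "a = c / complex_of_real (n\<^sup>2)"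
  have cyx: "cinner y x = cnj c" by (simp add: c_def cinner_commute [of y x])
  have cc: "c * cnj c = complex_of_real ((cmod c)\<^sup>2)"
    by (rule complex_norm_square [symmetric])
  have "complex_of_real ((norm (x - a *\<^sub>C y))\<^sup>2)
      = complex_of_real ((norm x)\<^sup>2) - cnj a * c - a * cnj c + a * cnj a * complex_of_real (n\<^sup>2)"
    unfolding cinner_self [symmetric] n_def
    by (simp add: cinner_diff_left cinner_diff_right cinner_scaleC_left cinner_scaleC_right
        cyx c_def [symmetric] algebra_simps)
  also have "\<dots> = complex_of_real ((norm x)\<^sup>2) - c * cnj c / complex_of_real (n\<^sup>2)"
    using n by (simp add: a_def field_simps)
  also have "\<dots> = complex_of_real ((norm x)\<^sup>2 - (cmod c)\<^sup>2 / n\<^sup>2)"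
    unfolding cc by simp
  finally have "(norm (x - a *\<^sub>C y))\<^sup>2 = (norm x)\<^sup>2 - (cmod c)\<^sup>2 / n\<^sup>2"
    using of_real_eq_iff by blast
  then have "(cmod c)\<^sup>2 / n\<^sup>2 \<le> (norm x)\<^sup>2"
    by (metis diff_ge_0_iff_ge zero_le_power2)
  then have "(cmod c)\<^sup>2 \<le> (norm x * n)\<^sup>2"
    using n by (simp add: field_simps power_mult_distrib)
  then show ?thesis
    using n by (simp add: c_def n_def power2_le_iff_abs_le)
qed


section \<open>Von Neumann algebras\<close>

text \<open>
  The bounded operators on the complex Hilbert space \<open>'h\<close> are the complex-linear elements
  of the library's space of bounded real-linear maps.  The norm is the operator norm in both cases.
\<close>

definition bounded_operators :: "('h::complex_hilbert_space \<Rightarrow>\<^sub>L 'h) set"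
  where "bounded_operators = {A :: 'h \<Rightarrow>\<^sub>L 'h. \<forall>c x. A (c *\<^sub>C x) = c *\<^sub>C A x}"

lift_definition scaleC_op ::
  "complex \<Rightarrow> ('h::complex_hilbert_space \<Rightarrow>\<^sub>L 'h) \<Rightarrow> 'h \<Rightarrow>\<^sub>L 'h"
  is "\<lambda>c A x. c *\<^sub>C A x"
proof -
  fix c :: complex and A :: "'h \<Rightarrow> 'h"
  assume "bounded_linear A"
  moreover have "bounded_linear (\<lambda>x::'h. c *\<^sub>C x)"
  proof (rule bounded_linear_intro)
    fix r :: real and x y :: 'h
    show "c *\<^sub>C (x + y) = c *\<^sub>C x + c *\<^sub>C y" by (rule scaleC_add_right)
    show "c *\<^sub>C r *\<^sub>R x = r *\<^sub>R c *\<^sub>C x"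
      by (simp add: scaleC_scaleC mult.commute flip: scaleC_of_real)
    show "norm (c *\<^sub>C x) \<le> norm x * cmod c" by (simp add: norm_scaleC)
  qed
  ultimately show "bounded_linear (\<lambda>x. c *\<^sub>C A x)"
    by (rule bounded_linear_compose [rotated])
qed

definition is_adjoint ::
  "('h::complex_hilbert_space \<Rightarrow>\<^sub>L 'h) \<Rightarrow> ('h \<Rightarrow>\<^sub>L 'h) \<Rightarrow> bool"
  where "is_adjoint A B \<longleftrightarrow> (\<forall>x y. cinner (A x) y = cinner x (B y))"

definition hadj :: "('h::complex_hilbert_space \<Rightarrow>\<^sub>L 'h) \<Rightarrow> 'h \<Rightarrow>\<^sub>L 'h"
  where "hadj A = (THE B. is_adjoint A B)"

lemma is_adjoint_unique: "is_adjoint A B \<Longrightarrow> is_adjoint A C \<Longrightarrow> B = C"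
  unfolding is_adjoint_def by (metis blinfun_eqI cinner_eqI)

lemma hadj_eqI: "is_adjoint A B \<Longrightarrow> hadj A = B"
  unfolding hadj_def using is_adjoint_unique by blast

lemma is_adjoint_sym: "is_adjoint A B \<Longrightarrow> is_adjoint B A"
  unfolding is_adjoint_def by (metis cinner_commute)

lemma is_adjoint_diff: "is_adjoint A B \<Longrightarrow> is_adjoint A' B' \<Longrightarrow> is_adjoint (A - A') (B - B')"
  by (simp add: is_adjoint_def blinfun.diff_left cinner_diff_left cinner_diff_right)

lemma norm_is_adjoint_le:
  assumes "is_adjoint A B"
  shows "norm B \<le> norm A"
proof (rule norm_blinfun_bound)
  fix y
  have "(norm (B y))\<^sup>2 = cmod (cinner (A (B y)) y)"
    using assms by (simp add: is_adjoint_def cinner_self norm_power)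
  also have "\<dots> \<le> norm A * norm (B y) * norm y"
    by (meson cmod_cinner_le mult_right_mono norm_blinfun norm_ge_zero order_trans)
  finally have "norm (B y) * norm (B y) \<le> (norm A * norm y) * norm (B y)"
    by (simp add: power2_eq_square mult_ac)
  then show "norm (B y) \<le> norm A * norm y"
    by (cases "B y = 0") (simp_all add: mult_le_cancel_right)
qed simp

lemma norm_is_adjoint: "is_adjoint A B \<Longrightarrow> norm B = norm A"
  by (meson antisym is_adjoint_sym norm_is_adjoint_le)

text \<open>
  A von Neumann algebra on \<open>'h\<close>: a strongly closed \<open>*\<close>-subalgebra of the bounded operators
  that contains the identity operator.
\<close>

definition von_neumann_algebra :: "('h::complex_hilbert_space \<Rightarrow>\<^sub>L 'h) set \<Rightarrow> bool"
  where "von_neumann_algebra M \<longleftrightarrow>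
    M \<subseteq> bounded_operators \<and>
    id_blinfun \<in> M \<and>
    (\<forall>A\<in>M. \<forall>B\<in>M. A + B \<in> M) \<and>
    (\<forall>A\<in>M. \<forall>B\<in>M. A o\<^sub>L B \<in> M) \<and>
    (\<forall>c. \<forall>A\<in>M. scaleC_op c A \<in> M) \<and>
    (\<forall>A\<in>M. \<exists>B\<in>M. is_adjoint A B) \<and>
    closedin strong_operator_topology M"

lemma von_neumann_algebra_hadj:
  assumes "von_neumann_algebra M" "A \<in> M"
  shows "hadj A \<in> M" "is_adjoint A (hadj A)"
  using assms hadj_eqI unfolding von_neumann_algebra_def by blast+


section \<open>C*-extreme points\<close>

text \<open>
  Only the carrier and the multiplicative and \<open>*\<close>-structure of a unital C*-algebra are recorded;
  its addition and norm are those of the type of its elements.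
\<close>

record 'a star_algebra = "'a monoid" +
  star :: "'a \<Rightarrow> 'a"

definition closed_unit_ball :: "('a::real_normed_vector, 'm) star_algebra_scheme \<Rightarrow> 'a set"
  where "closed_unit_ball A = {x \<in> carrier A. norm x \<le> 1}"

definition unitaries :: "('a, 'm) star_algebra_scheme \<Rightarrow> 'a set"
  where "unitaries A = {u \<in> carrier A.
    star A u \<otimes>\<^bsub>A\<^esub> u = \<one>\<^bsub>A\<^esub> \<and> u \<otimes>\<^bsub>A\<^esub> star A u = \<one>\<^bsub>A\<^esub>}"

definition cstar_extreme_point ::
  "('a::real_normed_vector, 'm) star_algebra_scheme \<Rightarrow> 'a \<Rightarrow> bool"
  where "cstar_extreme_point A x \<longleftrightarrow>
    x \<in> closed_unit_ball A \<and>
    (\<forall>(k::nat) y t.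
      (\<forall>i\<in>{1..k}. y i \<in> closed_unit_ball A \<and> t i \<in> Units A) \<longrightarrow>
      (\<Sum>i=1..k. star A (t i) \<otimes>\<^bsub>A\<^esub> t i) = \<one>\<^bsub>A\<^esub> \<longrightarrow>
      x = (\<Sum>i=1..k. star A (t i) \<otimes>\<^bsub>A\<^esub> y i \<otimes>\<^bsub>A\<^esub> t i) \<longrightarrow>
      (\<exists>u. \<forall>i\<in>{1..k}. u i \<in> unitaries A \<and>
        y i = star A (u i) \<otimes>\<^bsub>A\<^esub> x \<otimes>\<^bsub>A\<^esub> u i))"

definition operator_algebra ::
  "('h::complex_hilbert_space \<Rightarrow>\<^sub>L 'h) set \<Rightarrow> ('h \<Rightarrow>\<^sub>L 'h) star_algebra"
  where "operator_algebra M =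
    \<lparr>carrier = M, mult = (o\<^sub>L), one = id_blinfun, star = hadj\<rparr>"

text \<open>
  On a compact space every continuous function is bounded, so the carrier below then consists of
  all continuous functions into \<open>M\<close>; the norm of the type of bounded continuous functions is the
  supremum norm.  \<open>Bcontfun\<close> is only meaningful on bounded continuous functions; that the
  pointwise operations stay among these is shown afterwards.
\<close>

definition continuous_algebra :: "('h::complex_hilbert_space \<Rightarrow>\<^sub>L 'h) set \<Rightarrow>
    ('w::topological_space \<Rightarrow>\<^sub>C ('h \<Rightarrow>\<^sub>L 'h)) star_algebra"
  where "continuous_algebra M =
    \<lparr>carrier = {f. \<forall>w. apply_bcontfun f w \<in> M},
     mult = (\<lambda>f g. Bcontfun (\<lambda>w. apply_bcontfun f w o\<^sub>L apply_bcontfun g w)),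
     one = const_bcontfun id_blinfun,
     star = (\<lambda>f. Bcontfun (\<lambda>w. hadj (apply_bcontfun f w)))\<rparr>"

lemma continuous_algebra_mult_apply:
  fixes f g :: "'w::topological_space \<Rightarrow>\<^sub>C ('h::complex_hilbert_space \<Rightarrow>\<^sub>L 'h)"
  shows "(f \<otimes>\<^bsub>continuous_algebra M\<^esub> g) w = f w o\<^sub>L g w"
proof -
  have "(\<lambda>w. f w o\<^sub>L g w) \<in> bcontfun"
  proof -
    obtain a b where a: "\<And>w. norm (f w) \<le> a" and b: "\<And>w. norm (g w) \<le> b"
      using bounded_apply_bcontfun [of f] bounded_apply_bcontfun [of g]
      by (auto simp: bounded_iff)
    have "norm (f w o\<^sub>L g w) \<le> a * b" for w
      by (rule order_trans [OF norm_blinfun_compose])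
        (meson a b mult_mono norm_ge_zero order_trans)
    then have "bounded (range (\<lambda>w. f w o\<^sub>L g w))" by (auto simp: bounded_iff)
    moreover have "continuous_on UNIV (\<lambda>w. f w o\<^sub>L g w)"
      by (intro bounded_bilinear.continuous_on [OF bounded_bilinear_blinfun_compose]
          continuous_on_apply_bcontfun)
    ultimately show ?thesis by (simp add: bcontfun_def)
  qed
  then show ?thesis by (simp add: continuous_algebra_def Bcontfun_inverse)
qed

lemma continuous_algebra_star_apply:
  fixes f :: "'w::topological_space \<Rightarrow>\<^sub>C ('h::complex_hilbert_space \<Rightarrow>\<^sub>L 'h)"
  assumes M: "von_neumann_algebra M" and f: "f \<in> carrier (continuous_algebra M)"
  shows "star (continuous_algebra M) f w = hadj (f w)"
proof -
  have adj: "is_adjoint (f w) (hadj (f w))" for w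
    using f by (auto simp: continuous_algebra_def intro: von_neumann_algebra_hadj [OF M])
  have iso: "dist (hadj (f v)) (hadj (f w)) = dist (f v) (f w)" for v w
    unfolding dist_norm by (rule norm_is_adjoint) (intro is_adjoint_diff adj)
  have "(\<lambda>w. hadj (f w)) \<in> bcontfun"
  proof -
    have "bounded (range (\<lambda>w. hadj (f w)))"
      using bounded_apply_bcontfun [of f] norm_is_adjoint [OF adj] by (simp add: bounded_iff)
    moreover have "continuous_on UNIV (\<lambda>w. hadj (f w))"
      using continuous_on_apply_bcontfun [of UNIV f]
      unfolding continuous_on_def tendsto_iff iso .
    ultimately show ?thesis by (simp add: bcontfun_def)
  qed
  then show ?thesis by (simp add: continuous_algebra_def Bcontfun_inverse)
qed

end

theory Submission
  imports Defs
begin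

text \<open>
  The \<open>C\<^sup>*\<close>-extreme points of the unit ball of a von Neumann algebra \<open>M\<close> turn out to be the partial
  isometries \<open>v\<close> with \<open>(\<I> - v v\<^sup>*) M (\<I> - v\<^sup>* v) = 0\<close>, and these form a norm-closed set.  At an isolated
  point \<open>w\<close> a decomposition of \<open>f w\<close> extends to one of \<open>f\<close>, so \<open>f w\<close> is \<open>C\<^sup>*\<close>-extreme there; by density
  and continuity all values of \<open>f\<close> then lie in the closed set.

  If \<open>x\<close> is \<open>C\<^sup>*\<close>-extreme and \<open>x = (y + z) / 2\<close> with contractions \<open>y, z\<close>, then \<open>y\<close> is unitarily equivalent to
  \<open>x\<close>.  Choosing for \<open>y\<close> the partial isometry of the polar decomposition of \<open>x\<close> shows that \<open>x\<close> is a
  partial isometry; choosing \<open>y = x + c\<close> with \<open>c \<in> (\<I> - x x\<^sup>*) M (\<I> - x\<^sup>* x)\<close> of norm \<open>1/2\<close>, which is not a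
  partial isometry, shows that this corner vanishes.

  Conversely, the central support of \<open>\<I> - x x\<^sup>*\<close> cuts such an \<open>x\<close> into an isometry and a coisometry.  If
  an isometry is \<open>x = \<Sum>i. t\<^sub>i\<^sup>* y\<^sub>i t\<^sub>i\<close>, strict convexity forces \<open>y\<^sub>i t\<^sub>i = t\<^sub>i x\<close> with \<open>y\<^sub>i\<close> an isometry, and
  similar isometries are unitarily equivalent in \<open>M\<close> by the Wold decomposition.
\<close>

text \<open>C*-extremality quantifies over decompositions and the unitaries they produce, and
  unitaries found at nearby points have no reason to converge, so the property does not visibly
  survive limits. The algebraic description is used because its identities involve only products and
  adjoints, which are norm-continuous.

  The obstacle lies in passing from similarity to unitary equivalence. If \<open>y t = t x\<close>
  with \<open>t\<close> invertible and \<open>x\<close>, \<open>y\<close> unitary, then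
  \<open>t\<^sup>\<dagger> t\<close> commutes with \<open>x\<close> and the polar factor of
  \<open>t\<close> intertwines. For isometries only the Toeplitz relation \<open>x\<^sup>\<dagger>
  (t\<^sup>\<dagger> t) x = t\<^sup>\<dagger> t\<close> holds. The Wold decomposition isolates the
  part where this still gives commutation; the shift part depends only on
  \<open>\<I> - x x\<^sup>\<dagger>\<close>, for which an equivalence in \<open>M\<close> with
  \<open>\<I> - y y\<^sup>\<dagger>\<close> suffices.

  Every operator constructed has to lie in \<open>M\<close>. Hence inverses and square roots are
  norm fixed points in closed subsets of \<open>M\<close>, other operators are strong limits, and
  commutation is tracked by \<open>sa_bicommutant\<close> in the role of a functional
  calculus.\<close>

instance complex_hilbert_space \<subseteq> banach ..

notation blinfun_compose (infixl \<open>\<cdot>\<close> 70)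
notation hadj (\<open>_\<^sup>\<dagger>\<close> [1000] 1000)
notation id_blinfun (\<open>\<I>\<close>)

lemma blinfun_compose_assoc: "A \<cdot> B \<cdot> C = A \<cdot> (B \<cdot> C)"
  by (rule blinfun_eqI) simp

lemma blinfun_compose_id [simp]: "\<I> \<cdot> A = A" "A \<cdot> \<I> = A"
  by (auto intro: blinfun_eqI)

lemmas blinfun_compose_bilinear = bounded_bilinear.add_left [OF bounded_bilinear_blinfun_compose]
  bounded_bilinear.add_right [OF bounded_bilinear_blinfun_compose]
  bounded_bilinear.diff_left [OF bounded_bilinear_blinfun_compose]
  bounded_bilinear.diff_right [OF bounded_bilinear_blinfun_compose]
  bounded_bilinear.minus_left [OF bounded_bilinear_blinfun_compose]
  bounded_bilinear.minus_right [OF bounded_bilinear_blinfun_compose]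
  bounded_bilinear.scaleR_left [OF bounded_bilinear_blinfun_compose]
  bounded_bilinear.scaleR_right [OF bounded_bilinear_blinfun_compose]

lemmas blinfun_apply_simps = blinfun.bilinear_simps

lemma blinfun_compose_cong: "A \<cdot> B = C \<Longrightarrow> A \<cdot> (B \<cdot> X) = C \<cdot> X"
  by (simp flip: blinfun_compose_assoc)

subsection \<open>The real inner product\<close>

text \<open>Only real scalars are needed below, so everything is phrased with the real part of the
  inner product.\<close>

definition rinner :: "'h::complex_hilbert_space \<Rightarrow> 'h \<Rightarrow> real"
  where "rinner x y = Re (cinner x y)"

lemma rinner_add: "rinner (x + y) z = rinner x z + rinner y z" "rinner x (y + z) = rinner x y + rinner x z"
  by (simp_all add: rinner_def cinner_add_left cinner_add_right)

lemma rinner_diff: "rinner (x - y) z = rinner x z - rinner y z" "rinner x (y - z) = rinner x y - rinner x z"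
  by (simp_all add: rinner_def cinner_diff_left cinner_diff_right)

lemma rinner_scaleR: "rinner (r *\<^sub>R x) y = r * rinner x y" "rinner x (r *\<^sub>R y) = r * rinner x y"
  by (simp_all add: rinner_def cinner_scaleC_left cinner_scaleC_right flip: scaleC_of_real)

lemma rinner_zero [simp]: fixes x y :: "'h::complex_hilbert_space" shows "rinner 0 y = 0" "rinner x 0 = 0"
  using rinner_diff(1) [of x x y] rinner_diff(2) [of x y y] by simp_all

lemma rinner_minus: "rinner (- x) y = - rinner x y" "rinner x (- y) = - rinner x y"
  using rinner_diff(1) [of 0 x y] rinner_diff(2) [of x 0 y] by simp_all

lemma rinner_sum: "rinner (sum f A) y = (\<Sum>i\<in>A. rinner (f i) y)" "rinner y (sum f A) = (\<Sum>i\<in>A. rinner y (f i))"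
  by (induction A rule: infinite_finite_induct) (simp_all add: rinner_add)

lemmas rinner_simps = rinner_add rinner_diff rinner_scaleR rinner_minus

lemma rinner_commute: "rinner x y = rinner y x"
  unfolding rinner_def by (subst cinner_commute) simp

lemma rinner_self: "rinner x x = (norm x)\<^sup>2"
  by (simp add: rinner_def cinner_self)

lemma rinner_eqI: "(\<And>x. rinner x y = rinner x z) \<Longrightarrow> y = z"
  using rinner_self [of "y - z"] by (simp add: rinner_diff)

lemma abs_rinner_le: "\<bar>rinner x y\<bar> \<le> norm x * norm y"
  unfolding rinner_def using abs_Re_le_cmod cmod_cinner_le order_trans by blast

lemma rinner_le: "rinner x y \<le> norm x * norm y"
  using abs_rinner_le [of x y] by linarith

lemma norm_add_sq: "(norm (x + y))\<^sup>2 = (norm x)\<^sup>2 + 2 * rinner x y + (norm y)\<^sup>2"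
  for x y :: "'h::complex_hilbert_space"
  by (simp add: rinner_simps rinner_commute flip: rinner_self)

lemma norm_diff_sq: "(norm (x - y))\<^sup>2 = (norm x)\<^sup>2 - 2 * rinner x y + (norm y)\<^sup>2"
  for x y :: "'h::complex_hilbert_space"
  by (simp add: rinner_simps rinner_commute flip: rinner_self)

lemma bounded_bilinear_rinner: "bounded_bilinear rinner"
  by standard (auto simp: rinner_simps abs_rinner_le intro!: exI [of _ 1])

lemmas tendsto_rinner = bounded_bilinear.tendsto [OF bounded_bilinear_rinner]

lemma blinfun_norm_le_sq:
  fixes A :: "'a::real_normed_vector \<Rightarrow>\<^sub>L 'b::real_normed_vector"
  assumes "0 \<le> c" "\<And>x. (norm (A x))\<^sup>2 \<le> c\<^sup>2 * (norm x)\<^sup>2"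
  shows "norm A \<le> c"
proof (rule norm_blinfun_bound)
  fix x
  have "(norm (A x))\<^sup>2 \<le> (c * norm x)\<^sup>2"
    using assms(2) by (simp add: power_mult_distrib)
  then show "norm (A x) \<le> c * norm x"
    using assms(1) by (simp add: power2_le_iff_abs_le)
qed (fact assms(1))

lemma norm_blinfun_le: "norm (A :: 'a::real_normed_vector \<Rightarrow>\<^sub>L 'b::real_normed_vector) \<le> c \<Longrightarrow> norm (A x) \<le> c * norm x"
  by (meson mult_right_mono norm_blinfun norm_ge_zero order_trans)

lemma norm_contraction_le: "norm (A :: 'a::real_normed_vector \<Rightarrow>\<^sub>L 'b::real_normed_vector) \<le> 1 \<Longrightarrow> norm (A x) \<le> norm x"
  using norm_blinfun_le [of A 1 x] by simp

subsection \<open>Operators in a von Neumann algebra\<close>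

text \<open>Only the real part of the quadratic form is constrained, so self-adjointness is not
  implied; where it matters it is a separate hypothesis
  \<open>A\<^sup>\<dagger> = A\<close>.\<close>

definition positive_op :: "('h::complex_hilbert_space \<Rightarrow>\<^sub>L 'h) \<Rightarrow> bool"
  where "positive_op A \<longleftrightarrow> (\<forall>x. 0 \<le> rinner (A x) x)"

text \<open>The uniform lower bound stands for "positive and invertible": it is what makes the norm
  fixed-point arguments below contract.\<close>

definition coercive :: "('h::complex_hilbert_space \<Rightarrow>\<^sub>L 'h) \<Rightarrow> bool"
  where "coercive A \<longleftrightarrow> (\<exists>e>0. \<forall>x. e * (norm x)\<^sup>2 \<le> rinner (A x) x)"

lemma positive_op_id [simp]: "positive_op \<I>"
  by (simp add: positive_op_def rinner_self)

lemma positive_op_add: "positive_op A \<Longrightarrow> positive_op B \<Longrightarrow> positive_op (A + B)"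
  by (simp add: positive_op_def blinfun_apply_simps rinner_simps)

lemma positive_op_scaleR: "positive_op A \<Longrightarrow> 0 \<le> r \<Longrightarrow> positive_op (r *\<^sub>R A)"
  by (simp add: positive_op_def blinfun_apply_simps rinner_simps)

lemma positive_op_add_id_coercive:
  assumes "positive_op A" "e > 0"
  shows "coercive (A + e *\<^sub>R \<I>)"
  using assms unfolding coercive_def positive_op_def
  by (intro exI [of _ e]) (simp add: blinfun_apply_simps rinner_simps rinner_self)

locale vna =
  fixes M :: "('h::complex_hilbert_space \<Rightarrow>\<^sub>L 'h) set"
  assumes vna: "von_neumann_algebra M"
begin

lemma id_mem [simp, intro]: "\<I> \<in> M"
  and add_mem [simp, intro]: "A \<in> M \<Longrightarrow> B \<in> M \<Longrightarrow> A + B \<in> M"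
  and compose_mem [simp, intro]: "A \<in> M \<Longrightarrow> B \<in> M \<Longrightarrow> A \<cdot> B \<in> M"
  using vna by (simp_all add: von_neumann_algebra_def)

lemma scaleR_mem [simp, intro]: "A \<in> M \<Longrightarrow> r *\<^sub>R A \<in> M"
proof -
  have "scaleC_op (complex_of_real r) A = r *\<^sub>R A"
    by (rule blinfun_eqI) (simp add: scaleC_op.rep_eq scaleC_of_real blinfun_apply_simps)
  then show "A \<in> M \<Longrightarrow> r *\<^sub>R A \<in> M"
    using vna by (metis von_neumann_algebra_def)
qed

lemma zero_mem [simp, intro]: "0 \<in> M"
  using scaleR_mem [OF id_mem, of 0] by simp

lemma minus_mem [simp, intro]: "A \<in> M \<Longrightarrow> - A \<in> M"
  using scaleR_mem [of A "-1"] by simp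

lemma diff_mem [simp, intro]: "A \<in> M \<Longrightarrow> B \<in> M \<Longrightarrow> A - B \<in> M"
  using add_mem [of A "- B"] by simp

lemma sum_mem [intro]: "(\<And>i. i \<in> I \<Longrightarrow> A i \<in> M) \<Longrightarrow> sum A I \<in> M"
  by (induction I rule: infinite_finite_induct) auto

lemma hadj_mem [simp, intro]: "A \<in> M \<Longrightarrow> A\<^sup>\<dagger> \<in> M"
  by (rule von_neumann_algebra_hadj [OF vna])

lemma is_adjoint_hadj: "A \<in> M \<Longrightarrow> is_adjoint A (A\<^sup>\<dagger>)"
  by (rule von_neumann_algebra_hadj [OF vna])

lemma rinner_hadj: "A \<in> M \<Longrightarrow> rinner x (A\<^sup>\<dagger> y) = rinner (A x) y"
  using is_adjoint_hadj by (simp add: is_adjoint_def rinner_def)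

lemma rinner_hadj': "A \<in> M \<Longrightarrow> rinner (A\<^sup>\<dagger> x) y = rinner x (A y)"
  by (metis rinner_commute rinner_hadj)

lemma hadj_eqI_rinner:
  assumes "A \<in> M" "\<And>x y. rinner x (blinfun_apply B y) = rinner (A x) y"
  shows "A\<^sup>\<dagger> = B"
  by (rule blinfun_eqI, rule rinner_eqI) (simp add: assms rinner_hadj)

lemma hadj_id [simp]: "(\<I> :: 'h \<Rightarrow>\<^sub>L 'h)\<^sup>\<dagger> = \<I>"
  by (rule hadj_eqI_rinner) auto

lemma hadj_hadj [simp]: "A \<in> M \<Longrightarrow> A\<^sup>\<dagger>\<^sup>\<dagger> = A"
  by (rule hadj_eqI_rinner) (auto simp: rinner_hadj')

lemma hadj_add [simp]: "A \<in> M \<Longrightarrow> B \<in> M \<Longrightarrow> (A + B)\<^sup>\<dagger> = A\<^sup>\<dagger> + B\<^sup>\<dagger>"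
  by (rule hadj_eqI_rinner) (auto simp: rinner_hadj blinfun_apply_simps rinner_simps)

lemma hadj_diff [simp]: "A \<in> M \<Longrightarrow> B \<in> M \<Longrightarrow> (A - B)\<^sup>\<dagger> = A\<^sup>\<dagger> - B\<^sup>\<dagger>"
  by (rule hadj_eqI_rinner) (auto simp: rinner_hadj blinfun_apply_simps rinner_simps)

lemma hadj_scaleR [simp]: "A \<in> M \<Longrightarrow> (r *\<^sub>R A)\<^sup>\<dagger> = r *\<^sub>R A\<^sup>\<dagger>"
  by (rule hadj_eqI_rinner) (auto simp: rinner_hadj blinfun_apply_simps rinner_simps)

lemma hadj_zero [simp]: "(0 :: 'h \<Rightarrow>\<^sub>L 'h)\<^sup>\<dagger> = 0"
  by (rule hadj_eqI_rinner) auto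

lemma hadj_compose [simp]: "A \<in> M \<Longrightarrow> B \<in> M \<Longrightarrow> (A \<cdot> B)\<^sup>\<dagger> = B\<^sup>\<dagger> \<cdot> A\<^sup>\<dagger>"
  by (rule hadj_eqI_rinner) (auto simp: rinner_hadj)

lemma hadj_sum: "(\<And>i. i \<in> I \<Longrightarrow> A i \<in> M) \<Longrightarrow> (sum A I)\<^sup>\<dagger> = (\<Sum>i\<in>I. (A i)\<^sup>\<dagger>)"
  by (induction I rule: infinite_finite_induct) (simp_all add: sum_mem)

lemma norm_hadj [simp]: "A \<in> M \<Longrightarrow> norm (A\<^sup>\<dagger>) = norm A"
  using is_adjoint_hadj norm_is_adjoint by blast

lemma norm_sq_rinner: "A \<in> M \<Longrightarrow> (norm (A x))\<^sup>2 = rinner (A\<^sup>\<dagger> (A x)) x"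
  by (simp add: rinner_hadj' rinner_self)

lemma positive_op_hadj_compose [simp]: "A \<in> M \<Longrightarrow> positive_op (A\<^sup>\<dagger> \<cdot> A)"
  by (simp add: positive_op_def flip: norm_sq_rinner)

text \<open>The strong operator topology is the pullback of the product topology along evaluation,
  so a basic neighbourhood of \<open>A\<close> restricts only finitely many values
  \<open>A x\<close>, each to a set containing a ball around \<open>A x\<close>.\<close>

lemma mem_if_strong_limit_point:
  fixes A :: "'h \<Rightarrow>\<^sub>L 'h"
  assumes "\<And>X d. finite X \<Longrightarrow> d > 0 \<Longrightarrow> \<exists>B\<in>M. \<forall>x\<in>X. norm (B x - A x) < d"
  shows "A \<in> M"
proof (rule ccontr)
  assume "A \<notin> M"
  have "closedin strong_operator_topology M"
    using vna by (simp add: von_neumann_algebra_def)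
  then have "openin (pullback_topology UNIV blinfun_apply euclidean) (- M)"
    by (simp add: closedin_def strong_operator_topology_topspace Compl_eq_Diff_UNIV
        flip: strong_operator_topology_def)
  then obtain U where U: "open U" "- M = blinfun_apply -` U"
    by (auto simp: openin_pullback_topology)
  have "blinfun_apply A \<in> U" using U \<open>A \<notin> M\<close> by blast
  then obtain X where X: "blinfun_apply A \<in> Pi\<^sub>E UNIV X" "\<And>i. open (X i)"
      "finite {i. X i \<noteq> UNIV}" "Pi\<^sub>E UNIV X \<subseteq> U"
    using product_topology_open_contains_basis [of "\<lambda>_. euclidean" UNIV U "blinfun_apply A"] U(1)
    by (auto simp: open_fun_def)
  define F where "F = {i. X i \<noteq> UNIV}"
  have "blinfun_apply A i \<in> X i" for i
    using PiE_mem [OF X(1)] by simp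
  then have "\<forall>i. \<exists>d>0. ball (A i) d \<subseteq> X i"
    using X(2) openE by blast
  then have "\<exists>d. \<forall>i. d i > 0 \<and> ball (A i) (d i) \<subseteq> X i" by (rule choice)
  then obtain d where d: "\<And>i. d i > 0" "\<And>i. ball (A i) (d i) \<subseteq> X i" by blast
  \<comment> \<open>\<open>insert 1\<close> keeps the minimum defined when no coordinate is
    restricted.\<close>
  define e where "e = Min (insert 1 (d ` F))"
  have "finite F" using X(3) by (simp add: F_def)
  then have e: "e > 0" "\<And>i. i \<in> F \<Longrightarrow> e \<le> d i"
    using d(1) by (auto simp: e_def)
  from assms [OF \<open>finite F\<close> e(1)] obtain B where B: "B \<in> M" "\<And>x. x \<in> F \<Longrightarrow> norm (B x - A x) < e"
    by blast
  have "B i \<in> X i" for i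
  proof (cases "i \<in> F")
    case True
    then have "B i \<in> ball (A i) (d i)"
      using B(2) [OF True] e(2) [OF True] by (simp add: dist_norm norm_minus_commute)
    then show ?thesis using d(2) by blast
  qed (auto simp: F_def)
  then have "blinfun_apply B \<in> U" using X(4) by (simp add: subset_iff PiE_iff)
  then show False using U(2) B(1) by blast
qed

lemma mem_if_strong_limit:
  fixes A :: "nat \<Rightarrow> 'h \<Rightarrow>\<^sub>L 'h" and B :: "'h \<Rightarrow>\<^sub>L 'h"
  assumes "\<And>n. A n \<in> M" "\<And>x. (\<lambda>n. A n x) \<longlonglongrightarrow> B x"
  shows "B \<in> M"
proof (rule mem_if_strong_limit_point)
  fix X :: "'h set" and d :: real
  assume "finite X" "d > 0"
  then have "\<forall>\<^sub>F n in sequentially. \<forall>x\<in>X. dist (A n x) (B x) < d"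
    by (intro eventually_ball_finite ballI tendstoD [OF assms(2)])
  then show "\<exists>C\<in>M. \<forall>x\<in>X. norm (C x - B x) < d"
    using assms(1) unfolding dist_norm eventually_sequentially by blast
qed

lemma closed_M: "closed M"
proof (rule closed_sequential_limits [THEN iffD2], intro allI impI)
  fix A B assume A: "(\<forall>n. A n \<in> M) \<and> A \<longlonglongrightarrow> B"
  have "(\<lambda>n. A n x) \<longlonglongrightarrow> B x" for x
    by (rule bounded_linear.tendsto [OF blinfun.bounded_linear_left]) (use A in blast)
  then show "B \<in> M" using A mem_if_strong_limit by blast
qed

lemma hadj_limit:
  assumes "\<And>n. A n \<in> M" "A \<longlonglongrightarrow> B"
  shows "(\<lambda>n. (A n)\<^sup>\<dagger>) \<longlonglongrightarrow> B\<^sup>\<dagger>"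
proof -
  have "B \<in> M" using closed_M assms closed_sequentially by blast
  then have "norm ((A n)\<^sup>\<dagger> - B\<^sup>\<dagger>) = norm (A n - B)" for n
    using assms(1) norm_hadj [of "A n - B"] by simp
  then show ?thesis using assms(2) by (simp add: tendsto_iff dist_norm)
qed

lemma strong_limit:
  fixes A :: "nat \<Rightarrow> 'h \<Rightarrow>\<^sub>L 'h"
  assumes A: "\<And>n. A n \<in> M" "\<And>n. norm (A n) \<le> c" and C: "\<And>x. Cauchy (\<lambda>n. A n x)"
  obtains B where "B \<in> M" "norm B \<le> c" "\<And>x. (\<lambda>n. A n x) \<longlonglongrightarrow> B x"
proof -
  define b where "b x = lim (\<lambda>n. A n x)" for x
  have lim: "(\<lambda>n. A n x) \<longlonglongrightarrow> b x" for x
    using C by (simp add: b_def Cauchy_convergent_iff convergent_LIMSEQ_iff)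
  have bound: "norm (b x) \<le> norm x * c" for x
  proof (rule LIMSEQ_le_const2 [OF tendsto_norm [OF lim]])
    show "\<exists>N. \<forall>n\<ge>N. norm (A n x) \<le> norm x * c"
      using norm_blinfun_le [OF A(2)] by (simp add: mult.commute)
  qed
  have "bounded_linear b"
  proof (rule bounded_linear_intro [OF _ _ bound])
    fix r x y
    have "(\<lambda>n. A n (x + y)) \<longlonglongrightarrow> b x + b y"
      unfolding blinfun.add_right by (intro tendsto_add lim)
    then show "b (x + y) = b x + b y" using lim LIMSEQ_unique by blast
    have "(\<lambda>n. A n (r *\<^sub>R x)) \<longlonglongrightarrow> r *\<^sub>R b x"
      unfolding blinfun.scaleR_right by (intro tendsto_scaleR tendsto_const lim)
    then show "b (r *\<^sub>R x) = r *\<^sub>R b x" using lim LIMSEQ_unique by blast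
  qed
  then have B: "blinfun_apply (Blinfun b) = b" by (rule bounded_linear_Blinfun_apply)
  show thesis
  proof (rule that)
    show lim': "(\<lambda>n. A n x) \<longlonglongrightarrow> Blinfun b x" for x using lim B by simp
    then show "Blinfun b \<in> M" using A(1) mem_if_strong_limit by blast
    show "norm (Blinfun b) \<le> c"
      using bound order_trans [OF norm_ge_zero A(2)] by (intro norm_blinfun_bound) (auto simp: B mult.commute)
  qed
qed

end

subsection \<open>Inverses and square roots\<close>

lemma compose_commutes:
  assumes "X \<cdot> A = A \<cdot> X" "X \<cdot> B = B \<cdot> X"
  shows "X \<cdot> (A \<cdot> B) = A \<cdot> B \<cdot> X"
proof -
  have "X \<cdot> (A \<cdot> B) = X \<cdot> A \<cdot> B" by (simp add: blinfun_compose_assoc)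
  also have "\<dots> = A \<cdot> (X \<cdot> B)" by (simp add: assms(1) blinfun_compose_assoc)
  finally show ?thesis by (simp add: assms(2) blinfun_compose_assoc)
qed

lemma coercive_contraction:
  assumes "coercive A"
  obtains l where "l > 0" "norm (\<I> - l *\<^sub>R A) < 1"
proof -
  obtain e where e: "e > 0" "\<And>x. e * (norm x)\<^sup>2 \<le> rinner (A x) x"
    using assms by (auto simp: coercive_def)
  define N where "N = (norm A)\<^sup>2"
  \<comment> \<open>\<open>l N \<le> e\<close> lets the quadratic term \<open>l^2 N\<close> absorb
    at most half of the gain \<open>2 l e\<close>; the summands \<open>e^2 + 1\<close> give
    \<open>l e < 1\<close>, so the square root below makes sense.\<close>
  define l where "l = e / (N + e\<^sup>2 + 1)"
  have N: "N \<ge> 0" by (simp add: N_def)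
  have pos: "N + e\<^sup>2 + 1 > 0" using N by (simp add: add_nonneg_pos)
  then have l: "l > 0" using e(1) by (simp add: l_def)
  have le: "l * e < 1" "l * N \<le> e"
    using N e(1) pos by (simp_all add: l_def field_simps power2_eq_square)
  have "norm (\<I> - l *\<^sub>R A) \<le> sqrt (1 - l * e)"
  proof (rule blinfun_norm_le_sq)
    fix x
    have Ax: "(norm (A x))\<^sup>2 \<le> N * (norm x)\<^sup>2"
      unfolding N_def power_mult_distrib [symmetric] by (intro power_mono norm_blinfun) simp
    have "(norm ((\<I> - l *\<^sub>R A) x))\<^sup>2 = (norm x)\<^sup>2 - 2 * l * rinner (A x) x + l\<^sup>2 * (norm (A x))\<^sup>2"
      by (simp add: blinfun_apply_simps norm_diff_sq rinner_simps rinner_commute power_mult_distrib)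
    also have "\<dots> \<le> (norm x)\<^sup>2 - 2 * l * (e * (norm x)\<^sup>2) + l\<^sup>2 * (N * (norm x)\<^sup>2)"
      using l e(2) Ax by (intro add_mono diff_mono mult_left_mono) auto
    also have "l\<^sup>2 * (N * (norm x)\<^sup>2) = l * (l * N) * (norm x)\<^sup>2"
      by (simp add: power2_eq_square)
    also have "\<dots> \<le> l * e * (norm x)\<^sup>2"
      using le l by (intro mult_right_mono mult_left_mono) auto
    also have "(norm x)\<^sup>2 - 2 * l * (e * (norm x)\<^sup>2) + l * e * (norm x)\<^sup>2 = (sqrt (1 - l * e))\<^sup>2 * (norm x)\<^sup>2"
      using le by (simp add: algebra_simps)
    finally show "(norm ((\<I> - l *\<^sub>R A) x))\<^sup>2 \<le> (sqrt (1 - l * e))\<^sup>2 * (norm x)\<^sup>2" by simp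
  qed (use le in simp)
  moreover have "sqrt (1 - l * e) < 1" using l e(1) by simp
  ultimately show thesis using that [OF l] by linarith
qed

context vna
begin

text \<open>Neumann series as fixed points: \<open>X = \<I> + S X\<close> and
  \<open>Y = \<I> + Y S\<close> say that \<open>X\<close> and \<open>Y\<close> are a right and a
  left inverse of \<open>l A\<close>, so they agree. Both are found inside \<open>M\<close> because
  \<open>M\<close> is norm-complete.\<close>

lemma coercive_inverse:
  assumes "A \<in> M" "coercive A"
  obtains B where "B \<in> M" "A \<cdot> B = \<I>" "B \<cdot> A = \<I>"
proof -
  obtain l where l: "l > 0" "norm (\<I> - l *\<^sub>R A) < 1"
    using coercive_contraction [OF assms(2)] .
  define S where "S = \<I> - l *\<^sub>R A"
  have S: "S \<in> M" "norm S < 1" using assms(1) l by (simp_all add: S_def)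
  have lip: "dist (\<I> + S \<cdot> X) (\<I> + S \<cdot> Y) \<le> norm S * dist X Y"
    "dist (\<I> + X \<cdot> S) (\<I> + Y \<cdot> S) \<le> norm S * dist X Y" for X Y
    using norm_blinfun_compose [of S "X - Y"] norm_blinfun_compose [of "X - Y" S]
    by (simp_all add: dist_norm blinfun_compose_bilinear mult.commute)
  have "complete M" "M \<noteq> {}" using closed_M by (auto simp: complete_eq_closed)
  then obtain X where X: "X \<in> M" "\<I> + S \<cdot> X = X"
    using Banach_fix [of M "norm S" "\<lambda>X. \<I> + S \<cdot> X"] lip(1) S by auto
  obtain Y where Y: "Y \<in> M" "\<I> + Y \<cdot> S = Y"
    using \<open>complete M\<close> \<open>M \<noteq> {}\<close> Banach_fix [of M "norm S" "\<lambda>X. \<I> + X \<cdot> S"] lip(2) S by auto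
  have "A \<cdot> (l *\<^sub>R X) = \<I>" "(l *\<^sub>R Y) \<cdot> A = \<I>"
    using X(2) Y(2) by (simp_all add: S_def blinfun_compose_bilinear algebra_simps)
  moreover from this have "l *\<^sub>R Y = l *\<^sub>R X"
    by (metis blinfun_compose_assoc blinfun_compose_id)
  ultimately show thesis using that X(1) by auto
qed

lemma inverse_commutes:
  assumes "A \<cdot> B = \<I>" "B \<cdot> A = \<I>" "C \<cdot> A = A \<cdot> C"
  shows "C \<cdot> B = B \<cdot> C"
proof -
  have "B \<cdot> (C \<cdot> A) \<cdot> B = B \<cdot> (A \<cdot> C) \<cdot> B" using assms(3) by simp
  then show ?thesis using assms(1,2)
    by (metis blinfun_compose_assoc blinfun_compose_id)
qed

text \<open>Substitute for the real functional calculus of \<open>A\<close>: for self-adjoint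
  \<open>A\<close> in \<open>M\<close> this is a commutative real algebra containing the real
  polynomials in \<open>A\<close>. The test operators \<open>C\<close> range over all bounded maps,
  not only over \<open>M\<close>.\<close>

definition sa_bicommutant :: "('h \<Rightarrow>\<^sub>L 'h) \<Rightarrow> ('h \<Rightarrow>\<^sub>L 'h) set"
  where "sa_bicommutant A = {B \<in> M. B\<^sup>\<dagger> = B \<and> (\<forall>C. C \<cdot> A = A \<cdot> C \<longrightarrow> C \<cdot> B = B \<cdot> C)}"

lemma sa_bicommutantD:
  assumes "B \<in> sa_bicommutant A"
  shows "B \<in> M" "B\<^sup>\<dagger> = B" "C \<cdot> A = A \<cdot> C \<Longrightarrow> C \<cdot> B = B \<cdot> C"
  using assms by (auto simp: sa_bicommutant_def)

lemma sa_bicommutant_commute: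
  assumes "B \<in> sa_bicommutant A" "C \<in> sa_bicommutant A" "A \<in> M" "A\<^sup>\<dagger> = A"
  shows "B \<cdot> C = C \<cdot> B"
  using assms by (metis sa_bicommutantD(3))

lemma sa_bicommutant_self: "A \<in> M \<Longrightarrow> A\<^sup>\<dagger> = A \<Longrightarrow> A \<in> sa_bicommutant A"
  by (simp add: sa_bicommutant_def)

lemma sa_bicommutant_id: "\<I> \<in> sa_bicommutant A"
  by (simp add: sa_bicommutant_def)

lemma sa_bicommutant_add: "B \<in> sa_bicommutant A \<Longrightarrow> C \<in> sa_bicommutant A \<Longrightarrow> B + C \<in> sa_bicommutant A"
  by (simp add: sa_bicommutant_def blinfun_compose_bilinear)

lemma sa_bicommutant_diff: "B \<in> sa_bicommutant A \<Longrightarrow> C \<in> sa_bicommutant A \<Longrightarrow> B - C \<in> sa_bicommutant A"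
  by (simp add: sa_bicommutant_def blinfun_compose_bilinear)

lemma sa_bicommutant_scaleR: "B \<in> sa_bicommutant A \<Longrightarrow> r *\<^sub>R B \<in> sa_bicommutant A"
  by (simp add: sa_bicommutant_def blinfun_compose_bilinear)

lemma sa_bicommutant_compose:
  assumes "B \<in> sa_bicommutant A" "C \<in> sa_bicommutant A" "A \<in> M" "A\<^sup>\<dagger> = A"
  shows "B \<cdot> C \<in> sa_bicommutant A"
proof -
  have "X \<cdot> (B \<cdot> C) = B \<cdot> C \<cdot> X" if "X \<cdot> A = A \<cdot> X" for X
    by (intro compose_commutes sa_bicommutantD(3) [OF assms(1) that] sa_bicommutantD(3) [OF assms(2) that])
  moreover have "(B \<cdot> C)\<^sup>\<dagger> = B \<cdot> C"
    by (simp add: sa_bicommutantD(1,2) [OF assms(1)] sa_bicommutantD(1,2) [OF assms(2)]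
        sa_bicommutant_commute [OF assms, symmetric])
  ultimately show ?thesis
    using sa_bicommutantD(1) [OF assms(1)] sa_bicommutantD(1) [OF assms(2)] by (simp add: sa_bicommutant_def)
qed

lemmas sa_bicommutant_intros = sa_bicommutant_self sa_bicommutant_id sa_bicommutant_add
  sa_bicommutant_diff sa_bicommutant_scaleR sa_bicommutant_compose

lemma closed_sa_bicommutant: "closed (sa_bicommutant A)"
proof (rule closed_sequential_limits [THEN iffD2], intro allI impI)
  fix X B assume XB: "(\<forall>n. X n \<in> sa_bicommutant A) \<and> X \<longlonglongrightarrow> B"
  then have X: "X n \<in> sa_bicommutant A" and lim: "X \<longlonglongrightarrow> B" for n by auto
  have mem: "B \<in> M"
    using closed_sequentially [OF closed_M _ lim] sa_bicommutantD(1) [OF X] by blast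
  have "(\<lambda>n. (X n)\<^sup>\<dagger>) \<longlonglongrightarrow> B\<^sup>\<dagger>"
    using hadj_limit [OF _ lim] sa_bicommutantD(1) [OF X] by blast
  then have "B\<^sup>\<dagger> = B"
    using lim LIMSEQ_unique by (simp add: sa_bicommutantD(2) [OF X])
  moreover have "C \<cdot> B = B \<cdot> C" if "C \<cdot> A = A \<cdot> C" for C
  proof (rule LIMSEQ_unique)
    show "(\<lambda>n. C \<cdot> X n) \<longlonglongrightarrow> C \<cdot> B"
      by (rule bounded_bilinear.tendsto [OF bounded_bilinear_blinfun_compose tendsto_const lim])
    show "(\<lambda>n. C \<cdot> X n) \<longlonglongrightarrow> B \<cdot> C"
      unfolding sa_bicommutantD(3) [OF X that]
      by (rule bounded_bilinear.tendsto [OF bounded_bilinear_blinfun_compose lim tendsto_const])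
  qed
  ultimately show "B \<in> sa_bicommutant A" using mem by (simp add: sa_bicommutant_def)
qed

text \<open>With \<open>S = \<I> - l A\<close>, a solution \<open>Y\<close> of \<open>Y = (S + Y\<^sup>2) / 2\<close> satisfies
  \<open>(\<I> - Y)\<^sup>2 = l A\<close>, and the right-hand side is a contraction on the ball of radius
  \<open>norm S < 1\<close>.\<close>

lemma coercive_sqrt:
  assumes A: "A \<in> M" "A\<^sup>\<dagger> = A" "coercive A"
  obtains H where "H \<in> sa_bicommutant A" "H \<cdot> H = A" "coercive H"
proof -
  obtain l where l: "l > 0" "norm (\<I> - l *\<^sub>R A) < 1"
    using coercive_contraction [OF A(3)] .
  define S where "S = \<I> - l *\<^sub>R A"
  define s where "s = norm S"
  have s: "0 \<le> s" "s < 1" using l by (simp_all add: s_def S_def)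
  have S: "S \<in> sa_bicommutant A"
    unfolding S_def by (intro sa_bicommutant_intros A)
  define D where "D = sa_bicommutant A \<inter> cball 0 s"
  define f where "f Y = (1/2) *\<^sub>R (S + Y \<cdot> Y)" for Y
  have "complete D" "D \<noteq> {}"
    using S by (auto simp: D_def s_def complete_eq_closed closed_sa_bicommutant)
  moreover have "f ` D \<subseteq> D"
  proof clarify
    fix Y assume "Y \<in> D"
    then have Y: "Y \<in> sa_bicommutant A" "norm Y \<le> s" by (auto simp: D_def)
    have "norm (S + Y \<cdot> Y) \<le> s + s * s"
      using norm_triangle_ineq [of S "Y \<cdot> Y"] norm_blinfun_compose [of Y Y]
        mult_mono [OF Y(2) Y(2)] s by (simp add: s_def)
    also have "\<dots> \<le> 2 * s" using s mult_left_mono [of s 1 s] by simp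
    finally have "norm (f Y) \<le> s" by (simp add: f_def)
    moreover have "f Y \<in> sa_bicommutant A"
      unfolding f_def by (intro sa_bicommutant_intros A S Y)
    ultimately show "f Y \<in> D" by (simp add: D_def)
  qed
  moreover have "dist (f Y) (f Z) \<le> s * dist Y Z" if "Y \<in> D" "Z \<in> D" for Y Z
  proof -
    have n: "norm Y \<le> s" "norm Z \<le> s" using that by (simp_all add: D_def)
    have "f Y - f Z = (1/2) *\<^sub>R (Y \<cdot> (Y - Z) + (Y - Z) \<cdot> Z)"
      by (simp add: f_def blinfun_compose_bilinear flip: scaleR_diff_right)
    moreover have "norm (Y \<cdot> (Y - Z) + (Y - Z) \<cdot> Z) \<le> s * norm (Y - Z) + norm (Y - Z) * s"
      by (intro norm_triangle_le add_mono order_trans [OF norm_blinfun_compose] mult_mono n s) auto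
    ultimately show ?thesis by (simp add: dist_norm)
  qed
  ultimately obtain Y where Y: "Y \<in> D" "f Y = Y"
    using Banach_fix [of D s f] s by auto
  have Y': "Y \<in> sa_bicommutant A" "norm Y \<le> s" using Y(1) by (auto simp: D_def)
  have "(2::real) *\<^sub>R f Y = S + Y \<cdot> Y" by (simp add: f_def)
  then have "(2::real) *\<^sub>R Y = S + Y \<cdot> Y" unfolding Y(2) .
  then have eq: "(\<I> - Y) \<cdot> (\<I> - Y) = l *\<^sub>R A"
    by (simp add: S_def blinfun_compose_bilinear scaleR_2 algebra_simps)
  define H where "H = (1 / sqrt l) *\<^sub>R (\<I> - Y)"
  show thesis
  proof (rule that)
    show "H \<in> sa_bicommutant A"
      unfolding H_def by (intro sa_bicommutant_intros Y')
    show "H \<cdot> H = A"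
      using l by (simp add: H_def blinfun_compose_bilinear(7,8) eq)
    have "(1 - s) * (norm x)\<^sup>2 \<le> rinner ((\<I> - Y) x) x" for x
    proof -
      have "rinner (Y x) x \<le> s * norm x * norm x"
        using rinner_le [of "Y x" x] norm_blinfun_le [OF Y'(2), of x]
        by (meson mult_right_mono norm_ge_zero order_trans)
      then show ?thesis
        by (simp add: blinfun_apply_simps rinner_simps rinner_self power2_eq_square algebra_simps)
    qed
    then show "coercive H"
      unfolding coercive_def using s l
      by (intro exI [of _ "(1 - s) / sqrt l"]) (simp add: H_def blinfun_apply_simps rinner_simps divide_right_mono)
  qed
qed

text \<open>If \<open>H\<close> is a square root of \<open>A\<close> commuting with
  \<open>B\<close>, then \<open>A B = H B H\<close> is a conjugate of the positive \<open>B\<close>.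
  Since \<open>coercive_sqrt\<close> needs coercivity, this is done for \<open>A + e \<I>\<close>,
  and \<open>e\<close> tends to \<open>0\<close>.\<close>

lemma positive_op_compose:
  assumes A: "A \<in> M" "A\<^sup>\<dagger> = A" "positive_op A" and B: "B \<in> M" "positive_op B"
    and comm: "A \<cdot> B = B \<cdot> A"
  shows "positive_op (A \<cdot> B)"
  unfolding positive_op_def
proof
  fix x
  have "- rinner ((A \<cdot> B) x) x \<le> e * rinner (B x) x" if "e > 0" for e
  proof -
    define A' where "A' = A + e *\<^sub>R \<I>"
    have A': "A' \<in> M" "A'\<^sup>\<dagger> = A'" "coercive A'"
      using A that by (simp_all add: A'_def positive_op_add_id_coercive)
    obtain H where H: "H \<in> sa_bicommutant A'" "H \<cdot> H = A'"
      using coercive_sqrt [OF A'] by metis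
    have "B \<cdot> A' = A' \<cdot> B" by (simp add: A'_def blinfun_compose_bilinear comm)
    then have "B \<cdot> H = H \<cdot> B" using sa_bicommutantD(3) [OF H(1)] by blast
    then have "A' \<cdot> B = H \<cdot> (B \<cdot> H)" by (simp add: blinfun_compose_assoc flip: H(2))
    then have "rinner ((A' \<cdot> B) x) x = rinner (B (H x)) (H x)"
      using rinner_hadj' [OF sa_bicommutantD(1) [OF H(1)], of "B (H x)" x] sa_bicommutantD(2) [OF H(1)] by simp
    also have "\<dots> \<ge> 0" using B by (simp add: positive_op_def)
    finally show ?thesis by (simp add: A'_def blinfun_apply_simps rinner_simps)
  qed
  then have "\<forall>\<^sub>F e in at_right 0. - rinner ((A \<cdot> B) x) x \<le> e * rinner (B x) x"
    by (auto simp: eventually_at_right_field intro: exI [of _ 1])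
  then have "- rinner ((A \<cdot> B) x) x \<le> 0 * rinner (B x) x"
    by (rule tendsto_lowerbound [OF tendsto_mult_right [OF tendsto_ident_at] _ trivial_limit_at_right_real])
  then show "0 \<le> rinner ((A \<cdot> B) x) x" by simp
qed

end

subsection \<open>Averages of partial isometries\<close>

text \<open>Turns convergence of scalar quadratic forms into strong convergence; every strong limit
  taken along a sequence below arises from such a telescoping bound.\<close>

lemma Cauchy_if_norm_sq_le:
  fixes X :: "nat \<Rightarrow> 'a::real_normed_vector" and f :: "nat \<Rightarrow> real"
  assumes "convergent f" "\<And>m n. m \<le> n \<Longrightarrow> (norm (X n - X m))\<^sup>2 \<le> f n - f m"
  shows "Cauchy X"
proof (rule CauchyI)
  fix e :: real assume "e > 0"
  then obtain N where N: "\<And>m n. m \<ge> N \<Longrightarrow> n \<ge> N \<Longrightarrow> norm (f m - f n) < e\<^sup>2"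
    using CauchyD [OF convergent_Cauchy [OF assms(1)], of "e\<^sup>2"] by auto
  have "norm (X n - X m) < e" if "m \<le> n" "m \<ge> N" for m n
  proof -
    have "(norm (X n - X m))\<^sup>2 < e\<^sup>2"
      using assms(2) [OF that(1)] N [of n m] that by (simp add: abs_less_iff)
    then show ?thesis using \<open>e > 0\<close> by (simp add: power_less_imp_less_base)
  qed
  then show "\<exists>N. \<forall>m\<ge>N. \<forall>n\<ge>N. norm (X m - X n) < e"
    by (metis nle_le norm_minus_commute)
qed

lemma blinfun_eqI_rinner: "(\<And>x y. rinner y (A x) = rinner y (B x)) \<Longrightarrow> A = B"
  for A B :: "'a::real_normed_vector \<Rightarrow>\<^sub>L 'h::complex_hilbert_space"
  by (intro blinfun_eqI rinner_eqI)

lemma rinner_le_if_positive: "positive_op (B - A) \<Longrightarrow> rinner (A x) x \<le> rinner (B x) x"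
  by (simp add: positive_op_def blinfun_apply_simps rinner_simps)

context vna
begin

lemma norm_sq_le_if_positive:
  assumes "A \<in> M" "positive_op (B - A\<^sup>\<dagger> \<cdot> A)"
  shows "(norm (A x))\<^sup>2 \<le> rinner (B x) x"
  using rinner_le_if_positive [OF assms(2)] norm_sq_rinner [OF assms(1)] by simp

lemma norm_le_1_iff_positive: "A \<in> M \<Longrightarrow> norm A \<le> 1 \<longleftrightarrow> positive_op (\<I> - A\<^sup>\<dagger> \<cdot> A)"
proof
  assume A: "A \<in> M" "norm A \<le> 1"
  have "(norm (A x))\<^sup>2 \<le> (norm x)\<^sup>2" for x
    using norm_contraction_le [OF A(2)] by (simp add: power_mono)
  then show "positive_op (\<I> - A\<^sup>\<dagger> \<cdot> A)"
    using A by (simp add: positive_op_def blinfun_apply_simps rinner_simps rinner_self norm_sq_rinner)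
next
  assume "A \<in> M" "positive_op (\<I> - A\<^sup>\<dagger> \<cdot> A)"
  then have "(norm (A x))\<^sup>2 \<le> (norm x)\<^sup>2" for x
    using norm_sq_le_if_positive [of A \<I> x] by (simp add: rinner_self)
  then show "norm A \<le> 1"
    by (intro blinfun_norm_le_sq) simp_all
qed

lemma positive_op_conjugate:
  assumes "X \<in> M" "positive_op A"
  shows "positive_op (X\<^sup>\<dagger> \<cdot> A \<cdot> X)"
  using assms by (simp add: positive_op_def rinner_hadj')

end

text \<open>Newton's iteration for the inverse square root of \<open>d\<close>. These operators may
  grow without bound on the kernel of \<open>d\<close>, so only the products \<open>x r\<close> are
  expected to converge; iterating on \<open>r\<close> keeps all terms in the commutative algebra
  generated by \<open>d\<close>.\<close>

primrec inv_abs_approx :: "('h::complex_hilbert_space \<Rightarrow>\<^sub>L 'h) \<Rightarrow> nat \<Rightarrow> 'h \<Rightarrow>\<^sub>L 'h" where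
  "inv_abs_approx d 0 = \<I>"
| "inv_abs_approx d (Suc n) =
    (1/2) *\<^sub>R (inv_abs_approx d n \<cdot> (3 *\<^sub>R \<I> - d \<cdot> (inv_abs_approx d n \<cdot> inv_abs_approx d n)))"

context vna
begin

text \<open>The Newton--Schulz iteration \<open>y \<mapsto> (3 y - y y\<^sup>* y) / 2\<close> started at a contraction \<open>x\<close>
  converges strongly to the partial isometry in the polar decomposition of \<open>x\<close>.  Here
  \<open>y\<^sub>n = x r\<^sub>n\<close> with \<open>r\<^sub>n\<close> a polynomial in \<open>d = x\<^sup>* x\<close>, and \<open>u\<^sub>n = y\<^sub>n\<^sup>* y\<^sub>n\<close> increases.\<close>

lemma contraction_average_partial_isometry:
  assumes x: "x \<in> M" "norm x \<le> 1"
  obtains v where "v \<in> M" "norm v \<le> 1" "v \<cdot> (v\<^sup>\<dagger> \<cdot> v) = v" "norm (2 *\<^sub>R x - v) \<le> 1"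
proof -
  define d where "d = x\<^sup>\<dagger> \<cdot> x"
  define r where "r = inv_abs_approx d"
  define u where "u n = d \<cdot> (r n \<cdot> r n)" for n
  define y where "y n = x \<cdot> r n" for n
  have d: "d \<in> M" "d\<^sup>\<dagger> = d" "positive_op d" "positive_op (\<I> - d)"
    using x norm_le_1_iff_positive by (simp_all add: d_def)
  have r_Suc: "r (Suc n) = (1/2) *\<^sub>R (r n \<cdot> (3 *\<^sub>R \<I> - u n))" for n
    by (simp add: r_def u_def)
  have r: "r n \<in> sa_bicommutant d" for n
  proof (induction n)
    case (Suc n)
    then show ?case unfolding r_Suc u_def by (intro sa_bicommutant_intros d)
  qed (simp add: r_def sa_bicommutant_id)
  then have u: "u n \<in> sa_bicommutant d" for n
    unfolding u_def by (intro sa_bicommutant_intros d)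
  note mem [simp] = d(1,2) sa_bicommutantD(1,2) [OF r] sa_bicommutantD(1,2) [OF u]
  have comm: "A \<cdot> B = B \<cdot> A" if "A \<in> sa_bicommutant d" "B \<in> sa_bicommutant d" for A B
    using sa_bicommutant_commute that d by blast
  have pos: "positive_op (A \<cdot> B)"
    if "A \<in> sa_bicommutant d" "B \<in> sa_bicommutant d" "positive_op A" "positive_op B" for A B
    using that by (intro positive_op_compose comm) (simp_all add: sa_bicommutantD)
  have rd: "r n \<cdot> d = d \<cdot> r n" for n by (intro comm r sa_bicommutant_intros d)
  have rd_apply: "r n (d \<xi>) = d (r n \<xi>)" for n \<xi>
    using arg_cong [OF rd, of "\<lambda>A. blinfun_apply A \<xi>"] by simp
  have d_apply: "x\<^sup>\<dagger> (x \<xi>) = d \<xi>" for \<xi> by (simp add: d_def)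
  have rr: "r n \<cdot> r m = r m \<cdot> r n" for n m by (intro comm r)
  note rd' = rd blinfun_compose_cong [OF rd, unfolded blinfun_compose_assoc]
  have u_le: "positive_op (\<I> - u n)" for n
  proof (induction n)
    case (Suc n)
    \<comment> \<open>The scalar identity behind this: \<open>u' = u (3 - u)^2 / 4\<close> gives
      \<open>1 - u' = (1 - u)^2 (3/4 + (1 - u)/4)\<close>, visibly a conjugate of a positive
      operator.\<close>
    have "\<I> - u (Suc n) = (\<I> - u n)\<^sup>\<dagger> \<cdot> ((3/4) *\<^sub>R \<I> + (1/4) *\<^sub>R (\<I> - u n)) \<cdot> (\<I> - u n)"
    proof -
      have ru: "r n \<cdot> u n = u n \<cdot> r n" by (intro comm r u)
      have "u (Suc n) = (1/4) *\<^sub>R (d \<cdot> (r n \<cdot> ((3 *\<^sub>R \<I> - u n) \<cdot> (r n \<cdot> (3 *\<^sub>R \<I> - u n)))))"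
        unfolding u_def [of "Suc n"] r_Suc by (simp add: blinfun_compose_bilinear(7,8) blinfun_compose_assoc)
      also have "(3 *\<^sub>R \<I> - u n) \<cdot> (r n \<cdot> (3 *\<^sub>R \<I> - u n)) = r n \<cdot> ((3 *\<^sub>R \<I> - u n) \<cdot> (3 *\<^sub>R \<I> - u n))"
        using ru by (simp add: blinfun_compose_bilinear blinfun_compose_assoc
            blinfun_compose_cong [OF ru, unfolded blinfun_compose_assoc])
      also have "d \<cdot> (r n \<cdot> (r n \<cdot> ((3 *\<^sub>R \<I> - u n) \<cdot> (3 *\<^sub>R \<I> - u n))))
          = u n \<cdot> ((3 *\<^sub>R \<I> - u n) \<cdot> (3 *\<^sub>R \<I> - u n))"
        by (simp add: u_def blinfun_compose_assoc)
      finally show ?thesis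
        by (intro blinfun_eqI_rinner) (simp add: blinfun_apply_simps rinner_simps field_simps)
    qed
    moreover have "positive_op ((3/4) *\<^sub>R \<I> + (1/4) *\<^sub>R (\<I> - u n))"
      by (intro positive_op_add positive_op_scaleR Suc) auto
    ultimately show ?case by (metis positive_op_conjugate diff_mem id_mem mem(5))
  qed (simp add: u_def r_def d)
  have r_pos: "positive_op (r n)" and r_step: "positive_op (r (Suc n) - r n)" for n
  proof -
    have step: "positive_op (r (Suc n) - r n)" if "positive_op (r n)" for n
    proof -
      have "r (Suc n) - r n = (1/2) *\<^sub>R (r n \<cdot> (\<I> - u n))"
        by (intro blinfun_eqI_rinner) (simp add: r_Suc blinfun_apply_simps rinner_simps)
      moreover have "positive_op (r n \<cdot> (\<I> - u n))"
        by (intro pos r u sa_bicommutant_intros that u_le)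
      ultimately show ?thesis by (simp add: positive_op_scaleR)
    qed
    show r_pos: "positive_op (r n)" for n
    proof (induction n)
      case (Suc n)
      then show ?case using positive_op_add [OF step [OF Suc] Suc] by simp
    qed (simp add: r_def)
    then show "positive_op (r (Suc n) - r n)" using step by blast
  qed
  have r_mono: "positive_op (r n - r m)" if "m \<le> n" for m n
    using that
  proof (induction n rule: dec_induct)
    case (step n)
    then show ?case using positive_op_add [OF r_step [of n] step.IH] by simp
  qed (simp add: positive_op_def)
  have y: "y n \<in> M" for n using x by (simp add: y_def)
  have yy: "(y n - y m)\<^sup>\<dagger> \<cdot> (y n - y m) = d \<cdot> ((r n - r m) \<cdot> (r n - r m))" for m n
    using x by (simp add: y_def d_def [symmetric] blinfun_compose_bilinear blinfun_compose_assoc rd'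
        blinfun_compose_cong [OF d_def [symmetric], unfolded blinfun_compose_assoc])
  have y_sq: "(y n)\<^sup>\<dagger> \<cdot> y n = u n" for n
    using x by (simp add: y_def u_def blinfun_compose_assoc rd'
        blinfun_compose_cong [OF d_def [symmetric], unfolded blinfun_compose_assoc])
  \<comment> \<open>The subtracted term is the square of \<open>y n - y m\<close>, so the increments
    of \<open>y\<close> are controlled by those of \<open>u\<close>.\<close>
  have "positive_op (u n - u m - d \<cdot> ((r n - r m) \<cdot> (r n - r m)))" if "m \<le> n" for m n
  proof -
    have "u n - u m - d \<cdot> ((r n - r m) \<cdot> (r n - r m)) = 2 *\<^sub>R (d \<cdot> ((r n - r m) \<cdot> r m))"
      by (simp add: u_def blinfun_compose_bilinear rr [of n m] scaleR_2 algebra_simps)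
    moreover have "positive_op (d \<cdot> ((r n - r m) \<cdot> r m))"
      by (intro pos sa_bicommutant_intros d r r_mono r_pos that)
    ultimately show ?thesis by (simp add: positive_op_scaleR)
  qed
  then have y_le: "(norm (y n \<xi> - y m \<xi>))\<^sup>2 \<le> rinner (u n \<xi>) \<xi> - rinner (u m \<xi>) \<xi>" if "m \<le> n" for m n \<xi>
    using norm_sq_le_if_positive [of "y n - y m" "u n - u m" \<xi>, unfolded yy] y that
    by (simp add: blinfun_apply_simps rinner_simps)
  have u_pos: "positive_op (u n - u m)" if "m \<le> n" for m n
    unfolding positive_op_def
    using order_trans [OF zero_le_power2 y_le [OF that]] by (simp add: blinfun_apply_simps rinner_simps)
  have u_conv: "convergent (\<lambda>n. rinner (u n \<xi>) \<xi>)" for \<xi>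
  proof (rule Bseq_mono_convergent)
    show "\<forall>m. \<forall>n\<ge>m. rinner (u m \<xi>) \<xi> \<le> rinner (u n \<xi>) \<xi>"
      using rinner_le_if_positive [OF u_pos] by blast
    have "0 \<le> rinner (u n \<xi>) \<xi>" for n
      using positive_op_hadj_compose [OF y, of n] by (simp add: y_sq positive_op_def)
    moreover have "rinner (u n \<xi>) \<xi> \<le> rinner \<xi> \<xi>" for n
      using rinner_le_if_positive [OF u_le] by fastforce
    ultimately show "Bseq (\<lambda>n. rinner (u n \<xi>) \<xi>)"
      by (intro BseqI' [of _ "rinner \<xi> \<xi>"]) simp
  qed
  have "norm (y n) \<le> 1" for n
    using norm_le_1_iff_positive [OF y] u_le by (simp add: y_sq)
  moreover have "Cauchy (\<lambda>n. y n \<xi>)" for \<xi>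
    by (rule Cauchy_if_norm_sq_le [OF u_conv y_le])
  ultimately obtain v where v: "v \<in> M" "norm v \<le> 1" "\<And>\<xi>. (\<lambda>n. y n \<xi>) \<longlonglongrightarrow> v \<xi>"
    using strong_limit [of y 1] y by blast
  \<comment> \<open>The limit of \<open>y n (u n \<xi>)\<close> below requires strong convergence of
    \<open>u\<close>. It holds because \<open>T = u n - u m\<close> lies between \<open>0\<close>
    and \<open>\<I>\<close>, whence \<open>T^2 \<le> T\<close>.\<close>
  have u_lim: "(\<lambda>n. u n \<xi>) \<longlonglongrightarrow> v\<^sup>\<dagger> (v \<xi>)" for \<xi>
  proof -
    have "(norm (u n \<xi> - u m \<xi>))\<^sup>2 \<le> rinner (u n \<xi>) \<xi> - rinner (u m \<xi>) \<xi>" if "m \<le> n" for m n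
    proof -
      define T where "T = u n - u m"
      have T: "T \<in> sa_bicommutant d" unfolding T_def by (intro sa_bicommutant_intros u)
      have "positive_op (u m)" using positive_op_hadj_compose [OF y, of m] by (simp add: y_sq)
      from positive_op_add [OF u_le [of n] this] have "positive_op (\<I> - T)"
        by (simp add: T_def algebra_simps)
      then have "positive_op (T \<cdot> (\<I> - T))"
        using u_pos [OF that] by (intro pos T sa_bicommutant_intros) (simp_all add: T_def)
      then have "positive_op (T - T\<^sup>\<dagger> \<cdot> T)"
        using sa_bicommutantD(2) [OF T] by (simp add: blinfun_compose_bilinear)
      then show ?thesis
        using norm_sq_le_if_positive [OF sa_bicommutantD(1) [OF T], of T \<xi>]
        by (simp add: T_def blinfun_apply_simps rinner_simps)
    qed
    then have "convergent (\<lambda>n. u n \<xi>)"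
      by (intro Cauchy_convergent Cauchy_if_norm_sq_le [OF u_conv])
    then obtain w where w: "(\<lambda>n. u n \<xi>) \<longlonglongrightarrow> w" by (auto simp: convergent_def)
    have "w = v\<^sup>\<dagger> (v \<xi>)"
    proof (rule rinner_eqI, rule LIMSEQ_unique)
      fix \<eta>
      show "(\<lambda>n. rinner \<eta> (u n \<xi>)) \<longlonglongrightarrow> rinner \<eta> w"
        by (intro tendsto_rinner tendsto_const w)
      have "rinner \<eta> (u n \<xi>) = rinner (y n \<eta>) (y n \<xi>)" for n
        using y by (simp add: rinner_hadj flip: y_sq)
      then show "(\<lambda>n. rinner \<eta> (u n \<xi>)) \<longlonglongrightarrow> rinner \<eta> (v\<^sup>\<dagger> (v \<xi>))"
        using tendsto_rinner [OF v(3) v(3)] v(1) by (simp add: rinner_hadj)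
    qed
    with w show ?thesis by simp
  qed
  have yu_lim: "(\<lambda>n. y n (u n \<xi>)) \<longlonglongrightarrow> v (v\<^sup>\<dagger> (v \<xi>))" for \<xi>
  proof -
    have "(\<lambda>n. y n (u n \<xi> - v\<^sup>\<dagger> (v \<xi>))) \<longlonglongrightarrow> 0"
    proof (rule Lim_null_comparison)
      show "(\<lambda>n. norm (u n \<xi> - v\<^sup>\<dagger> (v \<xi>))) \<longlonglongrightarrow> 0"
        using u_lim [of \<xi>] by (simp add: tendsto_norm_zero LIM_zero)
      show "\<forall>\<^sub>F n in sequentially. norm (y n (u n \<xi> - v\<^sup>\<dagger> (v \<xi>))) \<le> norm (u n \<xi> - v\<^sup>\<dagger> (v \<xi>))"
        using norm_contraction_le \<open>\<And>n. norm (y n) \<le> 1\<close> by (intro always_eventually allI) blast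
    qed
    from tendsto_add [OF this v(3) [of "v\<^sup>\<dagger> (v \<xi>)"]] show ?thesis by (simp add: blinfun_apply_simps)
  qed
  \<comment> \<open>The limit of the iteration is a fixed point, and
    \<open>v = (3 v - v v\<^sup>\<dagger> v) / 2\<close> is the partial isometry equation.\<close>
  have "v \<xi> = (1/2) *\<^sub>R (3 *\<^sub>R v \<xi> - v (v\<^sup>\<dagger> (v \<xi>)))" for \<xi>
  proof (rule LIMSEQ_unique)
    show "(\<lambda>n. y (Suc n) \<xi>) \<longlonglongrightarrow> v \<xi>" using v(3) by (rule LIMSEQ_Suc)
    have "y (Suc n) \<xi> = (1/2) *\<^sub>R (3 *\<^sub>R y n \<xi> - y n (u n \<xi>))" for n
      by (simp add: y_def r_Suc blinfun_apply_simps)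
    then show "(\<lambda>n. y (Suc n) \<xi>) \<longlonglongrightarrow> (1/2) *\<^sub>R (3 *\<^sub>R v \<xi> - v (v\<^sup>\<dagger> (v \<xi>)))"
      by (auto intro!: tendsto_intros v(3) yu_lim)
  qed
  then have v_eq: "2 *\<^sub>R v \<xi> = 2 *\<^sub>R (1/2) *\<^sub>R (3 *\<^sub>R v \<xi> - v (v\<^sup>\<dagger> (v \<xi>)))" for \<xi>
    by simp
  have "v (v\<^sup>\<dagger> (v \<xi>)) = v \<xi>" for \<xi>
    using v_eq [of \<xi>] scaleR_left_distrib [of 2 1 "v \<xi>"] by (simp add: algebra_simps)
  moreover have "norm (2 *\<^sub>R x - v) \<le> 1"
  proof (rule norm_blinfun_bound)
    fix \<xi>
    have "norm ((2 *\<^sub>R x - y n) \<xi>) \<le> 1 * norm \<xi>" for n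
    proof (rule norm_blinfun_le)
      have "(2 *\<^sub>R x - y n)\<^sup>\<dagger> \<cdot> (2 *\<^sub>R x - y n) = 4 *\<^sub>R d - 4 *\<^sub>R (d \<cdot> r n) + u n"
        using x by (intro blinfun_eqI_rinner)
          (simp add: y_def u_def blinfun_apply_simps rinner_simps d_apply rd_apply)
      \<comment> \<open>Here the start \<open>r 0 = \<I>\<close> matters: since \<open>r\<close>
        increases from it, \<open>d (r n - r 0)\<close> is positive. In the limit this is the scalar
        fact that \<open>2 s - 1\<close> lies in \<open>[-1, 1]\<close> for \<open>s\<close> in
        \<open>(0, 1]\<close>.\<close>
      then have "\<I> - (2 *\<^sub>R x - y n)\<^sup>\<dagger> \<cdot> (2 *\<^sub>R x - y n) = (\<I> - u n) + 4 *\<^sub>R (d \<cdot> (r n - r 0))"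
        by (simp add: r_def blinfun_compose_bilinear algebra_simps)
      moreover have "positive_op \<dots>"
        by (intro positive_op_add u_le positive_op_scaleR pos sa_bicommutant_intros d r r_mono) auto
      ultimately have "positive_op (\<I> - (2 *\<^sub>R x - y n)\<^sup>\<dagger> \<cdot> (2 *\<^sub>R x - y n))"
        by (simp only:)
      then show "norm (2 *\<^sub>R x - y n) \<le> 1"
        using norm_le_1_iff_positive x y by blast
    qed
    moreover have "(\<lambda>n. norm ((2 *\<^sub>R x - y n) \<xi>)) \<longlonglongrightarrow> norm ((2 *\<^sub>R x - v) \<xi>)"
      by (auto simp: blinfun_apply_simps intro!: tendsto_intros v(3))
    ultimately show "norm ((2 *\<^sub>R x - v) \<xi>) \<le> 1 * norm \<xi>"
      by (meson LIMSEQ_le_const2)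
  qed simp
  ultimately show thesis using v(1,2) by (intro that [of v]) (auto intro: blinfun_eqI)
qed

end

subsection \<open>C*-extreme points are maximal partial isometries\<close>

lemma (in vna) Units_operator_algebra:
  "Units (operator_algebra M) = {t \<in> M. \<exists>s\<in>M. s \<cdot> t = \<I> \<and> t \<cdot> s = \<I>}"
  by (auto simp: Units_def operator_algebra_def)

lemma (in vna) unitaries_operator_algebra:
  "unitaries (operator_algebra M) = {u \<in> M. u\<^sup>\<dagger> \<cdot> u = \<I> \<and> u \<cdot> u\<^sup>\<dagger> = \<I>}"
  by (auto simp: unitaries_def operator_algebra_def)

lemma (in vna) closed_unit_ball_operator_algebra:
  "closed_unit_ball (operator_algebra M) = {x \<in> M. norm x \<le> 1}"
  by (auto simp: closed_unit_ball_def operator_algebra_def)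

context vna
begin

text \<open>Kadison's description of the linear extreme points of the unit ball of
  \<open>M\<close>.\<close>

definition maximal_partial_isometries :: "('h \<Rightarrow>\<^sub>L 'h) set"
  where "maximal_partial_isometries = {v \<in> M. v \<cdot> (v\<^sup>\<dagger> \<cdot> v) = v \<and>
    (\<forall>m\<in>M. (\<I> - v \<cdot> v\<^sup>\<dagger>) \<cdot> m \<cdot> (\<I> - v\<^sup>\<dagger> \<cdot> v) = 0)}"

text \<open>A midpoint is a C*-convex combination with both coefficients equal to the invertible
  scalar \<open>\<I> / sqrt 2\<close>.\<close>

lemma cstar_extreme_point_midpoint:
  assumes x: "cstar_extreme_point (operator_algebra M) x"
    and y: "y \<in> M" "norm y \<le> 1" and z: "z \<in> M" "norm z \<le> 1" and eq: "x = (1/2) *\<^sub>R (y + z)"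
  obtains u where "u \<in> M" "u\<^sup>\<dagger> \<cdot> u = \<I>" "u \<cdot> u\<^sup>\<dagger> = \<I>" "y = u\<^sup>\<dagger> \<cdot> x \<cdot> u"
proof -
  define Y where "Y i = (if i = Suc 0 then y else z)" for i
  define t where "t = (\<lambda>i::nat. (1 / sqrt 2) *\<^sub>R (\<I> :: 'h \<Rightarrow>\<^sub>L 'h))"
  have "\<exists>s\<in>M. s \<cdot> t i = \<I> \<and> t i \<cdot> s = \<I>" for i
    by (rule bexI [of _ "sqrt 2 *\<^sub>R \<I>"]) (simp_all add: t_def blinfun_compose_bilinear)
  then have "\<forall>i\<in>{1..2}. Y i \<in> closed_unit_ball (operator_algebra M) \<and> t i \<in> Units (operator_algebra M)"
    using y z by (simp add: Units_operator_algebra closed_unit_ball_operator_algebra Y_def t_def)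
  moreover have "(\<Sum>i=1..2. star (operator_algebra M) (t i) \<otimes>\<^bsub>operator_algebra M\<^esub> t i) = \<one>\<^bsub>operator_algebra M\<^esub>"
    by (simp add: operator_algebra_def numeral_2_eq_2 t_def blinfun_compose_bilinear flip: scaleR_left_distrib)
  moreover have "x = (\<Sum>i=1..2. star (operator_algebra M) (t i) \<otimes>\<^bsub>operator_algebra M\<^esub> Y i \<otimes>\<^bsub>operator_algebra M\<^esub> t i)"
    by (simp add: operator_algebra_def numeral_2_eq_2 t_def Y_def eq blinfun_compose_bilinear scaleR_add_right)
  ultimately obtain u where "\<forall>i\<in>{1..2}. u i \<in> unitaries (operator_algebra M) \<and>
      Y i = star (operator_algebra M) (u i) \<otimes>\<^bsub>operator_algebra M\<^esub> x \<otimes>\<^bsub>operator_algebra M\<^esub> u i"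
    using x unfolding cstar_extreme_point_def by blast
  then have "u 1 \<in> unitaries (operator_algebra M)" "Y 1 = (u 1)\<^sup>\<dagger> \<cdot> x \<cdot> u 1"
    by (auto simp: operator_algebra_def)
  then show thesis using that [of "u 1"] by (auto simp: unitaries_operator_algebra Y_def)
qed

text \<open>Unitary conjugation preserves and reflects the partial isometry equation. Both
  directions serve: \<open>x\<close> inherits it from its polar factor, and later
  \<open>x + c\<close> inherits it from \<open>x\<close>.\<close>

lemma cstar_extreme_point_midpoint_partial_isometry:
  assumes x: "cstar_extreme_point (operator_algebra M) x"
    and y: "y \<in> M" "norm y \<le> 1" and z: "z \<in> M" "norm z \<le> 1" and eq: "x = (1/2) *\<^sub>R (y + z)"
  shows "x \<cdot> (x\<^sup>\<dagger> \<cdot> x) = x \<longleftrightarrow> y \<cdot> (y\<^sup>\<dagger> \<cdot> y) = y"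
proof -
  obtain u where u: "u \<in> M" "u\<^sup>\<dagger> \<cdot> u = \<I>" "u \<cdot> u\<^sup>\<dagger> = \<I>" "y = u\<^sup>\<dagger> \<cdot> x \<cdot> u"
    using cstar_extreme_point_midpoint [OF assms] .
  have x: "x \<in> M" using eq y(1) z(1) by simp
  have uu: "u (u\<^sup>\<dagger> \<xi>) = \<xi>" "u\<^sup>\<dagger> (u \<xi>) = \<xi>" for \<xi>
    using arg_cong [OF u(3), of "\<lambda>A. blinfun_apply A \<xi>"] arg_cong [OF u(2), of "\<lambda>A. blinfun_apply A \<xi>"]
    by simp_all
  have yyy: "y \<cdot> (y\<^sup>\<dagger> \<cdot> y) = u\<^sup>\<dagger> \<cdot> (x \<cdot> (x\<^sup>\<dagger> \<cdot> x)) \<cdot> u"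
    using u(1) x by (intro blinfun_eqI) (simp add: u(4) uu)
  have "u \<cdot> (u\<^sup>\<dagger> \<cdot> a \<cdot> u) \<cdot> u\<^sup>\<dagger> = a" for a
    by (intro blinfun_eqI) (simp add: uu)
  then have "u\<^sup>\<dagger> \<cdot> a \<cdot> u = u\<^sup>\<dagger> \<cdot> b \<cdot> u \<longleftrightarrow> a = b" for a b
    by metis
  from this [of "x \<cdot> (x\<^sup>\<dagger> \<cdot> x)" x] show ?thesis
    by (simp only: flip: u(4) yyy)
qed

lemma cstar_extreme_point_imp_maximal_partial_isometry:
  assumes x: "cstar_extreme_point (operator_algebra M) x"
  shows "x \<in> maximal_partial_isometries"
proof -
  have mem: "x \<in> M" "norm x \<le> 1"
    using x by (auto simp: cstar_extreme_point_def closed_unit_ball_operator_algebra)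
  obtain v where v: "v \<in> M" "norm v \<le> 1" "v \<cdot> (v\<^sup>\<dagger> \<cdot> v) = v" "norm (2 *\<^sub>R x - v) \<le> 1"
    using contraction_average_partial_isometry [OF mem] .
  have "x = (1/2) *\<^sub>R (v + (2 *\<^sub>R x - v))" by simp
  then have xxx: "x \<cdot> (x\<^sup>\<dagger> \<cdot> x) = x"
    using cstar_extreme_point_midpoint_partial_isometry [OF x v(1,2) _ v(4)] v(1,3) mem(1) by simp
  then have x_apply: "x (x\<^sup>\<dagger> (x \<xi>)) = x \<xi>" for \<xi>
    by (metis blinfun_apply_blinfun_compose)
  have x_apply': "x\<^sup>\<dagger> (x (x\<^sup>\<dagger> \<xi>)) = x\<^sup>\<dagger> \<xi>" for \<xi>
    using arg_cong [OF arg_cong [OF xxx, of hadj], of "\<lambda>A. blinfun_apply A \<xi>"] mem(1) by simp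
  have "(\<I> - x \<cdot> x\<^sup>\<dagger>) \<cdot> m \<cdot> (\<I> - x\<^sup>\<dagger> \<cdot> x) = 0" if m: "m \<in> M" for m
  proof (rule ccontr)
    define c0 where "c0 = (\<I> - x \<cdot> x\<^sup>\<dagger>) \<cdot> m \<cdot> (\<I> - x\<^sup>\<dagger> \<cdot> x)"
    \<comment> \<open>Any norm strictly between \<open>0\<close> and \<open>1\<close> would do,
      since \<open>c = c c\<^sup>\<dagger> c\<close> forces the norm to be \<open>0\<close> or at
      least \<open>1\<close>.\<close>
    define c where "c = (1 / (2 * norm c0)) *\<^sub>R c0"
    assume "(\<I> - x \<cdot> x\<^sup>\<dagger>) \<cdot> m \<cdot> (\<I> - x\<^sup>\<dagger> \<cdot> x) \<noteq> 0"
    then have "norm c = 1/2" by (simp add: c_def c0_def)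
    have c: "c \<in> M" using m mem(1) by (simp add: c_def c0_def)
    have xc: "x\<^sup>\<dagger> (c \<xi>) = 0" for \<xi>
      by (simp add: c_def c0_def blinfun_apply_simps x_apply')
    have cx: "x (c\<^sup>\<dagger> \<xi>) = 0" for \<xi>
      using m mem(1) by (simp add: c_def c0_def blinfun_apply_simps x_apply)
    have cx': "c (x\<^sup>\<dagger> \<xi>) = 0" for \<xi>
      by (simp add: c_def c0_def blinfun_apply_simps x_apply')
    have xc': "c\<^sup>\<dagger> (x \<xi>) = 0" for \<xi>
      using m mem(1) by (simp add: c_def c0_def blinfun_apply_simps x_apply)
    \<comment> \<open>\<open>c\<close> kills the range of \<open>x\<^sup>\<dagger>\<close>, so it
      sees only the component \<open>p\<close> of \<open>\<xi>\<close>, and its range is orthogonal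
      to that of \<open>x\<close>. Pythagoras gives the bound for either sign of
      \<open>r\<close>.\<close>
    have norm_le: "norm (x + r *\<^sub>R c) \<le> 1" if "\<bar>r\<bar> = 1" for r :: real
    proof (rule blinfun_norm_le_sq)
      fix \<xi>
      define p where "p = \<xi> - x\<^sup>\<dagger> (x \<xi>)"
      have "c \<xi> = c p" by (simp add: p_def blinfun_apply_simps cx')
      then have "norm (c \<xi>) \<le> norm p"
        using norm_contraction_le [of c p] \<open>norm c = 1/2\<close> by simp
      then have "(norm (c \<xi>))\<^sup>2 \<le> (norm p)\<^sup>2" by (simp add: power_mono)
      also have "\<dots> = (norm \<xi>)\<^sup>2 - (norm (x \<xi>))\<^sup>2"
        by (simp add: p_def norm_diff_sq norm_sq_rinner [of "x\<^sup>\<dagger>"] mem(1) x_apply' rinner_hadj rinner_self)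
          (simp add: rinner_hadj' rinner_self mem(1) x_apply)
      finally have "(norm (x \<xi>))\<^sup>2 + (norm (c \<xi>))\<^sup>2 \<le> (norm \<xi>)\<^sup>2" by simp
      moreover have "rinner (x \<xi>) (c \<xi>) = 0"
        using rinner_hadj [OF mem(1), of \<xi> "c \<xi>"] by (simp add: xc)
      ultimately show "(norm ((x + r *\<^sub>R c) \<xi>))\<^sup>2 \<le> 1\<^sup>2 * (norm \<xi>)\<^sup>2"
        using that by (simp add: blinfun_apply_simps norm_add_sq rinner_simps)
    qed simp
    have "x = (1/2) *\<^sub>R ((x + c) + (x - c))" by (simp flip: scaleR_2)
    then have "(x + c) \<cdot> ((x + c)\<^sup>\<dagger> \<cdot> (x + c)) = x + c"
      using cstar_extreme_point_midpoint_partial_isometry [OF x, of "x + c" "x - c"]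
        norm_le [of 1] norm_le [of "-1"] mem(1) c xxx by simp
    \<comment> \<open>All mixed products vanish by the four annihilation facts above, so only the
      two pure cubes remain.\<close>
    moreover have "(x + c) \<cdot> ((x + c)\<^sup>\<dagger> \<cdot> (x + c)) = x + c \<cdot> (c\<^sup>\<dagger> \<cdot> c)"
      using mem(1) c by (intro blinfun_eqI) (simp add: blinfun_apply_simps x_apply xc cx cx' xc')
    ultimately have "c = c \<cdot> (c\<^sup>\<dagger> \<cdot> c)" by simp
    then have "norm c \<le> norm c * (norm (c\<^sup>\<dagger>) * norm c)"
      by (metis norm_blinfun_compose mult_left_mono norm_ge_zero order_trans)
    then show False using c \<open>norm c = 1/2\<close> by simp
  qed
  then show ?thesis using mem(1) xxx by (simp add: maximal_partial_isometries_def)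
qed

end

subsection \<open>Central supports\<close>

lemma subspace_closure:
  fixes S :: "'a::real_normed_vector set"
  assumes S: "subspace S"
  shows "subspace (closure S)"
  unfolding subspace_def
proof (intro conjI ballI allI)
  show "0 \<in> closure S" using subspace_0 [OF S] closure_subset by blast
next
  fix x y assume "x \<in> closure S" "y \<in> closure S"
  then obtain a b where "\<forall>n. a n \<in> S" "a \<longlonglongrightarrow> x" "\<forall>n. b n \<in> S" "b \<longlonglongrightarrow> y"
    unfolding closure_sequential by blast
  then show "x + y \<in> closure S"
    unfolding closure_sequential using subspace_add [OF S]
    by (intro exI [of _ "\<lambda>n. a n + b n"]) (simp add: tendsto_add)
next
  fix c :: real and x assume "x \<in> closure S"
  then obtain a where "\<forall>n. a n \<in> S" "a \<longlonglongrightarrow> x"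
    unfolding closure_sequential by blast
  then show "c *\<^sub>R x \<in> closure S"
    unfolding closure_sequential using subspace_scale [OF S]
    by (intro exI [of _ "\<lambda>n. c *\<^sub>R a n"]) (simp add: tendsto_scaleR)
qed

lemma nearest_point_exists:
  fixes K :: "'h::complex_hilbert_space set"
  assumes K: "subspace K" "closed K"
  obtains k where "k \<in> K" "\<And>l. l \<in> K \<Longrightarrow> norm (x - k) \<le> norm (x - l)"
proof -
  define d where "d = (INF k\<in>K. (norm (x - k))\<^sup>2)"
  have bdd: "bdd_below ((\<lambda>k. (norm (x - k))\<^sup>2) ` K)" by (rule bdd_belowI [of _ 0]) auto
  have d_le: "d \<le> (norm (x - k))\<^sup>2" if "k \<in> K" for k
    unfolding d_def using bdd that by (rule cINF_lower)
  have "\<exists>k\<in>K. (norm (x - k))\<^sup>2 < d + e" if "e > 0" for e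
    using cINF_less_iff [OF _ bdd, of "d + e"] subspace_0 [OF K(1)] that by (auto simp: d_def)
  then have "\<exists>k\<in>K. (norm (x - k))\<^sup>2 < d + inverse (real (Suc n))" for n by simp
  then obtain k where k: "\<And>n. k n \<in> K" "\<And>n. (norm (x - k n))\<^sup>2 < d + inverse (real (Suc n))"
    by metis
  have parallelogram: "(norm (k m - k n))\<^sup>2 \<le> 2 * inverse (real (Suc m)) + 2 * inverse (real (Suc n))" for m n
  proof -
    have "(1/2) *\<^sub>R (k m + k n) \<in> K" using k(1) K(1) by (simp add: subspace_add subspace_scale)
    then have "d \<le> (norm (x - (1/2) *\<^sub>R (k m + k n)))\<^sup>2" by (rule d_le)
    also have "\<dots> = (norm (x - k m))\<^sup>2 / 2 + (norm (x - k n))\<^sup>2 / 2 - (norm (k m - k n))\<^sup>2 / 4"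
      by (simp add: rinner_simps rinner_commute field_simps flip: rinner_self)
    finally show ?thesis using k(2) [of m] k(2) [of n] by linarith
  qed
  have "Cauchy k"
  proof (rule CauchyI)
    fix e :: real assume "e > 0"
    then obtain N where N: "inverse (real (Suc N)) < e\<^sup>2 / 4"
      using reals_Archimedean [of "e\<^sup>2 / 4"] by auto
    have "norm (k m - k n) < e" if "m \<ge> N" "n \<ge> N" for m n
    proof -
      have "inverse (real (Suc m)) \<le> inverse (real (Suc N))" "inverse (real (Suc n)) \<le> inverse (real (Suc N))"
        using that by (simp_all add: le_imp_inverse_le)
      then have "(norm (k m - k n))\<^sup>2 < e\<^sup>2" using parallelogram [of m n] N by linarith
      then show ?thesis using \<open>e > 0\<close> by (simp add: power_less_imp_less_base)
    qed
    then show "\<exists>N. \<forall>m\<ge>N. \<forall>n\<ge>N. norm (k m - k n) < e" by blast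
  qed
  then obtain l where l: "k \<longlonglongrightarrow> l" using Cauchy_convergent convergent_def by blast
  have "l \<in> K" using closed_sequentially [OF K(2) k(1) l] .
  moreover have "(norm (x - l))\<^sup>2 \<le> d"
  proof (rule LIMSEQ_le)
    show "(\<lambda>n. (norm (x - k n))\<^sup>2) \<longlonglongrightarrow> (norm (x - l))\<^sup>2"
      by (intro tendsto_power tendsto_norm tendsto_diff tendsto_const l)
    show "(\<lambda>n. d + inverse (real (Suc n))) \<longlonglongrightarrow> d"
      using tendsto_add [OF tendsto_const LIMSEQ_inverse_real_of_nat, of d] by simp
    show "\<exists>N. \<forall>n\<ge>N. (norm (x - k n))\<^sup>2 \<le> d + inverse (real (Suc n))"
      using k(2) less_imp_le by blast
  qed
  then have "norm (x - l) \<le> norm (x - m)" if "m \<in> K" for m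
    using d_le [OF that] by (meson norm_ge_zero order_trans power2_le_imp_le)
  ultimately show thesis using that by blast
qed

text \<open>Subspaces, orthogonality and linearity are real here; that the projection of interest
  lies in \<open>M\<close> is left to \<open>range_projection_mem\<close>.\<close>

lemma orthogonal_projection_exists:
  fixes K :: "'h::complex_hilbert_space set"
  assumes K: "subspace K" "closed K"
  obtains P :: "'h \<Rightarrow>\<^sub>L 'h"
  where "\<And>x. P x \<in> K" "\<And>x k. k \<in> K \<Longrightarrow> rinner (x - P x) k = 0"
proof -
  have "\<exists>k\<in>K. \<forall>l\<in>K. rinner (x - k) l = 0" for x
  proof -
    obtain k where k: "k \<in> K" "\<And>l. l \<in> K \<Longrightarrow> norm (x - k) \<le> norm (x - l)"
      using nearest_point_exists [OF K, of x] by blast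
    have "rinner (x - k) l = 0" if "l \<in> K" for l
    proof (rule ccontr)
      define a where "a = rinner (x - k) l"
      \<comment> \<open>The step along \<open>l\<close> that minimizes the distance from
        \<open>x - k\<close> to the line through \<open>l\<close>.\<close>
      define t where "t = a / (norm l)\<^sup>2"
      assume "rinner (x - k) l \<noteq> 0"
      then have "a \<noteq> 0" "l \<noteq> 0" by (auto simp: a_def)
      have "k + t *\<^sub>R l \<in> K" using k(1) that K(1) by (simp add: subspace_add subspace_scale)
      then have "(norm (x - k))\<^sup>2 \<le> (norm ((x - k) - t *\<^sub>R l))\<^sup>2"
        using k(2) [of "k + t *\<^sub>R l"] by (simp add: power_mono algebra_simps)
      then have "2 * t * a \<le> t\<^sup>2 * (norm l)\<^sup>2"
        unfolding norm_diff_sq [of "x - k"] by (simp add: a_def rinner_scaleR power_mult_distrib)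
      then have "a\<^sup>2 \<le> 0" using \<open>l \<noteq> 0\<close> by (simp add: t_def power2_eq_square field_simps)
      then show False using \<open>a \<noteq> 0\<close> by simp
    qed
    with k(1) show ?thesis by blast
  qed
  then have "\<exists>p. \<forall>x. p x \<in> K \<and> (\<forall>l\<in>K. rinner (x - p x) l = 0)" by (intro choice) blast
  then obtain p where p: "\<And>x. p x \<in> K" "\<And>x l. l \<in> K \<Longrightarrow> rinner (x - p x) l = 0" by blast
  have unique: "p x = y" if "y \<in> K" "\<And>l. l \<in> K \<Longrightarrow> rinner (x - y) l = 0" for x y
  proof -
    have "p x - y \<in> K" using that(1) p(1) K(1) by (simp add: subspace_diff)
    then have "rinner (p x - y) (p x - y) = 0"
      using p(2) [of "p x - y" x] that(2) [of "p x - y"] by (simp add: rinner_simps)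
    then show ?thesis by (simp add: rinner_self)
  qed
  have "bounded_linear p"
  proof (rule bounded_linear_intro)
    fix x y r
    show "p (x + y) = p x + p y"
    proof (rule unique)
      show "rinner (x + y - (p x + p y)) l = 0" if "l \<in> K" for l
        using p(2) [OF that, of x] p(2) [OF that, of y] by (simp add: rinner_simps)
    qed (simp add: p K(1) subspace_add)
    show "p (r *\<^sub>R x) = r *\<^sub>R p x"
    proof (rule unique)
      show "rinner (r *\<^sub>R x - r *\<^sub>R p x) l = 0" if "l \<in> K" for l
        using p(2) [OF that, of x] by (simp add: rinner_simps)
    qed (simp add: p K(1) subspace_scale)
    have "(norm (p x))\<^sup>2 = rinner x (p x)"
      using p(2) [OF p(1), of x x] by (simp add: rinner_simps rinner_self)
    also have "\<dots> \<le> norm x * norm (p x)" by (rule rinner_le)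
    finally show "norm (p x) \<le> norm x * 1"
      by (cases "p x = 0") (simp_all add: power2_eq_square)
  qed
  then have "blinfun_apply (Blinfun p) = p" by (rule bounded_linear_Blinfun_apply)
  then show thesis using that [of "Blinfun p"] p by simp
qed

context vna
begin

text \<open>With \<open>a = \<Sum>b\<in>F. b b\<^sup>*\<close>, the operators \<open>a (a + e)\<^sup>-\<^sup>1 = \<I> - e (a + e)\<^sup>-\<^sup>1\<close> lie in \<open>M\<close>,
  vanish on the orthogonal complement of the ranges of the \<open>b \<in> F\<close>, and converge strongly to the
  identity on these ranges as \<open>e\<close> tends to \<open>0\<close>.\<close>

lemma range_projection_mem:
  assumes B: "B \<subseteq> M" and K: "K = closure (span (\<Union>b\<in>B. range (blinfun_apply b)))"
    and P: "\<And>x. blinfun_apply P x \<in> K" "\<And>x k. k \<in> K \<Longrightarrow> rinner (x - P x) k = 0"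
  shows "P \<in> M"
proof (rule mem_if_strong_limit_point)
  fix X :: "'h set" and d :: real
  assume X: "finite X" and d: "d > 0"
  define S where "S C = span (\<Union>b\<in>C. range (blinfun_apply b))" for C :: "('h \<Rightarrow>\<^sub>L 'h) set"
  \<comment> \<open>Each \<open>P x\<close> is nearly a finite combination of vectors in the ranges,
    and only finitely many \<open>x\<close> are tested, so finitely many \<open>b\<close> suffice
    and \<open>a\<close> below is a finite sum.\<close>
  have "\<exists>y F. finite F \<and> F \<subseteq> B \<and> y \<in> S F \<and> norm (P x - y) < d / 2" for x
  proof -
    have "P x \<in> closure (S B)" using P(1) by (simp add: K S_def)
    then obtain y where y: "y \<in> S B" "dist y (P x) < d / 2"
      using d unfolding closure_approachable by (meson half_gt_zero)
    from y(1) obtain T r where T: "finite T" "T \<subseteq> (\<Union>b\<in>B. range (blinfun_apply b))" "y = (\<Sum>a\<in>T. r a *\<^sub>R a)"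
      unfolding S_def span_explicit by blast
    obtain F where F: "finite F" "F \<subseteq> B" "T \<subseteq> (\<Union>b\<in>F. range (blinfun_apply b))"
      using finite_subset_Union [OF T(1), of "(\<lambda>b. range (blinfun_apply b)) ` B"] T(2)
        finite_subset_image by metis
    have "y \<in> S F"
      unfolding T(3) S_def using F(3) by (intro span_sum span_scale span_base) blast
    with F y(2) show ?thesis by (auto simp: dist_norm norm_minus_commute)
  qed
  then obtain y F where yF: "\<And>x. finite (F x)" "\<And>x. F x \<subseteq> B" "\<And>x. y x \<in> S (F x)" "\<And>x. norm (P x - y x) < d / 2"
    by metis
  define G where "G = (\<Union>x\<in>X. F x)"
  have G: "finite G" "G \<subseteq> B" using X yF by (auto simp: G_def)
  then have GM: "b \<in> M" if "b \<in> G" for b using B that by blast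
  have yG: "y x \<in> S G" if "x \<in> X" for x
    using yF(3) [of x] that span_mono [of "\<Union>b\<in>F x. range (blinfun_apply b)" "\<Union>b\<in>G. range (blinfun_apply b)"]
    unfolding S_def G_def by blast
  define a where "a = (\<Sum>b\<in>G. b \<cdot> b\<^sup>\<dagger>)"
  have a: "a \<in> M" unfolding a_def using GM by (intro sum_mem) auto
  have a_rinner: "rinner (a x) x = (\<Sum>b\<in>G. (norm (b\<^sup>\<dagger> x))\<^sup>2)" for x
    unfolding a_def by (simp add: blinfun.sum_left rinner_sum)
      (intro sum.cong refl, simp add: GM rinner_self flip: rinner_hadj)
  have a_pos: "positive_op a" by (simp add: positive_op_def a_rinner sum_nonneg)
  \<comment> \<open>The premise sits inside the existential so that \<open>R\<close> can be chosen
    as a total function of \<open>e\<close>.\<close>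
  have "\<exists>R. 0 < e \<longrightarrow> R \<in> M \<and> (a + e *\<^sub>R \<I>) \<cdot> R = \<I> \<and> R \<cdot> (a + e *\<^sub>R \<I>) = \<I>" for e
  proof (cases "e > 0")
    case True
    then show ?thesis
      using coercive_inverse [OF _ positive_op_add_id_coercive [OF a_pos True]] a by (metis add_mem id_mem scaleR_mem)
  qed blast
  then obtain R where R: "\<And>e. 0 < e \<Longrightarrow> R e \<in> M" "\<And>e. 0 < e \<Longrightarrow> (a + e *\<^sub>R \<I>) \<cdot> R e = \<I>"
      "\<And>e. 0 < e \<Longrightarrow> R e \<cdot> (a + e *\<^sub>R \<I>) = \<I>"
    by metis
  have R_rinner: "rinner (a (R e x)) (R e x) + e * (norm (R e x))\<^sup>2 = rinner x (R e x)" if "e > 0" for e x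
    using arg_cong [OF R(2) [OF that], of "\<lambda>A. rinner (A x) (R e x)"]
    by (simp add: blinfun_apply_simps rinner_simps rinner_self)
  have R_norm: "norm (e *\<^sub>R R e x) \<le> norm x" if "e > 0" for e x
  proof -
    have "e * (norm (R e x))\<^sup>2 \<le> norm x * norm (R e x)"
      using R_rinner [OF that, of x] a_pos [unfolded positive_op_def, rule_format, of "R e x"]
        rinner_le [of x "R e x"] by linarith
    then show ?thesis using that by (cases "R e x = 0") (simp_all add: power2_eq_square)
  qed
  \<comment> \<open>Pairing \<open>(a + e) h = b x\<close> with \<open>h\<close> gives
    \<open>\<beta>^2 + e \<parallel>h\<parallel>^2 \<le> \<parallel>x\<parallel> \<beta>\<close>,
    because \<open>b b\<^sup>\<dagger>\<close> is a summand of \<open>a\<close>. Hence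
    \<open>e \<parallel>h\<parallel>^2\<close> stays bounded and \<open>e h\<close> has order
    \<open>sqrt e\<close>.\<close>
  have R_range: "norm (e *\<^sub>R R e (b x)) \<le> sqrt e * norm x" if e: "e > 0" and b: "b \<in> G" for e b x
  proof -
    define h where "h = R e (b x)"
    define \<beta> where "\<beta> = norm (b\<^sup>\<dagger> h)"
    have "rinner (b x) h \<le> norm x * \<beta>"
      using rinner_le [of x "b\<^sup>\<dagger> h"] by (simp add: \<beta>_def rinner_hadj GM b)
    moreover have "\<beta>\<^sup>2 \<le> rinner (a h) h"
      unfolding a_rinner \<beta>_def using G(1) b by (intro member_le_sum) auto
    ultimately have "\<beta>\<^sup>2 + e * (norm h)\<^sup>2 \<le> norm x * \<beta>"
      using R_rinner [OF e, of "b x"] by (simp add: h_def)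
    moreover have "norm x * \<beta> \<le> \<beta>\<^sup>2 + (norm x)\<^sup>2"
    proof -
      have "0 \<le> norm x * \<beta>" by (simp add: \<beta>_def)
      then show ?thesis using sum_squares_bound [of "norm x" \<beta>] unfolding mult.assoc by linarith
    qed
    ultimately have "e * (norm h)\<^sup>2 \<le> (norm x)\<^sup>2" by linarith
    then have "(e * norm h)\<^sup>2 \<le> (sqrt e * norm x)\<^sup>2"
      using e mult_left_mono [of "e * (norm h)\<^sup>2" "(norm x)\<^sup>2" e]
      by (simp add: power_mult_distrib power2_eq_square [of e] mult.assoc)
    then have "e * norm h \<le> sqrt e * norm x" by (rule power2_le_imp_le) (use e in simp)
    then show ?thesis using e by (simp add: h_def)
  qed
  define V where "V = {v. ((\<lambda>e. e *\<^sub>R R e v) \<longlongrightarrow> 0) (at_right 0)}"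
  have "S G \<subseteq> V"
    unfolding S_def
  proof (rule span_minimal)
    show "subspace V"
      unfolding V_def subspace_def
    proof (intro conjI ballI allI; clarsimp simp: blinfun_apply_simps scaleR_add_right)
      fix v w assume "((\<lambda>e. e *\<^sub>R R e v) \<longlongrightarrow> 0) (at_right 0)" "((\<lambda>e. e *\<^sub>R R e w) \<longlongrightarrow> 0) (at_right 0)"
      from tendsto_add [OF this] show "((\<lambda>e. e *\<^sub>R R e v + e *\<^sub>R R e w) \<longlongrightarrow> 0) (at_right 0)" by simp
    next
      fix c v assume "((\<lambda>e. e *\<^sub>R R e v) \<longlongrightarrow> 0) (at_right 0)"
      from tendsto_scaleR [OF tendsto_const [of c] this]
      show "((\<lambda>e. (e * c) *\<^sub>R R e v) \<longlongrightarrow> 0) (at_right 0)" by (simp add: mult.commute)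
    qed
    show "(\<Union>b\<in>G. range (blinfun_apply b)) \<subseteq> V"
    proof clarify
      fix b x assume b: "b \<in> G"
      have "((\<lambda>e. e *\<^sub>R R e (b x)) \<longlongrightarrow> 0) (at_right 0)"
      proof (rule Lim_null_comparison)
        show "\<forall>\<^sub>F e in at_right 0. norm (e *\<^sub>R R e (b x)) \<le> sqrt e * norm x"
          using R_range b by (intro eventually_at_rightI [of 0 1]) auto
        have "((\<lambda>e. sqrt e * norm x) \<longlongrightarrow> sqrt 0 * norm x) (at_right 0)"
          by (intro tendsto_intros)
        then show "((\<lambda>e. sqrt e * norm x) \<longlongrightarrow> 0) (at_right 0)" by simp
      qed
      then show "b x \<in> V" by (simp add: V_def)
    qed
  qed
  then have "\<forall>\<^sub>F e in at_right 0. norm (e *\<^sub>R R e (y x)) < d / 2" if "x \<in> X" for x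
    using tendstoD [of "\<lambda>e. e *\<^sub>R R e (y x)" 0 "at_right 0" "d / 2"] yG [OF that] d by (auto simp: V_def)
  then have "\<forall>\<^sub>F e in at_right 0. \<forall>x\<in>X. norm (e *\<^sub>R R e (y x)) < d / 2"
    using X by (simp add: eventually_ball_finite)
  then have "\<forall>\<^sub>F e in at_right 0. e > 0 \<and> (\<forall>x\<in>X. norm (e *\<^sub>R R e (y x)) < d / 2)"
    by (intro eventually_conj eventually_at_right_less)
  then obtain e where e: "e > 0" "\<And>x. x \<in> X \<Longrightarrow> norm (e *\<^sub>R R e (y x)) < d / 2"
    using eventually_happens' [OF trivial_limit_at_right_real] by blast
  show "\<exists>C\<in>M. \<forall>x\<in>X. norm (C x - P x) < d"
  proof (intro bexI ballI)
    show "\<I> - e *\<^sub>R R e \<in> M" using R(1) [OF e(1)] by simp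
    fix x assume x: "x \<in> X"
    define w where "w = x - P x"
    have "b\<^sup>\<dagger> w = 0" if "b \<in> G" for b
    proof (rule rinner_eqI)
      fix v
      have "b v \<in> K" unfolding K
        using that G(2) by (intro subsetD [OF closure_subset] span_base) blast
      then show "rinner v (b\<^sup>\<dagger> w) = rinner v 0"
        using P(2) GM [OF that] by (simp add: w_def rinner_hadj rinner_commute)
    qed
    then have "a w = 0" by (simp add: a_def blinfun.sum_left)
    then have "e *\<^sub>R R e w = w"
      using arg_cong [OF R(3) [OF e(1)], of "\<lambda>A. blinfun_apply A w"] by (simp add: blinfun_apply_simps)
    then have "(\<I> - e *\<^sub>R R e) x - P x = - (e *\<^sub>R R e (P x))"
      by (simp add: w_def blinfun_apply_simps algebra_simps)
    also have "\<dots> = - (e *\<^sub>R R e (P x - y x) + e *\<^sub>R R e (y x))"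
      by (simp add: blinfun_apply_simps algebra_simps)
    finally have "norm ((\<I> - e *\<^sub>R R e) x - P x) \<le> norm (e *\<^sub>R R e (P x - y x)) + norm (e *\<^sub>R R e (y x))"
      using norm_triangle_ineq by (metis norm_minus_cancel)
    also have "\<dots> < d"
      using R_norm [OF e(1), of "P x - y x"] yF(4) [of x] e(2) [OF x] by linarith
    finally show "norm ((\<I> - e *\<^sub>R R e) x - P x) < d" .
  qed
qed

text \<open>\<open>z\<close> projects onto the closed span of \<open>M q H\<close>. This space is
  invariant under \<open>M\<close>, and since \<open>M\<close> is closed under adjoints so is its
  complement, which makes \<open>z\<close> central. An operator killing \<open>M q H\<close> kills
  its closed span, hence the minimality clause.\<close>

lemma central_support:
  assumes q: "q \<in> M"
  obtains z where "z \<in> M" "z\<^sup>\<dagger> = z" "z \<cdot> z = z" "\<And>m. m \<in> M \<Longrightarrow> z \<cdot> m = m \<cdot> z" "z \<cdot> q = q"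
    "\<And>a. (\<And>m. m \<in> M \<Longrightarrow> a \<cdot> m \<cdot> q = 0) \<Longrightarrow> a \<cdot> z = 0"
proof -
  define B where "B = (\<lambda>m. m \<cdot> q) ` M"
  define K where "K = closure (span (\<Union>b\<in>B. range (blinfun_apply b)))"
  have K: "subspace K" "closed K" by (simp_all add: K_def subspace_span closed_subspace subspace_closure)
  obtain z where z: "\<And>x. blinfun_apply z x \<in> K" "\<And>x k. k \<in> K \<Longrightarrow> rinner (x - z x) k = 0"
    using orthogonal_projection_exists [OF K] by blast
  have B: "B \<subseteq> M" using q by (auto simp: B_def)
  have zM: "z \<in> M" by (rule range_projection_mem [OF B K_def z])
  have K_least: "K \<subseteq> V" if "subspace V" "closed V" "\<And>m x. m \<in> M \<Longrightarrow> m (q x) \<in> V" for V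
    unfolding K_def using that by (intro closure_minimal span_minimal) (auto simp: B_def)
  have K_mem: "m (q x) \<in> K" if "m \<in> M" for m x
  proof -
    have "m (q x) \<in> span (\<Union>b\<in>B. range (blinfun_apply b))"
      using that by (intro span_base) (auto simp: B_def intro!: exI [of _ x] bexI [of _ m])
    then show ?thesis using closure_subset by (auto simp: K_def)
  qed
  have z_id: "z k = k" if "k \<in> K" for k
  proof -
    have "k - z k \<in> K" using that z(1) K(1) by (simp add: subspace_diff)
    then have "rinner (k - z k) (k - z k) = 0" by (rule z(2))
    then show ?thesis by (simp add: rinner_self)
  qed
  have za: "z\<^sup>\<dagger> = z"
  proof (rule hadj_eqI_rinner [OF zM])
    fix x y
    show "rinner x (z y) = rinner (z x) y"
      using z(2) [OF z(1), of x y] z(2) [OF z(1), of y x] by (simp add: rinner_simps rinner_commute)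
  qed
  have invariant: "z \<cdot> (m \<cdot> z) = m \<cdot> z" if m: "m \<in> M" for m
  proof -
    have "K \<subseteq> blinfun_apply m -` K"
    proof (rule K_least)
      show "subspace (blinfun_apply m -` K)"
        using K(1) by (auto simp: subspace_def blinfun_apply_simps)
      show "closed (blinfun_apply m -` K)"
        by (intro closed_vimage K(2) linear_continuous_on blinfun.bounded_linear_right)
      show "m' (q x) \<in> blinfun_apply m -` K" if "m' \<in> M" for m' x
        using K_mem [of "m \<cdot> m'"] m that by simp
    qed
    then have "m (z x) \<in> K" for x using z(1) by blast
    then show ?thesis by (intro blinfun_eqI) (simp add: z_id)
  qed
  show thesis
  proof (rule that [OF zM za])
    show "z \<cdot> z = z" "z \<cdot> q = q"
      using z(1) K_mem [OF id_mem] by (auto intro!: blinfun_eqI simp: z_id)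
    show "z \<cdot> m = m \<cdot> z" if m: "m \<in> M" for m
    proof -
      have "z \<cdot> (m\<^sup>\<dagger> \<cdot> z) = m\<^sup>\<dagger> \<cdot> z" using invariant m by simp
      from arg_cong [OF this, of hadj] have "z \<cdot> (m \<cdot> z) = z \<cdot> m"
        using m zM by (simp add: za blinfun_compose_assoc)
      then show ?thesis using invariant [OF m] by simp
    qed
    show "a \<cdot> z = 0" if a: "\<And>m. m \<in> M \<Longrightarrow> a \<cdot> m \<cdot> q = 0" for a
    proof -
      have "K \<subseteq> blinfun_apply a -` {0}"
      proof (rule K_least)
        show "subspace (blinfun_apply a -` {0})" by (auto simp: subspace_def blinfun_apply_simps)
        show "closed (blinfun_apply a -` {0})"
          by (intro closed_vimage linear_continuous_on blinfun.bounded_linear_right) simp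
        show "m (q x) \<in> blinfun_apply a -` {0}" if "m \<in> M" for m x
          using arg_cong [OF a [OF that], of "\<lambda>A. blinfun_apply A x"] by simp
      qed
      then show ?thesis using z(1) by (intro blinfun_eqI) auto
    qed
  qed
qed

end

subsection \<open>Similar isometries\<close>

lemma blinfun_compose_applyD: "A \<cdot> B = C \<Longrightarrow> A (B \<xi>) = C \<xi>"
  by (metis blinfun_apply_blinfun_compose)

section \<open>Wold decomposition: powers of an isometry and their range projections\<close>

primrec op_power :: "('a::real_normed_vector \<Rightarrow>\<^sub>L 'a) \<Rightarrow> nat \<Rightarrow> 'a \<Rightarrow>\<^sub>L 'a" where
  "op_power x 0 = \<I>"
| "op_power x (Suc n) = x \<cdot> op_power x n"

lemma op_power_add: "op_power x (m + n) = op_power x m \<cdot> op_power x n"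
  by (induction m) (simp_all add: blinfun_compose_assoc)

lemma op_power_intertwine: "y \<cdot> t = t \<cdot> x \<Longrightarrow> op_power y n \<cdot> t = t \<cdot> op_power x n"
proof (induction n)
  case (Suc n)
  then show ?case by (metis blinfun_compose_assoc op_power.simps(2))
qed simp

context vna
begin

lemma eq_zero_if_hadj_compose: "A \<in> M \<Longrightarrow> A\<^sup>\<dagger> \<cdot> A = 0 \<Longrightarrow> A = 0"
  using norm_sq_rinner [of A] blinfun_compose_applyD [of "A\<^sup>\<dagger>" A 0]
  by (intro blinfun_eqI) simp

lemma norm_sq_rinner_eq: "A \<in> M \<Longrightarrow> A\<^sup>\<dagger> \<cdot> A = B \<Longrightarrow> (norm (A x))\<^sup>2 = rinner (B x) x"
  using norm_sq_rinner [of A x] blinfun_compose_applyD [of "A\<^sup>\<dagger>" A B x] by simp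

lemma op_power_mem [simp]: "x \<in> M \<Longrightarrow> op_power x n \<in> M"
  by (induction n) auto

text \<open>For an isometry \<open>x\<close>, the projection onto the range of the
  \<open>n\<close>-th power.\<close>

definition range_power :: "('h \<Rightarrow>\<^sub>L 'h) \<Rightarrow> nat \<Rightarrow> 'h \<Rightarrow>\<^sub>L 'h"
  where "range_power x n = op_power x n \<cdot> (op_power x n)\<^sup>\<dagger>"

lemma range_power_mem [simp]: "x \<in> M \<Longrightarrow> range_power x n \<in> M"
  by (simp add: range_power_def)

lemma range_power_0 [simp]: "range_power x 0 = \<I>"
  by (simp add: range_power_def)

lemma range_power_Suc: "x \<in> M \<Longrightarrow> range_power x (Suc n) = x \<cdot> range_power x n \<cdot> x\<^sup>\<dagger>"
  by (simp add: range_power_def blinfun_compose_assoc)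

lemma hadj_range_power [simp]: "x \<in> M \<Longrightarrow> (range_power x n)\<^sup>\<dagger> = range_power x n"
  by (simp add: range_power_def)

lemma op_power_isometry:
  assumes "x \<in> M" "x\<^sup>\<dagger> \<cdot> x = \<I>"
  shows "(op_power x n)\<^sup>\<dagger> \<cdot> op_power x n = \<I>"
  using assms by (induction n) (simp_all add: blinfun_compose_assoc blinfun_compose_cong [OF assms(2)])

lemma range_power_compose:
  assumes "x \<in> M" "x\<^sup>\<dagger> \<cdot> x = \<I>" "m \<le> n"
  shows "range_power x m \<cdot> range_power x n = range_power x n"
proof -
  obtain k where n: "n = m + k" using assms(3) le_Suc_ex by blast
  show ?thesis
    using assms(1) by (simp add: range_power_def n op_power_add blinfun_compose_assoc
        blinfun_compose_cong [OF op_power_isometry [OF assms(1,2), of m]])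
qed

text \<open>\<open>e\<close> is the projection onto the intersection of the ranges of all powers,
  the largest subspace on which the isometry \<open>x\<close> acts as a unitary; it is captured as
  the strong limit of the decreasing range projections.\<close>

definition unitary_part :: "('h \<Rightarrow>\<^sub>L 'h) \<Rightarrow> ('h \<Rightarrow>\<^sub>L 'h) \<Rightarrow> bool"
  where "unitary_part x e \<longleftrightarrow> e \<in> M \<and> (\<forall>\<xi>. (\<lambda>n. range_power x n \<xi>) \<longlonglongrightarrow> e \<xi>)"

text \<open>The range projections decrease; the minus sign makes the sequence increase, as
  \<open>Cauchy_if_norm_sq_le\<close> expects.\<close>

lemma range_power_quadratic:
  assumes "x \<in> M" "x\<^sup>\<dagger> \<cdot> x = \<I>"
  shows "convergent (\<lambda>n. - rinner (range_power x n \<xi>) \<xi>)" (is ?conv)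
    and "m \<le> n \<Longrightarrow> positive_op (range_power x m - range_power x n)"
proof -
  show pos: "positive_op (range_power x m - range_power x n)" if "m \<le> n" for m n
  proof -
    define T where "T = range_power x m - range_power x n"
    have T: "T \<in> M" using assms by (simp add: T_def)
    have "range_power x n \<cdot> range_power x m = range_power x n"
      using arg_cong [OF range_power_compose [OF assms that], of hadj] assms(1) by simp
    then have "T\<^sup>\<dagger> \<cdot> T = T"
      using assms range_power_compose [OF assms that] range_power_compose [OF assms order_refl]
      by (simp add: T_def blinfun_compose_bilinear)
    then show ?thesis
      using positive_op_hadj_compose [OF T] by (simp add: T_def)
  qed
  show ?conv
  proof (rule Bseq_mono_convergent)
    have "0 \<le> rinner (range_power x n \<xi>) \<xi>" for n
      using assms by (simp add: range_power_def rinner_hadj [symmetric] rinner_self rinner_commute [of _ \<xi>])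
        (simp add: rinner_hadj' [symmetric] rinner_self)
    moreover have "rinner (range_power x n \<xi>) \<xi> \<le> rinner \<xi> \<xi>" for n
      using rinner_le_if_positive [OF pos [of 0 n]] by simp
    ultimately show "Bseq (\<lambda>n. - rinner (range_power x n \<xi>) \<xi>)"
      by (intro BseqI' [of _ "rinner \<xi> \<xi>"]) simp
  qed (use rinner_le_if_positive [OF pos] in auto)
qed

text \<open>A difference of nested projections is a projection, so the squared norm of its value at
  \<open>\<xi>\<close> equals a difference of quadratic forms.\<close>

lemma unitary_part_exists:
  assumes x: "x \<in> M" "x\<^sup>\<dagger> \<cdot> x = \<I>"
  obtains e where "unitary_part x e"
proof -
  have "Cauchy (\<lambda>n. range_power x n \<xi>)" for \<xi>
  proof (rule Cauchy_if_norm_sq_le [OF range_power_quadratic(1) [OF x]])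
    fix m n :: nat assume mn: "m \<le> n"
    have "range_power x n \<cdot> range_power x m = range_power x n"
      using arg_cong [OF range_power_compose [OF x mn], of hadj] x by simp
    then have "(range_power x n - range_power x m)\<^sup>\<dagger> \<cdot> (range_power x n - range_power x m)
        = range_power x m - range_power x n"
      using x range_power_compose [OF x mn] range_power_compose [OF x order_refl]
      by (simp add: blinfun_compose_bilinear)
    from norm_sq_rinner_eq [OF _ this, of \<xi>]
    show "(norm (range_power x n \<xi> - range_power x m \<xi>))\<^sup>2
        \<le> - rinner (range_power x n \<xi>) \<xi> - - rinner (range_power x m \<xi>) \<xi>"
      using x by (simp add: blinfun_apply_simps rinner_simps)
  qed
  moreover have "norm (range_power x n) \<le> 1" for n
  proof -
    have "norm (op_power x n) \<le> 1"
      using norm_le_1_iff_positive [of "op_power x n"] op_power_isometry [OF x] x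
      by (simp add: positive_op_def)
    then show ?thesis
      using norm_blinfun_compose [of "op_power x n" "(op_power x n)\<^sup>\<dagger>"] x
      by (simp add: range_power_def mult_le_one order_trans)
  qed
  ultimately obtain e where "e \<in> M" "\<And>\<xi>. (\<lambda>n. range_power x n \<xi>) \<longlonglongrightarrow> e \<xi>"
    using strong_limit [of "range_power x" 1] x by (metis range_power_mem)
  then show thesis using that [of e] by (simp add: unitary_part_def)
qed

lemma unitary_part_apply_eqI:
  assumes "unitary_part x e" "\<And>n. range_power x n \<xi> = \<xi>"
  shows "e \<xi> = \<xi>"
proof -
  have "(\<lambda>n. range_power x n \<xi>) \<longlonglongrightarrow> e \<xi>" using assms(1) by (simp add: unitary_part_def)
  then show ?thesis by (simp add: assms(2) LIMSEQ_const_iff)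
qed

lemma unitary_part_properties:
  assumes x: "x \<in> M" "x\<^sup>\<dagger> \<cdot> x = \<I>" and e: "unitary_part x e"
  shows "e \<in> M" "e\<^sup>\<dagger> = e" "range_power x n \<cdot> e = e" "e \<cdot> e = e" "x \<cdot> e = e \<cdot> x" "x \<cdot> x\<^sup>\<dagger> \<cdot> e = e"
proof -
  have lim: "(\<lambda>n. range_power x n \<xi>) \<longlonglongrightarrow> e \<xi>" for \<xi> using e by (simp add: unitary_part_def)
  show mem: "e \<in> M" using e by (simp add: unitary_part_def)
  show "e\<^sup>\<dagger> = e"
  proof (rule hadj_eqI_rinner [OF mem], rule LIMSEQ_unique)
    fix \<xi> \<eta>
    show "(\<lambda>n. rinner \<xi> (range_power x n \<eta>)) \<longlonglongrightarrow> rinner \<xi> (e \<eta>)"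
      by (intro tendsto_rinner tendsto_const lim)
    have "rinner \<xi> (range_power x n \<eta>) = rinner (range_power x n \<xi>) \<eta>" for n
      using rinner_hadj [of "range_power x n" \<xi> \<eta>] x by simp
    then show "(\<lambda>n. rinner \<xi> (range_power x n \<eta>)) \<longlonglongrightarrow> rinner (e \<xi>) \<eta>"
      by (simp add: tendsto_rinner lim)
  qed
  have range_e: "range_power x n (e \<xi>) = e \<xi>" for n \<xi>
  proof (rule LIMSEQ_unique)
    show "(\<lambda>k. range_power x n (range_power x k \<xi>)) \<longlonglongrightarrow> range_power x n (e \<xi>)"
      by (intro bounded_linear.tendsto [OF blinfun.bounded_linear_right] lim)
    have "\<forall>\<^sub>F k in sequentially. range_power x n (range_power x k \<xi>) = range_power x k \<xi>"
      using blinfun_compose_applyD [OF range_power_compose [OF x]] eventually_sequentially by blast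
    then show "(\<lambda>k. range_power x n (range_power x k \<xi>)) \<longlonglongrightarrow> e \<xi>"
      using lim [of \<xi>] tendsto_cong by force
  qed
  then show range_e': "range_power x n \<cdot> e = e" for n by (intro blinfun_eqI) simp
  show "e \<cdot> e = e"
    using unitary_part_apply_eqI [OF e range_e] by (intro blinfun_eqI) simp
  show "x \<cdot> e = e \<cdot> x"
  proof (rule blinfun_eqI, rule LIMSEQ_unique)
    fix \<xi>
    show "(\<lambda>n. range_power x (Suc n) (x \<xi>)) \<longlonglongrightarrow> (e \<cdot> x) \<xi>"
      using LIMSEQ_Suc [OF lim] by simp
    have "range_power x (Suc n) (x \<xi>) = x (range_power x n \<xi>)" for n
      using x blinfun_compose_applyD [OF x(2)] by (simp add: range_power_Suc)
    then show "(\<lambda>n. range_power x (Suc n) (x \<xi>)) \<longlonglongrightarrow> (x \<cdot> e) \<xi>"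
      by (simp add: bounded_linear.tendsto [OF blinfun.bounded_linear_right lim])
  qed
  show "x \<cdot> x\<^sup>\<dagger> \<cdot> e = e"
    using range_e' [of 1] x by (simp add: range_power_Suc)
qed

text \<open>Intertwining passes to powers, so \<open>t\<close> carries the range of each power of
  \<open>x\<close> into that of the same power of \<open>y\<close>, and hence the intersection into
  the intersection.\<close>

lemma unitary_part_intertwine:
  assumes x: "x \<in> M" "x\<^sup>\<dagger> \<cdot> x = \<I>" and e: "unitary_part x e"
    and y: "y \<in> M" "y\<^sup>\<dagger> \<cdot> y = \<I>" and e': "unitary_part y e'" and t: "y \<cdot> t = t \<cdot> x"
  shows "e' \<cdot> (t \<cdot> e) = t \<cdot> e"
proof (rule blinfun_eqI)
  fix \<xi>
  have "range_power y n (t (e \<xi>)) = t (e \<xi>)" for n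
  proof -
    define \<eta> where "\<eta> = (op_power x n)\<^sup>\<dagger> (e \<xi>)"
    have "t (e \<xi>) = t (op_power x n \<eta>)"
      using blinfun_compose_applyD [OF unitary_part_properties(3) [OF x e], of n \<xi>]
      by (simp add: \<eta>_def range_power_def)
    also have "\<dots> = op_power y n (t \<eta>)"
      using blinfun_compose_applyD [OF op_power_intertwine [OF t]] by simp
    finally show ?thesis
      using blinfun_compose_applyD [OF op_power_isometry [OF y]] by (simp add: range_power_def)
  qed
  then show "(e' \<cdot> (t \<cdot> e)) \<xi> = (t \<cdot> e) \<xi>"
    using unitary_part_apply_eqI [OF e'] by simp
qed

text \<open>The polar decomposition of \<open>t\<close> restricted to the range of \<open>e\<close>.\<close>

lemma projections_equivalent:
  assumes e: "e \<in> M" "e\<^sup>\<dagger> = e" "e \<cdot> e = e" and e': "e' \<in> M" "e'\<^sup>\<dagger> = e'" "e' \<cdot> e' = e'"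
    and t: "t \<in> M" "s \<in> M" "s \<cdot> t = \<I>" "t \<cdot> s = \<I>"
    and te: "e' \<cdot> (t \<cdot> e) = t \<cdot> e" and se: "e \<cdot> (s \<cdot> e') = s \<cdot> e'"
  obtains g where "g \<in> M" "(t \<cdot> g \<cdot> e)\<^sup>\<dagger> \<cdot> (t \<cdot> g \<cdot> e) = e" "(t \<cdot> g \<cdot> e) \<cdot> (t \<cdot> g \<cdot> e)\<^sup>\<dagger> = e'"
    "\<And>c. c \<cdot> (e \<cdot> (t\<^sup>\<dagger> \<cdot> (t \<cdot> e))) = e \<cdot> (t\<^sup>\<dagger> \<cdot> (t \<cdot> e)) \<cdot> c \<Longrightarrow> c \<cdot> e = e \<cdot> c \<Longrightarrow> c \<cdot> g = g \<cdot> c"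
proof -
  \<comment> \<open>Adding \<open>\<I> - e\<close> makes the operator coercive on the whole space,
    so that an inverse square root \<open>g\<close> exists in \<open>M\<close>; on the range of
    \<open>e\<close> it is the compression of \<open>t\<^sup>\<dagger> t\<close>.\<close>
  define a where "a = e \<cdot> (t\<^sup>\<dagger> \<cdot> (t \<cdot> e)) + (\<I> - e)"
  have a: "a \<in> M" "a\<^sup>\<dagger> = a"
    using e t by (simp_all add: a_def blinfun_compose_assoc)
  have ee: "e (e \<xi>) = e \<xi>" for \<xi> using blinfun_compose_applyD [OF e(3)] .
  have "coercive a"
    unfolding coercive_def
  proof (intro exI conjI allI)
    \<comment> \<open>The summand \<open>(norm s)^2\<close> bounds \<open>e \<xi>\<close> by
      \<open>t (e \<xi>)\<close>; the \<open>1\<close> covers the component in the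
      complement.\<close>
    define N where "N = (norm s)\<^sup>2 + 1"
    have N: "N > 0" by (simp add: N_def add_nonneg_pos)
    then show "1 / N > 0" by simp
    fix \<xi>
    have split: "(norm \<xi>)\<^sup>2 = (norm (e \<xi>))\<^sup>2 + (norm (\<xi> - e \<xi>))\<^sup>2"
    proof -
      have "rinner (e \<xi>) (\<xi> - e \<xi>) = 0"
        using rinner_hadj [OF e(1), of \<xi> "\<xi> - e \<xi>"] by (simp add: e(2) blinfun_apply_simps ee)
      then show ?thesis using norm_add_sq [of "e \<xi>" "\<xi> - e \<xi>"] by simp
    qed
    have "e \<xi> = s (t (e \<xi>))" using blinfun_compose_applyD [OF t(3)] by simp
    then have "norm (e \<xi>) \<le> norm s * norm (t (e \<xi>))" by (metis norm_blinfun)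
    then have "(norm (e \<xi>))\<^sup>2 \<le> (norm s)\<^sup>2 * (norm (t (e \<xi>)))\<^sup>2"
      unfolding power_mult_distrib [symmetric] by (simp add: power_mono)
    also have "\<dots> \<le> N * (norm (t (e \<xi>)))\<^sup>2" by (simp add: N_def mult_right_mono)
    finally have 1: "(norm (e \<xi>))\<^sup>2 \<le> N * (norm (t (e \<xi>)))\<^sup>2" .
    have 2: "(norm (\<xi> - e \<xi>))\<^sup>2 \<le> N * (norm (\<xi> - e \<xi>))\<^sup>2"
      using mult_right_mono [of 1 N "(norm (\<xi> - e \<xi>))\<^sup>2"] by (simp add: N_def)
    have "rinner (e (t\<^sup>\<dagger> (t (e \<xi>)))) \<xi> = (norm (t (e \<xi>)))\<^sup>2"
      using rinner_hadj' [OF e(1), of "t\<^sup>\<dagger> (t (e \<xi>))" \<xi>] rinner_hadj' [OF t(1), of "t (e \<xi>)" "e \<xi>"]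
      by (simp add: e(2) rinner_self)
    moreover have "rinner (\<xi> - e \<xi>) \<xi> = (norm (\<xi> - e \<xi>))\<^sup>2"
      using rinner_hadj' [OF e(1), of "\<xi> - e \<xi>" \<xi>] ee
      by (simp add: e(2) blinfun_apply_simps rinner_simps rinner_commute flip: rinner_self)
    ultimately have "rinner (a \<xi>) \<xi> = (norm (t (e \<xi>)))\<^sup>2 + (norm (\<xi> - e \<xi>))\<^sup>2"
      by (simp add: a_def blinfun_apply_simps rinner_add)
    then have "(norm \<xi>)\<^sup>2 \<le> N * rinner (a \<xi>) \<xi>"
      using 1 2 split by (simp add: algebra_simps)
    then show "1 / N * (norm \<xi>)\<^sup>2 \<le> rinner (a \<xi>) \<xi>"
      using N by (simp add: field_simps)
  qed
  then obtain h where h: "h \<in> sa_bicommutant a" "h \<cdot> h = a" "coercive h"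
    using coercive_sqrt [OF a] by blast
  note hM = sa_bicommutantD(1,2) [OF h(1)]
  obtain g where g: "g \<in> M" "h \<cdot> g = \<I>" "g \<cdot> h = \<I>" using coercive_inverse [OF hM(1) h(3)] .
  have g_comm: "c \<cdot> g = g \<cdot> c" if "c \<cdot> a = a \<cdot> c" for c
    using inverse_commutes [OF g(2,3) sa_bicommutantD(3) [OF h(1) that]] .
  have "e \<cdot> a = a \<cdot> e"
    using e(3) by (intro blinfun_eqI) (simp add: a_def blinfun_apply_simps ee)
  then have eg: "e \<cdot> g = g \<cdot> e" by (rule g_comm)
  have ga: "g\<^sup>\<dagger> = g"
  proof -
    have "g\<^sup>\<dagger> \<cdot> h = \<I>" using arg_cong [OF g(2), of hadj] g(1) hM by simp
    then show ?thesis using g(2) by (metis blinfun_compose_assoc blinfun_compose_id)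
  qed
  define w where "w = t \<cdot> g \<cdot> e"
  have w: "w \<in> M" using t g e by (simp add: w_def)
  have w_alt: "w = t \<cdot> e \<cdot> g" by (simp add: w_def blinfun_compose_assoc eg)
  have ww: "w\<^sup>\<dagger> \<cdot> w = e"
  proof -
    have "w\<^sup>\<dagger> \<cdot> w = g \<cdot> (e \<cdot> (t\<^sup>\<dagger> \<cdot> (t \<cdot> e))) \<cdot> g"
      using t g e by (simp add: w_alt ga blinfun_compose_assoc)
    also have "e \<cdot> (t\<^sup>\<dagger> \<cdot> (t \<cdot> e)) = a \<cdot> e"
      by (intro blinfun_eqI) (simp add: a_def blinfun_apply_simps ee)
    also have "a \<cdot> e = h \<cdot> (h \<cdot> e)" by (simp add: blinfun_compose_assoc flip: h(2))
    also have "g \<cdot> (h \<cdot> (h \<cdot> e)) \<cdot> g = h \<cdot> (e \<cdot> g)"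
      by (simp add: blinfun_compose_assoc blinfun_compose_cong [OF g(3)])
    finally show ?thesis by (simp add: eg blinfun_compose_cong [OF g(2)])
  qed
  \<comment> \<open>\<open>te\<close> puts the range of \<open>w\<close> inside that of
    \<open>e'\<close>. For the converse \<open>se\<close> yields \<open>e' = w r\<close> for some
    \<open>r\<close>, and then
    \<open>w w\<^sup>\<dagger> e' = w (w\<^sup>\<dagger> w) r = e'\<close>.\<close>
  have ww': "w \<cdot> w\<^sup>\<dagger> = e'"
  proof -
    have we: "w \<cdot> e = w" by (simp add: w_def blinfun_compose_assoc e)
    have e'w: "e' \<cdot> w = w" using te by (simp add: w_alt flip: blinfun_compose_assoc)
    have "e' = t \<cdot> (s \<cdot> e')" by (simp add: blinfun_compose_cong [OF t(4)])
    also have "\<dots> = t \<cdot> (e \<cdot> (s \<cdot> e'))" using se by simp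
    also have "\<dots> = w \<cdot> (h \<cdot> (s \<cdot> e'))"
      by (simp add: w_alt blinfun_compose_assoc blinfun_compose_cong [OF g(3)])
    finally obtain r where r: "e' = w \<cdot> r" by blast
    have "w \<cdot> (w\<^sup>\<dagger> \<cdot> e') = w \<cdot> (w\<^sup>\<dagger> \<cdot> w) \<cdot> r" unfolding r by (simp add: blinfun_compose_assoc)
    then have "w \<cdot> (w\<^sup>\<dagger> \<cdot> e') = e'" by (simp add: ww we r)
    moreover have "w\<^sup>\<dagger> \<cdot> e' = w\<^sup>\<dagger>" using arg_cong [OF e'w, of hadj] w e' by simp
    ultimately show ?thesis by simp
  qed
  show thesis
  proof (rule that [OF g(1)])
    show "(t \<cdot> g \<cdot> e)\<^sup>\<dagger> \<cdot> (t \<cdot> g \<cdot> e) = e" "(t \<cdot> g \<cdot> e) \<cdot> (t \<cdot> g \<cdot> e)\<^sup>\<dagger> = e'"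
      using ww ww' by (simp_all only: w_def)
    show "c \<cdot> g = g \<cdot> c"
      if "c \<cdot> (e \<cdot> (t\<^sup>\<dagger> \<cdot> (t \<cdot> e))) = e \<cdot> (t\<^sup>\<dagger> \<cdot> (t \<cdot> e)) \<cdot> c" "c \<cdot> e = e \<cdot> c" for c
      using that by (intro g_comm) (simp add: a_def blinfun_compose_bilinear)
  qed
qed

text \<open>The partial sums of \<open>\<Sum>k. y\<^sup>k v x\<^sup>*\<^sup>k\<close>.\<close>

primrec shift_sum :: "('h \<Rightarrow>\<^sub>L 'h) \<Rightarrow> ('h \<Rightarrow>\<^sub>L 'h) \<Rightarrow> ('h \<Rightarrow>\<^sub>L 'h) \<Rightarrow> nat \<Rightarrow> 'h \<Rightarrow>\<^sub>L 'h" where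
  "shift_sum x y v 0 = 0"
| "shift_sum x y v (Suc n) = v + y \<cdot> (shift_sum x y v n \<cdot> x\<^sup>\<dagger>)"

lemma shift_sum_mem [simp]: "x \<in> M \<Longrightarrow> y \<in> M \<Longrightarrow> v \<in> M \<Longrightarrow> shift_sum x y v n \<in> M"
  by (induction n) auto

lemma hadj_shift_sum:
  "x \<in> M \<Longrightarrow> y \<in> M \<Longrightarrow> v \<in> M \<Longrightarrow> (shift_sum x y v n)\<^sup>\<dagger> = shift_sum y x (v\<^sup>\<dagger>) n"
  by (induction n) (simp_all add: blinfun_compose_assoc)

text \<open>\<open>v\<close> maps the kernel of \<open>x\<^sup>\<dagger>\<close> isometrically onto
  that of \<open>y\<^sup>\<dagger>\<close>, so the \<open>k\<close>-th term carries the
  \<open>k\<close>-th wandering subspace of \<open>x\<close> onto that of \<open>y\<close>. These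
  subspaces are mutually orthogonal, so partial sums are partial isometries with initial projection
  \<open>\<I> - range_power x n\<close>.\<close>

lemma shift_part:
  assumes x: "x \<in> M" "x\<^sup>\<dagger> \<cdot> x = \<I>" and y: "y \<in> M" "y\<^sup>\<dagger> \<cdot> y = \<I>"
    and v: "v \<in> M" "v\<^sup>\<dagger> \<cdot> v = \<I> - x \<cdot> x\<^sup>\<dagger>" "v \<cdot> v\<^sup>\<dagger> = \<I> - y \<cdot> y\<^sup>\<dagger>"
    and e: "unitary_part x e"
  obtains d where "d \<in> M" "\<And>\<xi>. (\<lambda>n. shift_sum x y v n \<xi>) \<longlonglongrightarrow> d \<xi>" "d\<^sup>\<dagger> \<cdot> d = \<I> - e" "d \<cdot> x = y \<cdot> d"
proof -
  define D where "D = shift_sum x y v"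
  have D: "D n \<in> M" for n using x y v by (simp add: D_def)
  have D_Suc: "D (Suc n) = v + y \<cdot> (D n \<cdot> x\<^sup>\<dagger>)" for n by (simp add: D_def)
  have vx: "v \<cdot> x = 0"
  proof (rule eq_zero_if_hadj_compose)
    have "x\<^sup>\<dagger> \<cdot> (v\<^sup>\<dagger> \<cdot> v) \<cdot> x = 0"
      by (simp add: v(2) x(2) blinfun_compose_bilinear blinfun_compose_assoc blinfun_compose_cong [OF x(2)])
    then show "(v \<cdot> x)\<^sup>\<dagger> \<cdot> (v \<cdot> x) = 0" using x(1) v(1) by (simp add: blinfun_compose_assoc)
  qed (use x v in simp)
  have vy: "v\<^sup>\<dagger> \<cdot> y = 0"
  proof (rule eq_zero_if_hadj_compose)
    have "y\<^sup>\<dagger> \<cdot> (v \<cdot> v\<^sup>\<dagger>) \<cdot> y = 0"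
      by (simp add: v(3) y(2) blinfun_compose_bilinear blinfun_compose_assoc blinfun_compose_cong [OF y(2)])
    then show "(v\<^sup>\<dagger> \<cdot> y)\<^sup>\<dagger> \<cdot> (v\<^sup>\<dagger> \<cdot> y) = 0" using y(1) v(1) by (simp add: blinfun_compose_assoc)
  qed (use y v in simp)
  have yv: "y\<^sup>\<dagger> \<cdot> v = 0" using arg_cong [OF vy, of hadj] y v by simp
  have DD: "(D m)\<^sup>\<dagger> \<cdot> D n = \<I> - range_power x m" if "m \<le> n" for m n
    using that
  proof (induction m arbitrary: n)
    case (Suc m)
    then obtain k where k: "n = Suc k" "m \<le> k" using Suc_le_D by blast
    have "(D (Suc m))\<^sup>\<dagger> \<cdot> D n = v\<^sup>\<dagger> \<cdot> v + x \<cdot> ((D m)\<^sup>\<dagger> \<cdot> D k) \<cdot> x\<^sup>\<dagger>"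
      using x(1) y(1) v(1) D [of m] D [of k]
      by (simp add: k D_Suc blinfun_compose_bilinear blinfun_compose_assoc
          blinfun_compose_cong [OF y(2)] blinfun_compose_cong [OF vy] yv)
    also have "\<dots> = \<I> - range_power x (Suc m)"
      using x by (simp add: Suc.IH [OF k(2)] v(2) range_power_Suc blinfun_compose_bilinear blinfun_compose_assoc)
    finally show ?case .
  qed (simp add: D_def)
  have "Cauchy (\<lambda>n. D n \<xi>)" for \<xi>
  proof (rule Cauchy_if_norm_sq_le [OF range_power_quadratic(1) [OF x]])
    fix m n :: nat assume mn: "m \<le> n"
    have "(D n)\<^sup>\<dagger> \<cdot> D m = \<I> - range_power x m"
      using arg_cong [OF DD [OF mn], of hadj] D [of n] D [of m] x by simp
    then have "(D n - D m)\<^sup>\<dagger> \<cdot> (D n - D m) = range_power x m - range_power x n"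
      using D [of n] D [of m] DD [OF mn] DD [OF order_refl] by (simp add: blinfun_compose_bilinear)
    from norm_sq_rinner_eq [OF _ this, of \<xi>]
    show "(norm (D n \<xi> - D m \<xi>))\<^sup>2 \<le> - rinner (range_power x n \<xi>) \<xi> - - rinner (range_power x m \<xi>) \<xi>"
      using D [of n] D [of m] by (simp add: blinfun_apply_simps rinner_simps)
  qed
  moreover have "norm (D n) \<le> 1" for n
  proof -
    have "positive_op (range_power x n)"
      using positive_op_hadj_compose [of "range_power x n"] range_power_compose [OF x order_refl] x by simp
    then show ?thesis
      using norm_le_1_iff_positive [OF D] by (simp add: DD)
  qed
  ultimately obtain d where d: "d \<in> M" "\<And>\<xi>. (\<lambda>n. D n \<xi>) \<longlonglongrightarrow> d \<xi>"
    using strong_limit [of D 1] D by metis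
  show thesis
  proof (rule that)
    show "d \<in> M" "\<And>\<xi>. (\<lambda>n. shift_sum x y v n \<xi>) \<longlonglongrightarrow> d \<xi>" using d by (simp_all add: D_def)
    show "d\<^sup>\<dagger> \<cdot> d = \<I> - e"
    proof (rule blinfun_eqI_rinner, rule LIMSEQ_unique)
      fix \<xi> \<eta>
      show "(\<lambda>n. rinner (D n \<eta>) (D n \<xi>)) \<longlonglongrightarrow> rinner \<eta> ((d\<^sup>\<dagger> \<cdot> d) \<xi>)"
        using tendsto_rinner [OF d(2) d(2)] d(1) by (simp add: rinner_hadj)
      have "rinner (D n \<eta>) (D n \<xi>) = rinner \<eta> (\<xi> - range_power x n \<xi>)" for n
        using blinfun_compose_applyD [OF DD [OF order_refl, of n], of \<xi>] D [of n]
        by (simp add: blinfun_apply_simps flip: rinner_hadj)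
      then show "(\<lambda>n. rinner (D n \<eta>) (D n \<xi>)) \<longlonglongrightarrow> rinner \<eta> ((\<I> - e) \<xi>)"
        using e by (simp add: unitary_part_def blinfun_apply_simps tendsto_rinner tendsto_diff)
    qed
    show "d \<cdot> x = y \<cdot> d"
    proof (rule blinfun_eqI, rule LIMSEQ_unique)
      fix \<xi>
      show "(\<lambda>n. D (Suc n) (x \<xi>)) \<longlonglongrightarrow> (d \<cdot> x) \<xi>"
        using LIMSEQ_Suc [OF d(2)] by simp
      have "D (Suc n) (x \<xi>) = y (D n \<xi>)" for n
        using blinfun_compose_applyD [OF vx, of \<xi>] blinfun_compose_applyD [OF x(2), of \<xi>]
        by (simp add: D_Suc blinfun_apply_simps)
      then show "(\<lambda>n. D (Suc n) (x \<xi>)) \<longlonglongrightarrow> (y \<cdot> d) \<xi>"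
        by (simp add: bounded_linear.tendsto [OF blinfun.bounded_linear_right d(2)])
    qed
  qed
qed

text \<open>By the Wold decomposition, an isometry \<open>x\<close> is a unitary on \<open>\<Inter>n. x\<^sup>n H\<close> and a shift on the
  orthogonal complement.  Since \<open>t\<close> intertwines the unitary parts and \<open>t\<^sup>-\<^sup>1\<^sup>*\<close> maps \<open>ker x\<^sup>*\<close> onto
  \<open>ker y\<^sup>*\<close>, both parts of two similar isometries are unitarily equivalent.\<close>

lemma similar_isometries_unitarily_equivalent:
  assumes x: "x \<in> M" "x\<^sup>\<dagger> \<cdot> x = \<I>" and y: "y \<in> M" "y\<^sup>\<dagger> \<cdot> y = \<I>"
    and t: "t \<in> M" "s \<in> M" "s \<cdot> t = \<I>" "t \<cdot> s = \<I>" and tx: "y \<cdot> t = t \<cdot> x"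
  obtains u where "u \<in> M" "u\<^sup>\<dagger> \<cdot> u = \<I>" "u \<cdot> u\<^sup>\<dagger> = \<I>" "y \<cdot> u = u \<cdot> x"
proof -
  have sy: "x \<cdot> s = s \<cdot> y"
  proof -
    have "s \<cdot> (y \<cdot> t) \<cdot> s = s \<cdot> (t \<cdot> x) \<cdot> s" using tx by simp
    then show ?thesis
      by (simp add: t(4) blinfun_compose_cong [OF t(3)] blinfun_compose_assoc)
  qed
  obtain e where e: "unitary_part x e" using unitary_part_exists [OF x] .
  obtain e' where e': "unitary_part y e'" using unitary_part_exists [OF y] .
  note ep = unitary_part_properties [OF x e] and ep' = unitary_part_properties [OF y e']
  obtain g where g: "g \<in> M" and w: "(t \<cdot> g \<cdot> e)\<^sup>\<dagger> \<cdot> (t \<cdot> g \<cdot> e) = e" "(t \<cdot> g \<cdot> e) \<cdot> (t \<cdot> g \<cdot> e)\<^sup>\<dagger> = e'"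
    and g_comm: "\<And>c. c \<cdot> (e \<cdot> (t\<^sup>\<dagger> \<cdot> (t \<cdot> e))) = e \<cdot> (t\<^sup>\<dagger> \<cdot> (t \<cdot> e)) \<cdot> c \<Longrightarrow> c \<cdot> e = e \<cdot> c \<Longrightarrow> c \<cdot> g = g \<cdot> c"
    using projections_equivalent [OF ep(1,2,4) ep'(1,2,4) t unitary_part_intertwine [OF x e y e' tx]
        unitary_part_intertwine [OF y e' x e sy]] by blast
  define w where "w = t \<cdot> g \<cdot> e"
  have wM: "w \<in> M" using t g ep(1) by (simp add: w_def)
  note w = w [folded w_def]
  have xg: "x \<cdot> g = g \<cdot> x"
  proof (rule g_comm)
    have xe: "x (e \<xi>) = e (x \<xi>)" for \<xi> using blinfun_compose_applyD [OF ep(5)] by simp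
    have xe': "x\<^sup>\<dagger> (e \<xi>) = e (x\<^sup>\<dagger> \<xi>)" for \<xi>
    proof -
      have "e \<cdot> x\<^sup>\<dagger> = x\<^sup>\<dagger> \<cdot> e" using arg_cong [OF ep(5), of hadj] ep(1,2) x(1) by simp
      then show ?thesis using blinfun_compose_applyD by fastforce
    qed
    have xxe: "x (x\<^sup>\<dagger> (e \<xi>)) = e \<xi>" for \<xi> using blinfun_compose_applyD [OF ep(6)] by simp
    \<comment> \<open>The Toeplitz relation, from \<open>y\<close> being isometric. On the range of
      \<open>e\<close>, where \<open>x x\<^sup>\<dagger>\<close> is the identity, multiplying it by
      \<open>x\<close> gives commutation.\<close>
    have "x\<^sup>\<dagger> \<cdot> (t\<^sup>\<dagger> \<cdot> (t \<cdot> x)) = t\<^sup>\<dagger> \<cdot> t"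
    proof -
      have "(t \<cdot> x)\<^sup>\<dagger> \<cdot> (t \<cdot> x) = (y \<cdot> t)\<^sup>\<dagger> \<cdot> (y \<cdot> t)" by (simp only: tx)
      then show ?thesis
        using t(1) x(1) y(1) by (simp add: blinfun_compose_assoc blinfun_compose_cong [OF y(2)])
    qed
    then have toeplitz: "x\<^sup>\<dagger> (t\<^sup>\<dagger> (t (x \<xi>))) = t\<^sup>\<dagger> (t \<xi>)" for \<xi>
      by (metis blinfun_apply_blinfun_compose)
    show "x \<cdot> (e \<cdot> (t\<^sup>\<dagger> \<cdot> (t \<cdot> e))) = e \<cdot> (t\<^sup>\<dagger> \<cdot> (t \<cdot> e)) \<cdot> x"
    proof (rule blinfun_eqI)
      fix \<xi>
      have "e (t\<^sup>\<dagger> (t (e (x \<xi>)))) = x (x\<^sup>\<dagger> (e (t\<^sup>\<dagger> (t (x (e \<xi>))))))"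
        by (simp add: xxe xe)
      also have "\<dots> = x (e (t\<^sup>\<dagger> (t (e \<xi>))))" by (simp add: xe' toeplitz)
      finally show "(x \<cdot> (e \<cdot> (t\<^sup>\<dagger> \<cdot> (t \<cdot> e)))) \<xi> = (e \<cdot> (t\<^sup>\<dagger> \<cdot> (t \<cdot> e)) \<cdot> x) \<xi>" by simp
    qed
  qed (rule ep(5))
  have wx: "y \<cdot> w = w \<cdot> x"
    using blinfun_compose_applyD [OF tx] blinfun_compose_applyD [OF xg] blinfun_compose_applyD [OF ep(5)]
    by (intro blinfun_eqI) (simp add: w_def)

  \<comment> \<open>For the shift parts the kernels of \<open>x\<^sup>\<dagger>\<close> and
    \<open>y\<^sup>\<dagger>\<close> must be matched. The adjoint of \<open>x s = s y\<close> shows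
    that \<open>s\<^sup>\<dagger>\<close>, rather than \<open>t\<close>, maps the first into the
    second, with inverse \<open>t\<^sup>\<dagger>\<close>.\<close>
  define q where "q = \<I> - x \<cdot> x\<^sup>\<dagger>"
  define q' where "q' = \<I> - y \<cdot> y\<^sup>\<dagger>"
  have q: "q \<in> M" "q\<^sup>\<dagger> = q" "q \<cdot> q = q" "x\<^sup>\<dagger> \<cdot> q = 0"
    and q': "q' \<in> M" "q'\<^sup>\<dagger> = q'" "q' \<cdot> q' = q'" "y\<^sup>\<dagger> \<cdot> q' = 0"
    using x y by (simp_all add: q_def q'_def blinfun_compose_bilinear blinfun_compose_assoc
        blinfun_compose_cong [OF x(2)] blinfun_compose_cong [OF y(2)])
  have st: "t\<^sup>\<dagger> \<cdot> s\<^sup>\<dagger> = \<I>" "s\<^sup>\<dagger> \<cdot> t\<^sup>\<dagger> = \<I>"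
    using arg_cong [OF t(3), of hadj] arg_cong [OF t(4), of hadj] t(1,2) by simp_all
  have tx': "s\<^sup>\<dagger> \<cdot> x\<^sup>\<dagger> = y\<^sup>\<dagger> \<cdot> s\<^sup>\<dagger>" using arg_cong [OF sy, of hadj] x y t by simp
  have sy': "t\<^sup>\<dagger> \<cdot> y\<^sup>\<dagger> = x\<^sup>\<dagger> \<cdot> t\<^sup>\<dagger>" using arg_cong [OF tx, of hadj] x y t by simp
  have "y\<^sup>\<dagger> \<cdot> (s\<^sup>\<dagger> \<cdot> q) = 0"
    using q(4) by (simp add: blinfun_compose_cong [OF tx' [symmetric]] blinfun_compose_assoc)
  then have 1: "q' \<cdot> (s\<^sup>\<dagger> \<cdot> q) = s\<^sup>\<dagger> \<cdot> q"
    by (simp add: q'_def blinfun_compose_bilinear blinfun_compose_assoc)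
  have "x\<^sup>\<dagger> \<cdot> (t\<^sup>\<dagger> \<cdot> q') = 0"
    using q'(4) by (simp add: blinfun_compose_cong [OF sy' [symmetric]] blinfun_compose_assoc)
  then have 2: "q \<cdot> (t\<^sup>\<dagger> \<cdot> q') = t\<^sup>\<dagger> \<cdot> q'"
    by (simp add: q_def blinfun_compose_bilinear blinfun_compose_assoc)
  obtain f where f: "f \<in> M" "(s\<^sup>\<dagger> \<cdot> f \<cdot> q)\<^sup>\<dagger> \<cdot> (s\<^sup>\<dagger> \<cdot> f \<cdot> q) = q" "(s\<^sup>\<dagger> \<cdot> f \<cdot> q) \<cdot> (s\<^sup>\<dagger> \<cdot> f \<cdot> q)\<^sup>\<dagger> = q'"
    using projections_equivalent [OF q(1-3) q'(1-3) hadj_mem [OF t(2)] hadj_mem [OF t(1)] st 1 2] by blast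
  define v where "v = s\<^sup>\<dagger> \<cdot> f \<cdot> q"
  have v: "v \<in> M" "v\<^sup>\<dagger> \<cdot> v = \<I> - x \<cdot> x\<^sup>\<dagger>" "v \<cdot> v\<^sup>\<dagger> = \<I> - y \<cdot> y\<^sup>\<dagger>"
  proof -
    show "v \<in> M" using f(1) t(2) q(1) by (simp add: v_def)
  qed (use f(2,3) in \<open>simp_all only: v_def q_def q'_def\<close>)
  obtain d where d: "d \<in> M" "\<And>\<xi>. (\<lambda>n. shift_sum x y v n \<xi>) \<longlonglongrightarrow> d \<xi>" "d\<^sup>\<dagger> \<cdot> d = \<I> - e" "d \<cdot> x = y \<cdot> d"
    using shift_part [OF x y v e] by blast
  have v': "v\<^sup>\<dagger> \<in> M" "v\<^sup>\<dagger>\<^sup>\<dagger> \<cdot> v\<^sup>\<dagger> = \<I> - y \<cdot> y\<^sup>\<dagger>" "v\<^sup>\<dagger> \<cdot> v\<^sup>\<dagger>\<^sup>\<dagger> = \<I> - x \<cdot> x\<^sup>\<dagger>"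
    using v by simp_all
  obtain d' where d': "d' \<in> M" "\<And>\<xi>. (\<lambda>n. shift_sum y x (v\<^sup>\<dagger>) n \<xi>) \<longlonglongrightarrow> d' \<xi>" "d'\<^sup>\<dagger> \<cdot> d' = \<I> - e'"
    using shift_part [OF y x v' e'] by blast
  \<comment> \<open>\<open>shift_part\<close> supplies only initial projections; exchanging
    \<open>x\<close> and \<open>y\<close> produces the adjoint of \<open>d\<close> and thereby its
    final projection.\<close>
  have "d\<^sup>\<dagger> = d'"
  proof (rule hadj_eqI_rinner [OF d(1)], rule LIMSEQ_unique)
    fix \<xi> \<eta>
    show "(\<lambda>n. rinner \<xi> (shift_sum y x (v\<^sup>\<dagger>) n \<eta>)) \<longlonglongrightarrow> rinner \<xi> (d' \<eta>)"
      by (intro tendsto_rinner tendsto_const d')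
    have "rinner \<xi> (shift_sum y x (v\<^sup>\<dagger>) n \<eta>) = rinner (shift_sum x y v n \<xi>) \<eta>" for n
      using x(1) y(1) v(1) by (simp add: rinner_hadj flip: hadj_shift_sum)
    then show "(\<lambda>n. rinner \<xi> (shift_sum y x (v\<^sup>\<dagger>) n \<eta>)) \<longlonglongrightarrow> rinner (d \<xi>) \<eta>"
      by (simp add: tendsto_rinner d(2))
  qed
  then have dd: "d \<cdot> d\<^sup>\<dagger> = \<I> - e'" using d'(3) d(1) by (metis hadj_hadj)
  have "d \<cdot> e = 0"
  proof (rule eq_zero_if_hadj_compose)
    have "e \<cdot> (d\<^sup>\<dagger> \<cdot> d) \<cdot> e = 0" using ep(4) by (simp add: d(3) blinfun_compose_bilinear)
    then show "(d \<cdot> e)\<^sup>\<dagger> \<cdot> (d \<cdot> e) = 0" using d(1) ep(1,2) by (simp add: blinfun_compose_assoc)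
  qed (use d(1) ep(1) in simp)
  have "d\<^sup>\<dagger> \<cdot> e' = 0"
  proof (rule eq_zero_if_hadj_compose)
    have "e' \<cdot> (d \<cdot> d\<^sup>\<dagger>) \<cdot> e' = 0" using ep'(4) by (simp add: dd blinfun_compose_bilinear)
    then show "(d\<^sup>\<dagger> \<cdot> e')\<^sup>\<dagger> \<cdot> (d\<^sup>\<dagger> \<cdot> e') = 0" using d(1) ep'(1,2) by (simp add: blinfun_compose_assoc)
  qed (use d(1) ep'(1) in simp)
  have we: "w \<cdot> e = w" by (simp add: w_def blinfun_compose_assoc ep(4))
  have e'w: "e' \<cdot> w = w" by (simp add: blinfun_compose_assoc w(1) we flip: w(2))
  have "d\<^sup>\<dagger> \<cdot> w = 0"
    by (subst e'w [symmetric]) (simp add: blinfun_compose_cong [OF \<open>d\<^sup>\<dagger> \<cdot> e' = 0\<close>])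
  from arg_cong [OF this, of hadj] have "w\<^sup>\<dagger> \<cdot> d = 0" using d(1) wM by simp
  have "w \<cdot> d\<^sup>\<dagger> = 0"
  proof -
    have "e \<cdot> d\<^sup>\<dagger> = 0" using arg_cong [OF \<open>d \<cdot> e = 0\<close>, of hadj] d(1) ep(1,2) by simp
    then show ?thesis by (subst we [symmetric]) (simp add: blinfun_compose_assoc)
  qed
  from arg_cong [OF this, of hadj] have "d \<cdot> w\<^sup>\<dagger> = 0" using d(1) wM by simp
  \<comment> \<open>The initial projections \<open>e\<close>, \<open>\<I> - e\<close> of
    \<open>w\<close> and \<open>d\<close> are complementary, and so are the final ones; the cross
    terms vanish and the sum is unitary.\<close>
  show thesis
  proof (rule that [of "w + d"])
    show "w + d \<in> M" using wM d(1) by simp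
    show "(w + d)\<^sup>\<dagger> \<cdot> (w + d) = \<I>"
      using wM d(1) w(1) d(3) \<open>d\<^sup>\<dagger> \<cdot> w = 0\<close> \<open>w\<^sup>\<dagger> \<cdot> d = 0\<close> by (simp add: blinfun_compose_bilinear)
    show "(w + d) \<cdot> (w + d)\<^sup>\<dagger> = \<I>"
      using wM d(1) w(2) dd \<open>w \<cdot> d\<^sup>\<dagger> = 0\<close> \<open>d \<cdot> w\<^sup>\<dagger> = 0\<close> by (simp add: blinfun_compose_bilinear)
    show "y \<cdot> (w + d) = (w + d) \<cdot> x"
      using wx d(4) by (simp add: blinfun_compose_bilinear)
  qed
qed

end

subsection \<open>Maximal partial isometries are C*-extreme points\<close>

context vna
begin

lemma isometryI:
  assumes "y \<in> M" "\<And>\<xi>. norm (y \<xi>) = norm \<xi>"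
  shows "y\<^sup>\<dagger> \<cdot> y = \<I>"
proof (rule blinfun_eqI_rinner)
  fix \<xi> \<eta>
  have "(norm (y \<eta> + y \<xi>))\<^sup>2 = (norm (\<eta> + \<xi>))\<^sup>2"
    using assms(2) [of "\<eta> + \<xi>"] by (simp add: blinfun_apply_simps)
  then have "rinner (y \<eta>) (y \<xi>) = rinner \<eta> \<xi>"
    by (simp add: norm_add_sq assms(2))
  then show "rinner \<eta> ((y\<^sup>\<dagger> \<cdot> y) \<xi>) = rinner \<eta> (\<I> \<xi>)" using assms(1) by (simp add: rinner_hadj)
qed

text \<open>Summing \<open>\<parallel>y\<^sub>i t\<^sub>i \<xi> - t\<^sub>i x \<xi>\<parallel>\<^sup>2 + (\<parallel>t\<^sub>i \<xi>\<parallel>\<^sup>2 - \<parallel>y\<^sub>i t\<^sub>i \<xi>\<parallel>\<^sup>2)\<close>, whose terms are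
  nonnegative, over \<open>i\<close> gives \<open>0\<close>.\<close>

lemma isometry_cstar_convex_combination:
  assumes x: "x \<in> M" "x\<^sup>\<dagger> \<cdot> x = \<I>" and I: "finite I"
    and t: "\<And>i. i \<in> I \<Longrightarrow> t i \<in> M" "\<And>i. i \<in> I \<Longrightarrow> t i \<cdot> s i = \<I>"
    and y: "\<And>i. i \<in> I \<Longrightarrow> y i \<in> M" "\<And>i. i \<in> I \<Longrightarrow> norm (y i) \<le> 1"
    and sum_t: "(\<Sum>i\<in>I. (t i)\<^sup>\<dagger> \<cdot> t i) = \<I>" and sum_y: "x = (\<Sum>i\<in>I. (t i)\<^sup>\<dagger> \<cdot> y i \<cdot> t i)"
    and i: "i \<in> I"
  shows "y i \<cdot> t i = t i \<cdot> x" "(y i)\<^sup>\<dagger> \<cdot> y i = \<I>"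
proof -
  have key: "y i (t i \<xi>) = t i (x \<xi>) \<and> norm (y i (t i \<xi>)) = norm (t i \<xi>)" for \<xi>
  proof -
    define A where "A i = (norm (y i (t i \<xi>) - t i (x \<xi>)))\<^sup>2" for i
    define B where "B i = (norm (t i \<xi>))\<^sup>2 - (norm (y i (t i \<xi>)))\<^sup>2" for i
    have nonneg: "0 \<le> A i" "i \<in> I \<Longrightarrow> 0 \<le> B i" for i
      using norm_contraction_le [OF y(2)] by (simp_all add: A_def B_def power_mono)
    have sum_norm: "(\<Sum>i\<in>I. (norm (t i \<eta>))\<^sup>2) = (norm \<eta>)\<^sup>2" for \<eta>
    proof -
      have "(\<Sum>i\<in>I. (norm (t i \<eta>))\<^sup>2) = (\<Sum>i\<in>I. rinner (((t i)\<^sup>\<dagger> \<cdot> t i) \<eta>) \<eta>)"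
        by (intro sum.cong refl) (simp add: norm_sq_rinner t)
      also have "\<dots> = rinner \<eta> \<eta>"
        using arg_cong [OF sum_t, of "\<lambda>T. rinner (T \<eta>) \<eta>"] by (simp add: blinfun.sum_left rinner_sum)
      finally show ?thesis by (simp add: rinner_self)
    qed
    have "(\<Sum>i\<in>I. rinner (y i (t i \<xi>)) (t i (x \<xi>))) = (\<Sum>i\<in>I. rinner (((t i)\<^sup>\<dagger> \<cdot> y i \<cdot> t i) \<xi>) (x \<xi>))"
      by (intro sum.cong refl) (simp add: rinner_hadj' t)
    also have "\<dots> = rinner (x \<xi>) (x \<xi>)"
      using arg_cong [OF sum_y, of "\<lambda>T. rinner (T \<xi>) (x \<xi>)"] by (simp add: blinfun.sum_left rinner_sum)
    finally have sum_xy: "(\<Sum>i\<in>I. rinner (y i (t i \<xi>)) (t i (x \<xi>))) = (norm (x \<xi>))\<^sup>2"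
      by (simp add: rinner_self)
    have "A i + B i = (norm (t i \<xi>))\<^sup>2 - 2 * rinner (y i (t i \<xi>)) (t i (x \<xi>)) + (norm (t i (x \<xi>)))\<^sup>2" for i
      by (simp add: A_def B_def norm_diff_sq)
    then have "(\<Sum>i\<in>I. A i + B i) = (norm \<xi>)\<^sup>2 - 2 * (norm (x \<xi>))\<^sup>2 + (norm (x \<xi>))\<^sup>2"
      by (simp add: sum.distrib sum_subtractf sum_norm sum_xy flip: sum_distrib_left)
    also have "(norm (x \<xi>))\<^sup>2 = (norm \<xi>)\<^sup>2"
      using norm_sq_rinner_eq [OF x, of \<xi>] by (simp add: rinner_self)
    finally have "(\<Sum>i\<in>I. A i + B i) = 0" by simp
    then have "A i + B i = 0"
      using sum_nonneg_eq_0_iff [OF I, of "\<lambda>i. A i + B i"] nonneg i by simp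
    then have "A i = 0" "B i = 0" using nonneg [of i] i by linarith+
    then show ?thesis by (simp add: A_def B_def)
  qed
  then show "y i \<cdot> t i = t i \<cdot> x" by (intro blinfun_eqI) simp
  show "(y i)\<^sup>\<dagger> \<cdot> y i = \<I>"
  proof (rule isometryI [OF y(1) [OF i]])
    fix \<xi>
    \<comment> \<open>Norms are known to be preserved only on the range of \<open>t i\<close>, which
      is everything because \<open>s i\<close> is a right inverse.\<close>
    show "norm (y i \<xi>) = norm \<xi>"
      using conjunct2 [OF key [of "s i \<xi>"]] blinfun_compose_applyD [OF t(2) [OF i], of \<xi>] by simp
  qed
qed

text \<open>\<open>cut\<close> keeps an operator on the range of \<open>z\<close> and puts the
  identity on the complement, which makes \<open>x\<close> a global isometry. As \<open>z\<close> is
  central and the \<open>(t i)\<^sup>\<dagger> t i\<close> sum to \<open>\<I>\<close>, the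
  decomposition of \<open>x\<close> becomes one of \<open>cut x\<close> with the same
  coefficients.\<close>

lemma isometry_part_unitarily_equivalent:
  assumes z: "z \<in> M" "z\<^sup>\<dagger> = z" "z \<cdot> z = z" "\<And>m. m \<in> M \<Longrightarrow> z \<cdot> m = m \<cdot> z"
    and x: "x \<in> M" "x\<^sup>\<dagger> \<cdot> x \<cdot> z = z" and I: "finite I"
    and t: "\<And>i. i \<in> I \<Longrightarrow> t i \<in> M" "\<And>i. i \<in> I \<Longrightarrow> s i \<in> M"
      "\<And>i. i \<in> I \<Longrightarrow> s i \<cdot> t i = \<I>" "\<And>i. i \<in> I \<Longrightarrow> t i \<cdot> s i = \<I>"
    and y: "\<And>i. i \<in> I \<Longrightarrow> y i \<in> M" "\<And>i. i \<in> I \<Longrightarrow> norm (y i) \<le> 1"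
    and sum_t: "(\<Sum>i\<in>I. (t i)\<^sup>\<dagger> \<cdot> t i) = \<I>" and sum_y: "x = (\<Sum>i\<in>I. (t i)\<^sup>\<dagger> \<cdot> y i \<cdot> t i)"
    and i: "i \<in> I"
  obtains u where "u \<in> M" "u\<^sup>\<dagger> \<cdot> u = \<I>" "u \<cdot> u\<^sup>\<dagger> = \<I>" "y i \<cdot> u \<cdot> z = u \<cdot> x \<cdot> z"
proof -
  define cut where "cut m = m \<cdot> z + (\<I> - z)" for m
  have cut_mem: "cut m \<in> M" if "m \<in> M" for m using that z(1) by (simp add: cut_def)
  have cut_hadj: "(cut m)\<^sup>\<dagger> \<cdot> cut m = m\<^sup>\<dagger> \<cdot> m \<cdot> z + (\<I> - z)" if m: "m \<in> M" for m
  proof (rule blinfun_eqI)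
    fix \<xi>
    have "z (m \<eta>) = m (z \<eta>)" "z (m\<^sup>\<dagger> \<eta>) = m\<^sup>\<dagger> (z \<eta>)" for \<eta>
      using blinfun_compose_applyD [OF z(4) [OF m]] blinfun_compose_applyD [OF z(4) [OF hadj_mem [OF m]]] by simp_all
    then show "((cut m)\<^sup>\<dagger> \<cdot> cut m) \<xi> = (m\<^sup>\<dagger> \<cdot> m \<cdot> z + (\<I> - z)) \<xi>"
      using z(1,2) m blinfun_compose_applyD [OF z(3)] by (simp add: cut_def blinfun_apply_simps)
  qed
  have cut_norm: "norm (cut m) \<le> 1" if m: "m \<in> M" "norm m \<le> 1" for m
  proof -
    have "positive_op (z\<^sup>\<dagger> \<cdot> (\<I> - m\<^sup>\<dagger> \<cdot> m) \<cdot> z)"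
      using m norm_le_1_iff_positive z(1) by (intro positive_op_conjugate) auto
    also have "z\<^sup>\<dagger> \<cdot> (\<I> - m\<^sup>\<dagger> \<cdot> m) \<cdot> z = (\<I> - m\<^sup>\<dagger> \<cdot> m) \<cdot> z \<cdot> z"
      using z(4) [of "\<I> - m\<^sup>\<dagger> \<cdot> m"] m z(2) by simp
    also have "\<dots> = \<I> - (cut m)\<^sup>\<dagger> \<cdot> cut m"
      using z(3) by (simp add: cut_hadj m blinfun_compose_bilinear blinfun_compose_assoc)
    finally show ?thesis using norm_le_1_iff_positive cut_mem m by blast
  qed
  have cut_x: "(cut x)\<^sup>\<dagger> \<cdot> cut x = \<I>" using x by (simp add: cut_hadj)
  have summand: "(t i)\<^sup>\<dagger> \<cdot> cut (y i) \<cdot> t i = (t i)\<^sup>\<dagger> \<cdot> y i \<cdot> t i \<cdot> z + (t i)\<^sup>\<dagger> \<cdot> t i \<cdot> (\<I> - z)" if "i \<in> I" for i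
    using z(4) [OF t(1) [OF that]] by (simp add: cut_def blinfun_compose_bilinear blinfun_compose_assoc)
  have "(\<Sum>i\<in>I. (t i)\<^sup>\<dagger> \<cdot> cut (y i) \<cdot> t i) = (\<Sum>i\<in>I. (t i)\<^sup>\<dagger> \<cdot> y i \<cdot> t i \<cdot> z + (t i)\<^sup>\<dagger> \<cdot> t i \<cdot> (\<I> - z))"
    by (intro sum.cong refl summand)
  also have "\<dots> = cut x"
    unfolding cut_def sum.distrib
    by (simp add: bounded_bilinear.sum_left [OF bounded_bilinear_blinfun_compose, symmetric] sum_t flip: sum_y)
  finally have sum_cut: "cut x = (\<Sum>i\<in>I. (t i)\<^sup>\<dagger> \<cdot> cut (y i) \<cdot> t i)" by simp
  note iso = isometry_cstar_convex_combination [OF cut_mem [OF x(1)] cut_x I t(1,4) cut_mem [OF y(1)]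
      cut_norm [OF y] sum_t sum_cut i]
  obtain u where u: "u \<in> M" "u\<^sup>\<dagger> \<cdot> u = \<I>" "u \<cdot> u\<^sup>\<dagger> = \<I>" "cut (y i) \<cdot> u = u \<cdot> cut x"
    using similar_isometries_unitarily_equivalent [OF cut_mem [OF x(1)] cut_x cut_mem [OF y(1) [OF i]] iso(2)
        t(1-4) [OF i] iso(1)] by blast
  have "y i \<cdot> u \<cdot> z = u \<cdot> x \<cdot> z"
  proof -
    have "cut (y i) \<cdot> u \<cdot> z = y i \<cdot> u \<cdot> z"
      using z(3) z(4) [OF u(1)] by (simp add: cut_def blinfun_compose_bilinear blinfun_compose_assoc)
    moreover have "u \<cdot> cut x \<cdot> z = u \<cdot> x \<cdot> z"
      using z(3) by (simp add: cut_def blinfun_compose_bilinear blinfun_compose_assoc)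
    ultimately show ?thesis using u(4) by simp
  qed
  then show thesis using that u(1-3) by blast
qed

theorem maximal_partial_isometry_imp_cstar_extreme_point:
  assumes x: "x \<in> maximal_partial_isometries"
  shows "cstar_extreme_point (operator_algebra M) x"
proof -
  have xM: "x \<in> M" and xxx: "x \<cdot> (x\<^sup>\<dagger> \<cdot> x) = x"
    and ext: "\<And>m. m \<in> M \<Longrightarrow> (\<I> - x \<cdot> x\<^sup>\<dagger>) \<cdot> m \<cdot> (\<I> - x\<^sup>\<dagger> \<cdot> x) = 0"
    using x by (auto simp: maximal_partial_isometries_def)
  define q where "q = \<I> - x \<cdot> x\<^sup>\<dagger>"
  define p where "p = \<I> - x\<^sup>\<dagger> \<cdot> x"
  have qM: "q \<in> M" using xM by (simp add: q_def)
  obtain z where z: "z \<in> M" "z\<^sup>\<dagger> = z" "z \<cdot> z = z" "\<And>m. m \<in> M \<Longrightarrow> z \<cdot> m = m \<cdot> z" "z \<cdot> q = q"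
    and z_least: "\<And>a :: 'h \<Rightarrow>\<^sub>L 'h. (\<And>m. m \<in> M \<Longrightarrow> a \<cdot> m \<cdot> q = 0) \<Longrightarrow> a \<cdot> z = 0"
    using central_support [OF qM] by blast
  define z' where "z' = \<I> - z"
  have z': "z' \<in> M" "z'\<^sup>\<dagger> = z'" "z' \<cdot> z' = z'" "\<And>m. m \<in> M \<Longrightarrow> z' \<cdot> m = m \<cdot> z'"
  proof -
    show "z' \<cdot> m = m \<cdot> z'" if "m \<in> M" for m
      by (simp add: z'_def blinfun_compose_bilinear z(4) [OF that])
  qed (use z(1-3) in \<open>simp_all add: z'_def blinfun_compose_bilinear\<close>)
  \<comment> \<open>The adjoint of the corner condition is \<open>p m q = 0\<close> for all
    \<open>m\<close>, exactly the premise of \<open>z_least\<close>. So \<open>x\<close> is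
    isometric on the range of \<open>z\<close>, while \<open>z q = q\<close> makes
    \<open>x\<^sup>\<dagger>\<close> isometric on the complement.\<close>
  have "p \<cdot> z = 0"
  proof (rule z_least)
    fix m assume "m \<in> M"
    then show "p \<cdot> m \<cdot> q = 0"
      using arg_cong [OF ext [of "m\<^sup>\<dagger>"], of hadj] xM by (simp add: p_def q_def blinfun_compose_assoc)
  qed
  then have xz: "x\<^sup>\<dagger> \<cdot> x \<cdot> z = z" by (simp add: p_def blinfun_compose_bilinear)
  have "q \<cdot> z' = 0" by (simp add: z'_def blinfun_compose_bilinear z(5) flip: z(4) [OF qM])
  then have xz': "x\<^sup>\<dagger>\<^sup>\<dagger> \<cdot> x\<^sup>\<dagger> \<cdot> z' = z'" using xM by (simp add: q_def blinfun_compose_bilinear)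
  have x1: "norm x \<le> 1"
  proof -
    have "p\<^sup>\<dagger> \<cdot> p = p"
      using xM blinfun_compose_cong [OF xxx] by (simp add: p_def blinfun_compose_bilinear blinfun_compose_assoc xxx)
    then have "positive_op p" using positive_op_hadj_compose [of p] xM by (simp add: p_def)
    then show ?thesis using norm_le_1_iff_positive [OF xM] by (simp add: p_def)
  qed
  have "\<exists>u. \<forall>i\<in>{1..k}. u i \<in> unitaries (operator_algebra M) \<and> y i = (u i)\<^sup>\<dagger> \<cdot> x \<cdot> u i"
    if yt: "\<forall>i\<in>{1..k}. y i \<in> closed_unit_ball (operator_algebra M) \<and> t i \<in> Units (operator_algebra M)"
      and sum_t: "(\<Sum>i=1..k. (t i)\<^sup>\<dagger> \<cdot> t i) = \<I>" and sum_y: "x = (\<Sum>i=1..k. (t i)\<^sup>\<dagger> \<cdot> y i \<cdot> t i)"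
    for k :: nat and y t
  proof (rule bchoice, rule ballI)
    fix i assume i: "i \<in> {1..k}"
    have y: "y i \<in> M" "norm (y i) \<le> 1" and t: "t i \<in> M" if "i \<in> {1..k}" for i
      using bspec [OF yt that] by (simp_all add: closed_unit_ball_operator_algebra Units_operator_algebra)
    have "\<forall>i\<in>{1..k}. \<exists>r. r \<in> M \<and> r \<cdot> t i = \<I> \<and> t i \<cdot> r = \<I>"
      using yt by (auto simp: Units_operator_algebra)
    then obtain s where s: "\<And>i. i \<in> {1..k} \<Longrightarrow> s i \<in> M" "\<And>i. i \<in> {1..k} \<Longrightarrow> s i \<cdot> t i = \<I>"
        "\<And>i. i \<in> {1..k} \<Longrightarrow> t i \<cdot> s i = \<I>"
      using bchoice [of "{1..k}" "\<lambda>i r. r \<in> M \<and> r \<cdot> t i = \<I> \<and> t i \<cdot> r = \<I>"] by blast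
    have y': "(y i)\<^sup>\<dagger> \<in> M" "norm ((y i)\<^sup>\<dagger>) \<le> 1" if "i \<in> {1..k}" for i
      using y [OF that] by simp_all
    have "x\<^sup>\<dagger> = (\<Sum>i=1..k. ((t i)\<^sup>\<dagger> \<cdot> y i \<cdot> t i)\<^sup>\<dagger>)"
      by (subst sum_y, rule hadj_sum) (simp add: y t)
    then have sum_y': "x\<^sup>\<dagger> = (\<Sum>i=1..k. (t i)\<^sup>\<dagger> \<cdot> (y i)\<^sup>\<dagger> \<cdot> t i)"
      by (simp add: y t blinfun_compose_assoc)
    obtain u where u: "u \<in> M" "u\<^sup>\<dagger> \<cdot> u = \<I>" "u \<cdot> u\<^sup>\<dagger> = \<I>" "y i \<cdot> u \<cdot> z = u \<cdot> x \<cdot> z"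
      using isometry_part_unitarily_equivalent [OF z(1-4) xM xz finite_atLeastAtMost t s y sum_t sum_y i] by blast
    \<comment> \<open>On the range of \<open>z'\<close> it is \<open>x\<^sup>\<dagger>\<close> that
      is isometric, so the adjoint decomposition is used, with the same coefficients.\<close>
    obtain v where v: "v \<in> M" "v\<^sup>\<dagger> \<cdot> v = \<I>" "v \<cdot> v\<^sup>\<dagger> = \<I>" "(y i)\<^sup>\<dagger> \<cdot> v \<cdot> z' = v \<cdot> x\<^sup>\<dagger> \<cdot> z'"
      using isometry_part_unitarily_equivalent [OF z' hadj_mem [OF xM] xz' finite_atLeastAtMost t s y' sum_t sum_y' i] by blast
    \<comment> \<open>Since \<open>v\<close> is unitary and \<open>z'\<close> central, taking
      adjoints turns conjugation of \<open>x\<^sup>\<dagger>\<close> into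
      \<open>(y i)\<^sup>\<dagger>\<close> into conjugation of \<open>x\<close> into
      \<open>y i\<close> by the same \<open>v\<close>.\<close>
    have yv: "y i \<cdot> v \<cdot> z' = v \<cdot> x \<cdot> z'"
    proof -
      have "v\<^sup>\<dagger> \<cdot> ((y i)\<^sup>\<dagger> \<cdot> v \<cdot> z') = x\<^sup>\<dagger> \<cdot> z'"
        unfolding v(4) by (simp add: blinfun_compose_assoc blinfun_compose_cong [OF v(2)])
      from arg_cong [OF this, of hadj] have "z' \<cdot> (v\<^sup>\<dagger> \<cdot> (y i \<cdot> v)) = z' \<cdot> x"
        using v(1) y [OF i] z'(1,2) xM by (simp add: blinfun_compose_assoc)
      then have "v\<^sup>\<dagger> \<cdot> (y i \<cdot> v) \<cdot> z' = x \<cdot> z'"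
        unfolding z'(4) [OF xM] z'(4) [OF compose_mem [OF hadj_mem [OF v(1)] compose_mem [OF y(1) [OF i] v(1)]]] .
      from arg_cong [OF this, of "\<lambda>a. v \<cdot> a"]
      show ?thesis by (simp add: blinfun_compose_assoc blinfun_compose_cong [OF v(3)])
    qed
    \<comment> \<open>Centrality of \<open>z\<close> allows gluing the two unitaries into
      one.\<close>
    define w where "w = u \<cdot> z + v \<cdot> z'"
    have wM: "w \<in> M" by (simp add: w_def u(1) v(1) z(1) z'(1))
    have zz': "z (z' \<xi>) = 0" "z' (z \<xi>) = 0" "z (z \<xi>) = z \<xi>" "z' (z' \<xi>) = z' \<xi>" "z \<xi> + z' \<xi> = \<xi>" for \<xi>
      using blinfun_compose_applyD [OF z(3), of \<xi>] by (simp_all add: z'_def blinfun_apply_simps)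
    have comm: "m (z \<xi>) = z (m \<xi>)" "m (z' \<xi>) = z' (m \<xi>)" if "m \<in> M" for m \<xi>
      using blinfun_compose_applyD [OF z(4) [OF that]] blinfun_compose_applyD [OF z'(4) [OF that]] by simp_all
    note comms = comm [OF u(1)] comm [OF v(1)] comm [OF hadj_mem [OF u(1)]] comm [OF hadj_mem [OF v(1)]]
    have w_hadj: "w\<^sup>\<dagger> = z \<cdot> u\<^sup>\<dagger> + z' \<cdot> v\<^sup>\<dagger>" using u(1) v(1) z(1,2) z'(1,2) by (simp add: w_def)
    note uv = blinfun_compose_applyD [OF u(2)] blinfun_compose_applyD [OF u(3)]
      blinfun_compose_applyD [OF v(2)] blinfun_compose_applyD [OF v(3)]
    have ww: "w\<^sup>\<dagger> \<cdot> w = \<I>" "w \<cdot> w\<^sup>\<dagger> = \<I>"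
      by (rule blinfun_eqI, simp add: w_hadj, simp add: w_def blinfun_apply_simps comms uv zz')+
    have "y i \<cdot> w = w \<cdot> x"
    proof -
      have "y i \<cdot> w = u \<cdot> x \<cdot> z + v \<cdot> x \<cdot> z'"
        using u(4) yv by (simp add: w_def blinfun_compose_bilinear blinfun_compose_assoc)
      also have "\<dots> = w \<cdot> x"
        using z(4) [OF xM] z'(4) [OF xM] by (simp add: w_def blinfun_compose_bilinear blinfun_compose_assoc)
      finally show ?thesis .
    qed
    then have "y i = w \<cdot> x \<cdot> w\<^sup>\<dagger>"
      by (metis ww(2) blinfun_compose_assoc blinfun_compose_id(2))
    \<comment> \<open>The definition asks for the form \<open>u\<^sup>\<dagger> x u\<close>, hence
      the adjoint of \<open>w\<close> as witness.\<close>
    then have "w\<^sup>\<dagger> \<in> unitaries (operator_algebra M) \<and> y i = w\<^sup>\<dagger>\<^sup>\<dagger> \<cdot> x \<cdot> w\<^sup>\<dagger>"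
      using wM ww by (simp add: unitaries_operator_algebra)
    then show "\<exists>u. u \<in> unitaries (operator_algebra M) \<and> y i = u\<^sup>\<dagger> \<cdot> x \<cdot> u" by blast
  qed
  then show ?thesis
    using xM x1 unfolding cstar_extreme_point_def closed_unit_ball_operator_algebra
    by (simp add: operator_algebra_def)
qed

lemma closed_maximal_partial_isometries: "closed maximal_partial_isometries"
proof (rule closed_sequential_limits [THEN iffD2], intro allI impI)
  fix A B assume "(\<forall>n. A n \<in> maximal_partial_isometries) \<and> A \<longlonglongrightarrow> B"
  then have A: "A n \<in> maximal_partial_isometries" and lim: "A \<longlonglongrightarrow> B" for n by auto
  have AM: "A n \<in> M" for n using A by (simp add: maximal_partial_isometries_def)
  have B: "B \<in> M" using closed_sequentially [OF closed_M AM lim] .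
  note compose = bounded_bilinear.tendsto [OF bounded_bilinear_blinfun_compose]
  note hadj = hadj_limit [OF AM lim]
  have "B \<cdot> (B\<^sup>\<dagger> \<cdot> B) = B"
  proof (rule LIMSEQ_unique [OF _ lim])
    have "(\<lambda>n. A n \<cdot> ((A n)\<^sup>\<dagger> \<cdot> A n)) \<longlonglongrightarrow> B \<cdot> (B\<^sup>\<dagger> \<cdot> B)" by (intro compose lim hadj)
    then show "A \<longlonglongrightarrow> B \<cdot> (B\<^sup>\<dagger> \<cdot> B)" using A by (simp add: maximal_partial_isometries_def)
  qed
  moreover have "(\<I> - B \<cdot> B\<^sup>\<dagger>) \<cdot> m \<cdot> (\<I> - B\<^sup>\<dagger> \<cdot> B) = 0" if "m \<in> M" for m
  proof -
    have "(\<lambda>n. (\<I> - A n \<cdot> (A n)\<^sup>\<dagger>) \<cdot> m \<cdot> (\<I> - (A n)\<^sup>\<dagger> \<cdot> A n)) \<longlonglongrightarrow> (\<I> - B \<cdot> B\<^sup>\<dagger>) \<cdot> m \<cdot> (\<I> - B\<^sup>\<dagger> \<cdot> B)"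
      by (intro compose tendsto_diff tendsto_const lim hadj)
    then show ?thesis using A that by (simp add: maximal_partial_isometries_def LIMSEQ_const_iff)
  qed
  ultimately show "B \<in> maximal_partial_isometries" using B by (simp add: maximal_partial_isometries_def)
qed

end

subsection \<open>Continuous functions\<close>

text \<open>The modified function is continuous when \<open>w\<close> is isolated;
  \<open>Bcontfun\<close> is unfolded only under that hypothesis.\<close>

definition point_update :: "'w::t2_space \<Rightarrow> 'b::metric_space \<Rightarrow> ('w \<Rightarrow>\<^sub>C 'b) \<Rightarrow> 'w \<Rightarrow>\<^sub>C 'b"
  where "point_update w a g = Bcontfun (\<lambda>v. if v = w then a else g v)"

lemma point_update_apply:
  assumes "w isolated_in UNIV"
  shows "point_update w a g v = (if v = w then a else g v)"
proof -
  have "open {w}" using assms by (auto simp: isolated_in_def)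
  then have "continuous_on ({w} \<union> - {w}) (\<lambda>v. if v = w then a else g v)"
    by (intro continuous_on_cases) (auto simp: closed_def)
  moreover have "bounded (range (\<lambda>v. if v = w then a else g v))"
    by (rule bounded_subset [of "insert a (range g)"]) auto
  ultimately show ?thesis by (simp add: point_update_def bcontfun_def Bcontfun_inverse)
qed

lemma sum_bcontfun_apply: "(\<Sum>i\<in>I. F i) v = (\<Sum>i\<in>I. apply_bcontfun (F i) v)"
  for F :: "'i \<Rightarrow> 'w::topological_space \<Rightarrow>\<^sub>C 'b::real_normed_vector"
  by (induction I rule: infinite_finite_induct) simp_all

lemma (in vna) cstar_extreme_point_at_isolated_point:
  fixes f :: "'w::t2_space \<Rightarrow>\<^sub>C ('h \<Rightarrow>\<^sub>L 'h)"
  assumes f: "cstar_extreme_point (continuous_algebra M) f" and w: "w isolated_in UNIV"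
  shows "cstar_extreme_point (operator_algebra M) (f w)"
proof -
  define C where "C = (continuous_algebra M :: ('w \<Rightarrow>\<^sub>C ('h \<Rightarrow>\<^sub>L 'h)) star_algebra)"
  have carrier_C: "g \<in> carrier C \<longleftrightarrow> (\<forall>v. apply_bcontfun g v \<in> M)" for g
    by (simp add: C_def continuous_algebra_def)
  have one_C: "\<one>\<^bsub>C\<^esub> v = \<I>" for v by (simp add: C_def continuous_algebra_def)
  have mult_C: "(g \<otimes>\<^bsub>C\<^esub> h) v = g v \<cdot> h v" for g h v
    unfolding C_def by (rule continuous_algebra_mult_apply)
  have star_C: "star C g v = (g v)\<^sup>\<dagger>" if "\<forall>v. apply_bcontfun g v \<in> M" for g v
    unfolding C_def
    by (rule continuous_algebra_star_apply [OF vna carrier_C [THEN iffD2, OF that, unfolded C_def]])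
  have f_mem: "f v \<in> M" and f_norm: "norm f \<le> 1" for v
    using f carrier_C by (auto simp: cstar_extreme_point_def closed_unit_ball_def C_def)
  note upd = point_update_apply [OF w]
  have "\<exists>u. \<forall>i\<in>{1..k}. u i \<in> unitaries (operator_algebra M) \<and> y i = (u i)\<^sup>\<dagger> \<cdot> f w \<cdot> u i"
    if yt: "\<forall>i\<in>{1..k}. y i \<in> closed_unit_ball (operator_algebra M) \<and> t i \<in> Units (operator_algebra M)"
      and sum_t: "(\<Sum>i=1..k. (t i)\<^sup>\<dagger> \<cdot> t i) = \<I>" and sum_y: "f w = (\<Sum>i=1..k. (t i)\<^sup>\<dagger> \<cdot> y i \<cdot> t i)"
    for k :: nat and y t
  \<comment> \<open>For \<open>k = 0\<close> the index set is empty and the claim vacuous; the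
    coefficients below divide by \<open>sqrt k\<close>.\<close>
  proof (cases "k = 0")
    case False
    then have k: "real k > 0" by simp
    have y: "y i \<in> M" "norm (y i) \<le> 1" and t: "t i \<in> M" if "i \<in> {1..k}" for i
      using bspec [OF yt that] by (simp_all add: closed_unit_ball_operator_algebra Units_operator_algebra)
    have "\<forall>i\<in>{1..k}. \<exists>r. r \<in> M \<and> r \<cdot> t i = \<I> \<and> t i \<cdot> r = \<I>"
      using yt by (auto simp: Units_operator_algebra)
    then obtain s where s: "\<And>i. i \<in> {1..k} \<Longrightarrow> s i \<in> M" "\<And>i. i \<in> {1..k} \<Longrightarrow> s i \<cdot> t i = \<I>"
        "\<And>i. i \<in> {1..k} \<Longrightarrow> t i \<cdot> s i = \<I>"
      using bchoice [of "{1..k}" "\<lambda>i r. r \<in> M \<and> r \<cdot> t i = \<I> \<and> t i \<cdot> r = \<I>"] by blast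
    \<comment> \<open>Away from \<open>w\<close> the decomposition is the trivial one,
      \<open>k\<close> copies of \<open>f\<close> with coefficients \<open>\<I> / sqrt k\<close>;
      \<open>S i\<close> is the inverse of \<open>T i\<close>.\<close>
    define Y where "Y i = point_update w (y i) f" for i
    define T where "T i = point_update w (t i) (const_bcontfun ((1 / sqrt k) *\<^sub>R \<I>))" for i
    define S where "S i = point_update w (s i) (const_bcontfun (sqrt k *\<^sub>R \<I>))" for i
    have T_mem: "\<forall>v. T i v \<in> M" if "i \<in> {1..k}" for i using t [OF that] by (simp add: T_def upd)
    have S_mem: "\<forall>v. S i v \<in> M" if "i \<in> {1..k}" for i using s(1) [OF that] by (simp add: S_def upd)
    have Y_mem: "\<forall>v. Y i v \<in> M" if "i \<in> {1..k}" for i using y(1) [OF that] f_mem by (simp add: Y_def upd)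
    have "Y i \<in> closed_unit_ball C" if "i \<in> {1..k}" for i
    proof -
      have "norm (Y i v) \<le> 1" for v
        using y(2) [OF that] order_trans [OF norm_bounded f_norm] by (simp add: Y_def upd)
      then show ?thesis using Y_mem [OF that] by (simp add: closed_unit_ball_def carrier_C norm_bound)
    qed
    moreover have "T i \<in> Units C" if "i \<in> {1..k}" for i
    proof -
      have "S i \<otimes>\<^bsub>C\<^esub> T i = \<one>\<^bsub>C\<^esub>" "T i \<otimes>\<^bsub>C\<^esub> S i = \<one>\<^bsub>C\<^esub>"
        using s(2,3) [OF that] k
        by (auto intro!: bcontfun_eqI simp: mult_C one_C S_def T_def upd blinfun_compose_bilinear)
      then show ?thesis using T_mem [OF that] S_mem [OF that] by (auto simp: Units_def carrier_C)
    qed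
    moreover have "(\<Sum>i=1..k. star C (T i) \<otimes>\<^bsub>C\<^esub> T i) = \<one>\<^bsub>C\<^esub>"
    proof (rule bcontfun_eqI)
      fix v
      have "(\<Sum>i=1..k. star C (T i) \<otimes>\<^bsub>C\<^esub> T i) v = (\<Sum>i=1..k. (T i v)\<^sup>\<dagger> \<cdot> T i v)"
        unfolding sum_bcontfun_apply by (intro sum.cong refl) (simp add: mult_C star_C [OF T_mem])
      also have "\<dots> = \<I>"
        using k sum_t by (cases "v = w") (simp_all add: T_def upd blinfun_compose_bilinear sum_constant_scaleR)
      finally show "(\<Sum>i=1..k. star C (T i) \<otimes>\<^bsub>C\<^esub> T i) v = \<one>\<^bsub>C\<^esub> v" by (simp add: one_C)
    qed
    moreover have "f = (\<Sum>i=1..k. star C (T i) \<otimes>\<^bsub>C\<^esub> Y i \<otimes>\<^bsub>C\<^esub> T i)"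
    proof (rule bcontfun_eqI)
      fix v
      have "(\<Sum>i=1..k. star C (T i) \<otimes>\<^bsub>C\<^esub> Y i \<otimes>\<^bsub>C\<^esub> T i) v = (\<Sum>i=1..k. (T i v)\<^sup>\<dagger> \<cdot> Y i v \<cdot> T i v)"
        unfolding sum_bcontfun_apply by (intro sum.cong refl) (simp add: mult_C star_C [OF T_mem])
      also have "\<dots> = f v"
        using k sum_y by (cases "v = w") (simp_all add: T_def Y_def upd blinfun_compose_bilinear sum_constant_scaleR)
      finally show "f v = (\<Sum>i=1..k. star C (T i) \<otimes>\<^bsub>C\<^esub> Y i \<otimes>\<^bsub>C\<^esub> T i) v" by simp
    qed
    ultimately obtain U where U: "\<forall>i\<in>{1..k}. U i \<in> unitaries C \<and> Y i = star C (U i) \<otimes>\<^bsub>C\<^esub> f \<otimes>\<^bsub>C\<^esub> U i"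
      using f unfolding cstar_extreme_point_def C_def [symmetric] by blast
    have "U i w \<in> unitaries (operator_algebra M) \<and> y i = (U i w)\<^sup>\<dagger> \<cdot> f w \<cdot> U i w" if i: "i \<in> {1..k}" for i
    proof -
      have U_mem: "\<forall>v. U i v \<in> M" using U i by (auto simp: unitaries_def carrier_C)
      have "star C (U i) \<otimes>\<^bsub>C\<^esub> U i = \<one>\<^bsub>C\<^esub>" "U i \<otimes>\<^bsub>C\<^esub> star C (U i) = \<one>\<^bsub>C\<^esub>"
        "Y i = star C (U i) \<otimes>\<^bsub>C\<^esub> f \<otimes>\<^bsub>C\<^esub> U i"
        using U i by (auto simp: unitaries_def)
      from this [THEN arg_cong, of "\<lambda>g. apply_bcontfun g w"] show ?thesis
        using U_mem by (simp add: mult_C one_C star_C [OF U_mem] unitaries_operator_algebra Y_def upd)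
    qed
    then show ?thesis by (intro exI [of _ "\<lambda>i. U i w"]) blast
  qed simp
  then show ?thesis
    using f_mem order_trans [OF norm_bounded f_norm]
    unfolding cstar_extreme_point_def closed_unit_ball_operator_algebra
    by (simp add: operator_algebra_def)
qed

theorem proposition4p11:
  fixes M :: "('h::complex_hilbert_space \<Rightarrow>\<^sub>L 'h) set"
    and f :: "'w::t2_space \<Rightarrow>\<^sub>C ('h \<Rightarrow>\<^sub>L 'h)"
  assumes "von_neumann_algebra M"
    and "compact (UNIV :: 'w set)"
    and "closure {w :: 'w. w isolated_in UNIV} = UNIV"
    and "cstar_extreme_point (continuous_algebra M) f"
  shows "\<forall>w. cstar_extreme_point (operator_algebra M) (f w)"
proof -
  interpret vna M by standard (fact assms(1))
  have "closed (apply_bcontfun f -` maximal_partial_isometries)"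
    by (intro closed_vimage closed_maximal_partial_isometries) simp
  moreover have "{w. w isolated_in UNIV} \<subseteq> apply_bcontfun f -` maximal_partial_isometries"
    using cstar_extreme_point_at_isolated_point [OF assms(4)]
      cstar_extreme_point_imp_maximal_partial_isometry by blast
  ultimately have "f w \<in> maximal_partial_isometries" for w
    using closure_minimal assms(3) by blast
  then show ?thesis using maximal_partial_isometry_imp_cstar_extreme_point by blast
qed

end
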